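(* Let $0<\lambda\le\Lambda$, $d\ge2$, and let $F:\mathcal{S}(d)\to\mathbb{R}$ be of class $\mathcal{C}^1$ with $F(0)=0$ and $$\lambda\|N\|\le F(M+N)-F(M)\le\Lambda\|N\|\quad\text{for all } M,N\in\mathcal{S}(d)\text{ with } N\ge0,$$ and such that each $F_{ij}$ is Lipschitz continuous on $\mathcal{S}(d)$. Let $u\in W^{2,1}_{loc}(B_1)$, let $\tilde f$ be a bounded function in $B_1$, and let $m\in L^1(B_1)$ be a nonnegative weak solution to $$\left(F_{ij}(D^2u)\,m\right)_{x_ix_j}=\tilde f\quad\text{in } B_1.$$ Then $m\in L^{d/(d-1)}(B_{1/2})$ and $$\|m\|_{L^{d/(d-1)}(B_{1/2})}\le C_1\|m\|_{L^1(B_{1/2})}+C_2\|\tilde f\|_{L^\infty(B_1)},$$ where $C_1>0$ and $C_2>0$ are universal constants, i.e. depend only on $\lambda$, $\Lambda$ and $d$.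
   Context: $B_r$ is the open ball of radius $r$ in $\mathbb{R}^d$ centered at the origin. $\mathcal{S}(d)$ is the space of real symmetric $d\times d$ matrices, with a matrix norm $\|\cdot\|$; $N\ge0$ means nonnegative definite. $F_{ij}(M)=\partial F/\partial m_{ij}(M)$, and repeated indices are summed from $1$ to $d$; these satisfy $\lambda|\xi|^2\le F_{ij}(M)\xi_i\xi_j\le\Lambda|\xi|^2$ for all $M\in\mathcal{S}(d)$, $\xi\in\mathbb{R}^d$. Weak solution means $\int_{B_1}F_{ij}(D^2u)\,m\,\varphi_{x_ix_j}\,dx=\int_{B_1}\tilde f\varphi\,dx$ for every $\varphi\in\mathcal{C}^\infty_c(B_1)$. *)

theory Defs
  imports "HOL-Analysis.Analysis" "HOL-Probability.Essential_Supremum"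
begin

definition sym_mats :: "(real^'n^'n) set" where
  "sym_mats = {M. transpose M = M}"

definition nonneg_definite :: "real^'n^'n \<Rightarrow> bool" where
  "nonneg_definite N \<longleftrightarrow> N \<in> sym_mats \<and> (\<forall>\<xi>. 0 \<le> \<xi> \<bullet> (N *v \<xi>))"

text \<open>An arbitrary norm on the space of symmetric matrices; values elsewhere are irrelevant.\<close>

definition norm_on_sym :: "(real^'n^'n \<Rightarrow> real) \<Rightarrow> bool" where
  "norm_on_sym nrm \<longleftrightarrow>
     (\<forall>M\<in>sym_mats. 0 \<le> nrm M \<and> (nrm M = 0 \<longleftrightarrow> M = 0)) \<and>
     (\<forall>M\<in>sym_mats. \<forall>c. nrm (c *\<^sub>R M) = \<bar>c\<bar> * nrm M) \<and>
     (\<forall>M\<in>sym_mats. \<forall>N\<in>sym_mats. nrm (M + N) \<le> nrm M + nrm N)"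

text \<open>The coordinate direction belonging to \<open>m\<^sub>i\<^sub>j\<close> inside the symmetric matrices:
  1 at \<open>(i,i)\<close> if \<open>i = j\<close>, and 1/2 at both \<open>(i,j)\<close> and \<open>(j,i)\<close> otherwise.  With this normalisation
  the sum of \<open>F\<^sub>i\<^sub>j(M) N\<^sub>i\<^sub>j\<close> over all \<open>i\<close> and \<open>j\<close> is the derivative of \<open>F\<close> at \<open>M\<close> in direction \<open>N\<close>,
  and \<open>F\<^sub>i\<^sub>j = F\<^sub>j\<^sub>i\<close>.\<close>

definition sym_unit :: "'n \<Rightarrow> 'n \<Rightarrow> real^'n^'n" where
  "sym_unit i j = (\<chi> k l. ((if k = i \<and> l = j then 1 else 0) + (if k = j \<and> l = i then 1 else 0)) / 2)"

definition mat_partial :: "(real^'n^'n \<Rightarrow> real) \<Rightarrow> 'n \<Rightarrow> 'n \<Rightarrow> real^'n^'n \<Rightarrow> real" where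
  "mat_partial F i j M = deriv (\<lambda>t. F (M + t *\<^sub>R sym_unit i j)) 0"

definition C1_on_sym :: "(real^'n^'n \<Rightarrow> real) \<Rightarrow> bool" where
  "C1_on_sym F \<longleftrightarrow>
     (\<forall>M\<in>sym_mats. (F has_derivative
        (\<lambda>N. \<Sum>i\<in>UNIV. \<Sum>j\<in>UNIV. mat_partial F i j M * N $ i $ j)) (at M within sym_mats)) \<and>
     (\<forall>i j. continuous_on sym_mats (mat_partial F i j))"

definition uniformly_elliptic ::
    "(real^'n^'n \<Rightarrow> real) \<Rightarrow> real \<Rightarrow> real \<Rightarrow> (real^'n^'n \<Rightarrow> real) \<Rightarrow> bool" where
  "uniformly_elliptic nrm lam Lam F \<longleftrightarrow>
     (\<forall>M\<in>sym_mats. \<forall>N. nonneg_definite N \<longrightarrow>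
        lam * nrm N \<le> F (M + N) - F M \<and> F (M + N) - F M \<le> Lam * nrm N)"

definition elliptic_coeffs :: "real \<Rightarrow> real \<Rightarrow> (real^'n^'n \<Rightarrow> real) \<Rightarrow> bool" where
  "elliptic_coeffs lam Lam F \<longleftrightarrow>
     (\<forall>M\<in>sym_mats. \<forall>\<xi>.
        lam * (norm \<xi>)\<^sup>2 \<le> (\<Sum>i\<in>UNIV. \<Sum>j\<in>UNIV. mat_partial F i j M * \<xi> $ i * \<xi> $ j) \<and>
        (\<Sum>i\<in>UNIV. \<Sum>j\<in>UNIV. mat_partial F i j M * \<xi> $ i * \<xi> $ j) \<le> Lam * (norm \<xi>)\<^sup>2)"

text \<open>For norms normalised by \<open>\<parallel>\<xi>\<xi>\<^sup>T\<parallel> = |\<xi>|\<^sup>2\<close> (operator norm, Frobenius norm, any Schatten norm),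
  the coefficient bounds follow from uniform ellipticity with the same constants.  For other norms
  they fix the normalisation of \<open>lam\<close> and \<open>Lam\<close>.\<close>

lemma outer_nonneg_definite:
  fixes \<xi> :: "real^'n"
  shows "nonneg_definite (\<chi> i j. \<xi> $ i * \<xi> $ j)"
proof -
  have "y \<bullet> ((\<chi> i j. \<xi> $ i * \<xi> $ j) *v y) = (\<xi> \<bullet> y)\<^sup>2" for y :: "real^'n"
  proof -
    have "y \<bullet> ((\<chi> i j. \<xi> $ i * \<xi> $ j) *v y) =
        (\<Sum>i\<in>UNIV. \<Sum>j\<in>UNIV. y $ i * (\<xi> $ i * \<xi> $ j * y $ j))"
      by (simp add: inner_vec_def matrix_vector_mult_def sum_distrib_left)
    also have "\<dots> = (\<Sum>i\<in>UNIV. \<Sum>j\<in>UNIV. (\<xi> $ i * y $ i) * (\<xi> $ j * y $ j))"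
      by (intro sum.cong refl) (simp add: algebra_simps)
    also have "\<dots> = (\<xi> \<bullet> y)\<^sup>2"
      by (simp add: inner_vec_def power2_eq_square sum_product)
    finally show ?thesis .
  qed
  then show ?thesis
    by (simp add: nonneg_definite_def sym_mats_def transpose_def mult.commute)
qed

lemma elliptic_coeffs_if_normalised:
  fixes F :: "real^'n^'n \<Rightarrow> real"
  assumes nrm: "norm_on_sym nrm"
    and outer: "\<And>\<xi>::real^'n. nrm (\<chi> i j. \<xi> $ i * \<xi> $ j) = (norm \<xi>)\<^sup>2"
    and C1: "C1_on_sym F" and ell: "uniformly_elliptic nrm lam Lam F"
  shows "elliptic_coeffs lam Lam F"
  unfolding elliptic_coeffs_def
proof (intro ballI allI)
  fix M :: "real^'n^'n" and \<xi> :: "real^'n"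
  assume M: "M \<in> sym_mats"
  define N :: "real^'n^'n" where "N = (\<chi> i j. \<xi> $ i * \<xi> $ j)"
  define D where "D = (\<Sum>i\<in>UNIV. \<Sum>j\<in>UNIV. mat_partial F i j M * \<xi> $ i * \<xi> $ j)"
  have N: "nonneg_definite N"
    unfolding N_def by (rule outer_nonneg_definite)
  have tN: "t *\<^sub>R N \<in> sym_mats" for t
    using N by (simp add: nonneg_definite_def sym_mats_def transpose_scalar)
  have line: "M + t *\<^sub>R N \<in> sym_mats" for t
    using M tN[of t] by (simp add: sym_mats_def transpose_def vec_eq_iff)
  have "(F has_derivative (\<lambda>N. \<Sum>i\<in>UNIV. \<Sum>j\<in>UNIV. mat_partial F i j M * N $ i $ j))
      (at M within sym_mats)"
    using C1 M unfolding C1_on_sym_def by blast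
  then have dF: "(F has_derivative (\<lambda>N. \<Sum>i\<in>UNIV. \<Sum>j\<in>UNIV. mat_partial F i j M * N $ i $ j))
      (at (M + 0 *\<^sub>R N) within (\<lambda>t. M + t *\<^sub>R N) ` UNIV)"
    unfolding scaleR_zero_left add_0_right
    by (rule has_derivative_subset) (use line in blast)
  have dl: "((\<lambda>t. M + t *\<^sub>R N) has_derivative (\<lambda>t. t *\<^sub>R N)) (at 0)"
    by (auto intro!: derivative_eq_intros)
  have "((\<lambda>t. F (M + t *\<^sub>R N)) has_derivative
      (\<lambda>t. \<Sum>i\<in>UNIV. \<Sum>j\<in>UNIV. mat_partial F i j M * (t *\<^sub>R N) $ i $ j)) (at 0)"
    by (rule has_derivative_in_compose[OF dl dF])
  moreover have "(\<lambda>t. \<Sum>i\<in>UNIV. \<Sum>j\<in>UNIV. mat_partial F i j M * (t *\<^sub>R N) $ i $ j) = (*) D"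
    unfolding D_def N_def fun_eq_iff sum_distrib_right
    by (intro allI sum.cong refl) (simp add: algebra_simps)
  ultimately have "((\<lambda>t. F (M + t *\<^sub>R N)) has_real_derivative D) (at 0)"
    by (simp add: has_field_derivative_def)
  then have lim: "((\<lambda>t. (F (M + t *\<^sub>R N) - F M) / t) \<longlongrightarrow> D) (at_right 0)"
    by (auto simp: has_field_derivative_iff dest: filterlim_mono[OF _ order_refl at_le[OF subset_UNIV]])
  have bd: "lam * (norm \<xi>)\<^sup>2 \<le> (F (M + t *\<^sub>R N) - F M) / t \<and>
      (F (M + t *\<^sub>R N) - F M) / t \<le> Lam * (norm \<xi>)\<^sup>2" if "t > 0" for t
  proof -
    have "nonneg_definite (t *\<^sub>R N)"
      using N tN[of t] that by (simp add: nonneg_definite_def scaleR_matrix_vector_assoc[symmetric])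
    moreover have "nrm (t *\<^sub>R N) = t * (norm \<xi>)\<^sup>2"
      using nrm N outer[of \<xi>] that by (simp add: norm_on_sym_def nonneg_definite_def N_def)
    ultimately have "lam * (t * (norm \<xi>)\<^sup>2) \<le> F (M + t *\<^sub>R N) - F M"
      "F (M + t *\<^sub>R N) - F M \<le> Lam * (t * (norm \<xi>)\<^sup>2)"
      using ell M unfolding uniformly_elliptic_def by metis+
    then show ?thesis
      using that by (simp add: pos_le_divide_eq pos_divide_le_eq mult_ac)
  qed
  have ev: "\<forall>\<^sub>F t::real in at_right 0. t > 0"
    by (simp add: eventually_at_right_less)
  have "lam * (norm \<xi>)\<^sup>2 \<le> D"
    using lim by (rule tendsto_lowerbound) (use ev bd in \<open>auto elim: eventually_mono\<close>)
  moreover have "D \<le> Lam * (norm \<xi>)\<^sup>2"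
    using lim by (rule tendsto_upperbound) (use ev bd in \<open>auto elim: eventually_mono\<close>)
  ultimately show "lam * (norm \<xi>)\<^sup>2 \<le> (\<Sum>i\<in>UNIV. \<Sum>j\<in>UNIV. mat_partial F i j M * \<xi> $ i * \<xi> $ j) \<and>
      (\<Sum>i\<in>UNIV. \<Sum>j\<in>UNIV. mat_partial F i j M * \<xi> $ i * \<xi> $ j) \<le> Lam * (norm \<xi>)\<^sup>2"
    by (simp add: D_def)
qed

definition partial_deriv :: "'n \<Rightarrow> (real^'n \<Rightarrow> real) \<Rightarrow> real^'n \<Rightarrow> real" where
  "partial_deriv i f x = frechet_derivative f (at x) (axis i 1)"

fun partial_derivs :: "'n list \<Rightarrow> (real^'n \<Rightarrow> real) \<Rightarrow> real^'n \<Rightarrow> real" where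
  "partial_derivs [] f = f"
| "partial_derivs (i # is) f = partial_deriv i (partial_derivs is f)"

text \<open>Class \<open>C\<^sup>\<infinity>\<close>: differentiability of all iterated partial derivatives makes each of them continuous.\<close>

definition smooth_fun :: "(real^'n \<Rightarrow> real) \<Rightarrow> bool" where
  "smooth_fun f \<longleftrightarrow> (\<forall>is x. partial_derivs is f differentiable (at x))"

definition test_fun :: "(real^'n) set \<Rightarrow> (real^'n \<Rightarrow> real) \<Rightarrow> bool" where
  "test_fun \<Omega> \<phi> \<longleftrightarrow>
     smooth_fun \<phi> \<and> compact (closure {x. \<phi> x \<noteq> 0}) \<and> closure {x. \<phi> x \<noteq> 0} \<subseteq> \<Omega>"

definition loc_integrable :: "(real^'n) set \<Rightarrow> (real^'n \<Rightarrow> real) \<Rightarrow> bool" where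
  "loc_integrable \<Omega> f \<longleftrightarrow> (\<forall>K. compact K \<and> K \<subseteq> \<Omega> \<longrightarrow> integrable (lebesgue_on K) f)"

definition weak_deriv ::
    "(real^'n) set \<Rightarrow> 'n list \<Rightarrow> (real^'n \<Rightarrow> real) \<Rightarrow> (real^'n \<Rightarrow> real) \<Rightarrow> bool" where
  "weak_deriv \<Omega> is u v \<longleftrightarrow> loc_integrable \<Omega> u \<and> loc_integrable \<Omega> v \<and>
     (\<forall>\<phi>. test_fun \<Omega> \<phi> \<longrightarrow>
        (LINT x|lebesgue_on \<Omega>. u x * partial_derivs is \<phi> x) =
        (- 1) ^ length is * (LINT x|lebesgue_on \<Omega>. v x * \<phi> x))"

definition sobolev_Wk1_loc :: "nat \<Rightarrow> (real^'n) set \<Rightarrow> (real^'n \<Rightarrow> real) \<Rightarrow> bool" where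
  "sobolev_Wk1_loc k \<Omega> u \<longleftrightarrow>
     loc_integrable \<Omega> u \<and> (\<forall>is. length is \<le> k \<longrightarrow> (\<exists>v. weak_deriv \<Omega> is u v))"

text \<open>A representative of the weak Hessian; it is determined, and symmetric, only almost
  everywhere.\<close>

definition weak_hessian :: "(real^'n) set \<Rightarrow> (real^'n \<Rightarrow> real) \<Rightarrow> (real^'n \<Rightarrow> real^'n^'n) \<Rightarrow> bool" where
  "weak_hessian \<Omega> u H \<longleftrightarrow> (\<forall>i j. weak_deriv \<Omega> [i, j] u (\<lambda>x. H x $ i $ j))"

definition weak_adjoint_solution ::
    "(real^'n) set \<Rightarrow> (real^'n^'n \<Rightarrow> real) \<Rightarrow> (real^'n \<Rightarrow> real^'n^'n) \<Rightarrow>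
     (real^'n \<Rightarrow> real) \<Rightarrow> (real^'n \<Rightarrow> real) \<Rightarrow> bool" where
  "weak_adjoint_solution \<Omega> F H m f \<longleftrightarrow>
     (\<forall>\<phi>. test_fun \<Omega> \<phi> \<longrightarrow>
        (LINT x|lebesgue_on \<Omega>.
           (\<Sum>i\<in>UNIV. \<Sum>j\<in>UNIV. mat_partial F i j (H x) * m x * partial_derivs [i, j] \<phi> x)) =
        (LINT x|lebesgue_on \<Omega>. f x * \<phi> x))"

definition in_Lp :: "real \<Rightarrow> (real^'n) set \<Rightarrow> (real^'n \<Rightarrow> real) \<Rightarrow> bool" where
  "in_Lp p S f \<longleftrightarrow>
     f \<in> borel_measurable (lebesgue_on S) \<and> integrable (lebesgue_on S) (\<lambda>x. \<bar>f x\<bar> powr p)"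

definition Lp_norm :: "real \<Rightarrow> (real^'n) set \<Rightarrow> (real^'n \<Rightarrow> real) \<Rightarrow> real" where
  "Lp_norm p S f = (LINT x|lebesgue_on S. \<bar>f x\<bar> powr p) powr (1 / p)"

definition Linf_norm :: "(real^'n) set \<Rightarrow> (real^'n \<Rightarrow> real) \<Rightarrow> real" where
  "Linf_norm S f = real_of_ereal (esssup (lebesgue_on S) (\<lambda>x. ereal \<bar>f x\<bar>))"

end

theory Submission
  imports Defs
begin

text \<open>
  The bound is dual to an Alexandrov estimate.  For \<open>g > 0\<close> one needs a smooth convex \<open>\<Psi>\<close> with
  \<open>\<Delta>\<Psi> \<ge> g\<close> on the half ball whose size and slope on the unit ball are at most \<open>C \<parallel>g\<parallel>\<close> in
  \<open>L\<^sup>d\<close>.  Since \<open>D\<^sup>2\<Psi> \<ge> 0\<close>, every coefficient matrix \<open>a \<ge> \<lambda>\<close>, however irregular, satisfies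
  \<open>a\<^sub>i\<^sub>j \<Psi>\<^sub>i\<^sub>j \<ge> \<lambda> \<Delta>\<Psi>\<close>.

  Such a \<open>\<Psi>\<close> is a mollified solution of a discrete Monge--Ampere problem: over a fine net of points
  \<open>x\<^sub>k\<close> one takes a maximal vector of depths for which the set of slopes of supporting planes at
  each \<open>x\<^sub>k\<close> has volume at most that of a ball of radius \<open>r\<^sub>k\<close>.  These sets cover a ball of slopes,
  which bounds the depths by the \<open>d\<close>-th root of the sum of the \<open>r\<^sub>k\<^sup>d\<close>, and by maximality each \<open>x\<^sub>k\<close>
  carries two slopes at distance \<open>r\<^sub>k\<close>, a kink that mollification turns into a Laplacian of the
  required size.

  The equation is tested with \<open>\<eta> (\<Psi> + 2S)\<close>, where \<open>S\<close> bounds \<open>\<Psi>\<close> and its gradient and \<open>\<eta>\<close> is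
  a steep exponential cutoff.  Outside the half ball \<open>a\<^sub>i\<^sub>j \<eta>\<^sub>i\<^sub>j\<close> dominates the gradient of \<open>\<eta>\<close>,
  so all error terms live on the half ball; this is why the \<open>L\<^sup>1\<close> norm over the half ball suffices on
  the right-hand side.  Duality then gives the \<open>L\<close> norm with exponent \<open>d/(d-1)\<close>.
\<close>

section \<open>Smooth functions\<close>

text \<open>The coefficients, as functions of x, are merely measurable, so the test function cannot
  follow them and has to work for all elliptic matrices at once. The natural candidate, a solution
  of det D^2 Psi = g^d, needs a regularity theory before the equation can be tested with it; hence
  the detour through a discrete problem. The scaling explains the exponent d. A jump r_k of the
  slope, smoothed at length L, yields a Laplacian of order r_k / L, so r_k is taken to be a multiple
  of L g(x_k). When the mesh h is a fixed fraction of L, small enough for a kink to be felt up to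
  distance h, the sum of the r_k^d is a multiple of the sum of h^d g(x_k)^d, which the integral of
  g^d controls uniformly in h. Positivity of g provides a positive minimum on the closed unit ball,
  against which the oscillation of g between neighbouring nodes and the error in the depths can be
  made small. On the dual side the weight is a power of m itself, truncated so that its integral is
  finite before it is divided out; d/(d-1) is the exponent conjugate to d.\<close>

lemma partial_deriv_eq:
  "(f has_derivative f') (at x) \<Longrightarrow> partial_deriv i f x = f' (axis i 1)"
  unfolding partial_deriv_def by (simp add: frechet_derivative_at[symmetric])

text \<open>Closure under products is proved by induction on the order, for all pairs of functions
  at once, so that the product rule is applied once per step. Iterated derivatives along a fixed
  list would need the full Leibniz formula.\<close>

primrec n_diff :: "nat \<Rightarrow> (real^'n \<Rightarrow> real) \<Rightarrow> bool" where
  "n_diff 0 f \<longleftrightarrow> True"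
| "n_diff (Suc n) f \<longleftrightarrow> (\<forall>x. f differentiable (at x)) \<and> (\<forall>i. n_diff n (partial_deriv i f))"

lemma partial_derivs_append: "partial_derivs (is @ js) f = partial_derivs is (partial_derivs js f)"
  by (induction "is") auto

lemma smooth_fun_partial: "smooth_fun f \<Longrightarrow> smooth_fun (partial_deriv i f)"
  unfolding smooth_fun_def
  by (metis partial_derivs_append partial_derivs.simps)

lemma smooth_fun_partials: "smooth_fun f \<Longrightarrow> smooth_fun (partial_derivs is f)"
  unfolding smooth_fun_def by (metis partial_derivs_append)

lemma smooth_fun_differentiable: "smooth_fun f \<Longrightarrow> f differentiable (at x)"
  unfolding smooth_fun_def by (metis partial_derivs.simps(1))

text \<open>Iterated derivatives never leave \<open>P\<close>. Smoothness proofs thus reduce to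
  finding a class closed under \<open>partial_deriv\<close>, such as all convolutions of a fixed
  \<open>w\<close> with varying kernels.\<close>

lemma smooth_fun_coinduct:
  assumes "P f" and "\<And>g x. P g \<Longrightarrow> g differentiable (at x)"
    and "\<And>g i. P g \<Longrightarrow> P (partial_deriv i g)"
  shows "smooth_fun f"
proof -
  have "P (partial_derivs is f)" for "is"
    by (induction "is") (auto intro: assms)
  then show ?thesis
    unfolding smooth_fun_def using assms(2) by blast
qed

lemma smooth_fun_imp_n_diff: "smooth_fun f \<Longrightarrow> n_diff n f"
  by (induction n arbitrary: f) (auto intro: smooth_fun_differentiable smooth_fun_partial)

lemma smooth_fun_iff_n_diff: "smooth_fun f \<longleftrightarrow> (\<forall>n. n_diff n f)"
proof
  assume "\<forall>n. n_diff n f"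
  then show "smooth_fun f"
    by (rule smooth_fun_coinduct[where P="\<lambda>f. \<forall>n. n_diff n f"]) (metis n_diff.simps(2))+
qed (use smooth_fun_imp_n_diff in blast)

lemma n_diff_mono: "n_diff (Suc n) f \<Longrightarrow> n_diff n f"
  by (induction n arbitrary: f) auto

lemma has_derivative_partial:
  assumes "f differentiable (at x)"
  shows "(f has_derivative (\<lambda>v. \<Sum>i\<in>UNIV. v $ i * partial_deriv i f x)) (at x)"
proof -
  have d: "(f has_derivative frechet_derivative f (at x)) (at x)"
    using assms frechet_derivative_works by blast
  interpret bounded_linear "frechet_derivative f (at x)"
    using d has_derivative_bounded_linear by blast
  have "frechet_derivative f (at x) v = (\<Sum>i\<in>UNIV. v $ i * partial_deriv i f x)" for v
  proof -
    have "frechet_derivative f (at x) v = frechet_derivative f (at x) (\<Sum>i\<in>UNIV. v $ i *\<^sub>R axis i 1)"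
      using basis_expansion[of v] by (simp add: scalar_mult_eq_scaleR)
    also have "\<dots> = (\<Sum>i\<in>UNIV. v $ i * partial_deriv i f x)"
      by (simp add: sum scaleR partial_deriv_def)
    finally show ?thesis .
  qed
  then show ?thesis using d by (metis (no_types, lifting) has_derivative_eq_rhs ext)
qed

lemma partial_deriv_add:
  assumes "\<And>x. f differentiable (at x)" "\<And>x. g differentiable (at x)"
  shows "partial_deriv i (\<lambda>x. f x + g x) = (\<lambda>x. partial_deriv i f x + partial_deriv i g x)"
proof
  fix x
  show "partial_deriv i (\<lambda>x. f x + g x) x = partial_deriv i f x + partial_deriv i g x"
    using has_derivative_add[OF assms[unfolded frechet_derivative_works]]
    by (subst partial_deriv_eq) (auto simp: partial_deriv_def)
qed

lemma partial_deriv_mult: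
  assumes "\<And>x. f differentiable (at x)" "\<And>x. g differentiable (at x)"
  shows "partial_deriv i (\<lambda>x. f x * g x) = (\<lambda>x. partial_deriv i f x * g x + f x * partial_deriv i g x)"
proof
  fix x
  show "partial_deriv i (\<lambda>x. f x * g x) x = partial_deriv i f x * g x + f x * partial_deriv i g x"
    using has_derivative_mult[OF assms[unfolded frechet_derivative_works]]
    by (subst partial_deriv_eq) (auto simp: partial_deriv_def add.commute)
qed

lemma partial_deriv_comp:
  assumes "\<And>s::real. (h has_real_derivative h' s) (at s)" "\<And>x. g differentiable (at x)"
  shows "partial_deriv i (\<lambda>x. h (g x)) = (\<lambda>x. h' (g x) * partial_deriv i g x)"
proof
  fix x
  show "partial_deriv i (\<lambda>x. h (g x)) x = h' (g x) * partial_deriv i g x"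
    using has_derivative_compose[OF assms(2)[unfolded frechet_derivative_works] assms(1)[unfolded has_field_derivative_def]]
    by (subst partial_deriv_eq) (auto simp: partial_deriv_def)
qed

lemma partial_deriv_const: "partial_deriv i (\<lambda>x. c) = (\<lambda>x. 0)"
  by (rule ext, subst partial_deriv_eq[OF has_derivative_const]) simp

lemma partial_deriv_component: "partial_deriv i (\<lambda>x. x $ j) = (\<lambda>x. if i = j then 1 else 0)"
  by (rule ext, subst partial_deriv_eq[OF bounded_linear_imp_has_derivative[OF bounded_linear_vec_nth]])
    (simp add: axis_def)

lemma smooth_fun_const [simp, intro]: "smooth_fun (\<lambda>x. c)"
  by (rule smooth_fun_coinduct[where P="\<lambda>f. \<exists>c. f = (\<lambda>x. c)"]) (auto simp: partial_deriv_const)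

lemma smooth_fun_component [simp, intro]: "smooth_fun (\<lambda>x. x $ j)"
  by (rule smooth_fun_coinduct[where P="\<lambda>f. f = (\<lambda>x. x $ j) \<or> (\<exists>c. f = (\<lambda>x. c))"])
    (auto simp: partial_deriv_const partial_deriv_component
       intro: bounded_linear_imp_differentiable bounded_linear_vec_nth)

lemma n_diff_add: "n_diff n f \<Longrightarrow> n_diff n g \<Longrightarrow> n_diff n (\<lambda>x. f x + g x)"
  by (induction n arbitrary: f g) (auto simp: partial_deriv_add)

lemma n_diff_mult: "n_diff n f \<Longrightarrow> n_diff n g \<Longrightarrow> n_diff n (\<lambda>x. f x * g x)"
proof (induction n arbitrary: f g)
  case (Suc n)
  then show ?case
    by (auto simp: partial_deriv_mult intro!: n_diff_add Suc.IH dest: n_diff_mono[OF iffD2[OF n_diff.simps(2)], OF conjI])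
qed auto

lemma smooth_fun_add [intro]: "smooth_fun f \<Longrightarrow> smooth_fun g \<Longrightarrow> smooth_fun (\<lambda>x. f x + g x)"
  by (simp add: smooth_fun_iff_n_diff n_diff_add)

lemma smooth_fun_mult [intro]: "smooth_fun f \<Longrightarrow> smooth_fun g \<Longrightarrow> smooth_fun (\<lambda>x. f x * g x)"
  by (simp add: smooth_fun_iff_n_diff n_diff_mult)

lemma smooth_fun_uminus [intro]: "smooth_fun f \<Longrightarrow> smooth_fun (\<lambda>x. - f x)"
  using smooth_fun_mult[OF smooth_fun_const[of "-1"], of f] by simp

lemma smooth_fun_diff [intro]: "smooth_fun f \<Longrightarrow> smooth_fun g \<Longrightarrow> smooth_fun (\<lambda>x. f x - g x)"
  using smooth_fun_add[OF _ smooth_fun_uminus, of f g] by simp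

lemma smooth_fun_sum [intro]:
  "finite I \<Longrightarrow> (\<And>i. i \<in> I \<Longrightarrow> smooth_fun (f i)) \<Longrightarrow> smooth_fun (\<lambda>x. \<Sum>i\<in>I. f i x)"
  by (induction I rule: finite_induct) auto

text \<open>The chain rule turns \<open>h p\<close> into \<open>h (D p)\<close> times a derivative
  of \<open>g\<close>, so the induction on the order runs over the whole family. It is meant for the
  family \<open>exp_recip\<close>.\<close>

lemma smooth_fun_comp_family:
  assumes h: "\<And>p s::real. p \<in> P \<Longrightarrow> (h p has_real_derivative h (D p) s) (at s)"
    and D: "\<And>p. p \<in> P \<Longrightarrow> D p \<in> P" and p: "p \<in> P" and g: "smooth_fun g"
  shows "smooth_fun (\<lambda>x. h p (g x))"
proof -
  have gd: "g differentiable (at x)" for x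
    using g by (rule smooth_fun_differentiable)
  have "n_diff n (\<lambda>x. h p (g x))" if "p \<in> P" for n p
    using that
  proof (induction n arbitrary: p)
    case (Suc n)
    have "(\<lambda>x. h p (g x)) differentiable (at x)" for x
      using differentiable_chain_at[OF gd, of "h p"] h[OF Suc.prems]
      by (auto simp: o_def real_differentiable_def)
    then show ?case
      using Suc D g
      by (auto simp: partial_deriv_comp[OF h gd] intro!: n_diff_mult smooth_fun_imp_n_diff[OF smooth_fun_partial])
  qed auto
  then show ?thesis using p by (simp add: smooth_fun_iff_n_diff)
qed

section \<open>Functions p(1/s) exp(-1/s), flat at the origin\<close>

definition exp_recip :: "real poly \<Rightarrow> real \<Rightarrow> real" where
  "exp_recip p s = (if s > 0 then poly p (1 / s) * exp (- 1 / s) else 0)"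

text \<open>With y = 1/s, the derivative in s of p(y) exp(-y) is y^2 (p(y) - p'(y)) exp(-y); the
  family indexed by polynomials is closed under differentiation.\<close>

definition exp_recip_deriv :: "real poly \<Rightarrow> real poly" where
  "exp_recip_deriv p = monom 1 2 * (p - pderiv p)"

lemma exp_recip_tendsto_0: "((\<lambda>s. poly p (1 / s) * exp (- 1 / s)) \<longlongrightarrow> 0) (at_right (0::real))"
proof -
  have "((\<lambda>y. poly p y / exp y) \<longlongrightarrow> 0) (at_top :: real filter)"
  proof -
    have "((\<lambda>y. \<Sum>i\<le>degree p. coeff p i * (y ^ i / exp y)) \<longlongrightarrow> (\<Sum>i\<le>degree p. coeff p i * 0))
        (at_top :: real filter)"
      by (intro tendsto_intros tendsto_power_div_exp_0)
    then show ?thesis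
      by (simp add: poly_altdef sum_divide_distrib)
  qed
  then have "((\<lambda>s. poly p (inverse s) / exp (inverse s)) \<longlongrightarrow> 0) (at_right 0)"
    by (rule filterlim_compose) (rule filterlim_inverse_at_top_right)
  then show ?thesis
    by (simp add: exp_minus inverse_eq_divide divide_simps)
qed

lemma exp_recip_has_derivative:
  "(exp_recip p has_real_derivative exp_recip (exp_recip_deriv p) s) (at s)"
proof (cases "s > 0")
  case True
  have "((\<lambda>s. poly p (1 / s) * exp (- 1 / s)) has_real_derivative
      exp_recip (exp_recip_deriv p) s) (at s)"
    using True by (auto intro!: derivative_eq_intros poly_DERIV[THEN DERIV_chain2]
      simp: exp_recip_def exp_recip_deriv_def poly_monom power2_eq_square field_simps)
  then show ?thesis
    by (rule has_field_derivative_transform_within_open[where S="{0<..}"])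
      (use True in \<open>auto simp: exp_recip_def\<close>)
next
  case False
  show ?thesis
  proof (cases "s < 0")
    case True
    have "((\<lambda>s. 0) has_real_derivative exp_recip (exp_recip_deriv p) s) (at s)"
      using True by (auto simp: exp_recip_def)
    then show ?thesis
      by (rule has_field_derivative_transform_within_open[where S="{..<0}"])
        (use True in \<open>auto simp: exp_recip_def\<close>)
  next
    case False
    with \<open>\<not> s > 0\<close> have s: "s = 0" by simp
    \<comment> \<open>For h > 0 the difference quotient at 0 belongs to the polynomial y p(y), which
      is \<open>pCons 0 p\<close>, so the same limit covers it.\<close>
    have "((\<lambda>h. exp_recip p h / h) \<longlongrightarrow> 0) (at_right 0)"
      using exp_recip_tendsto_0[of "pCons 0 p"]
      by (rule Lim_transform_eventually)
        (auto simp: exp_recip_def eventually_at_filter divide_simps)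
    moreover have "((\<lambda>h. exp_recip p h / h) \<longlongrightarrow> 0) (at_left 0)"
      by (rule Lim_transform_eventually[OF tendsto_const])
        (auto simp: exp_recip_def eventually_at_filter divide_simps)
    ultimately have "((\<lambda>h. exp_recip p h / h) \<longlongrightarrow> 0) (at 0)"
      by (simp add: filterlim_split_at)
    then show ?thesis
      by (simp add: s DERIV_def exp_recip_def)
  qed
qed

lemma smooth_fun_exp_recip: "smooth_fun g \<Longrightarrow> smooth_fun (\<lambda>x. exp_recip p (g x))"
  by (rule smooth_fun_comp_family[where P=UNIV and D=exp_recip_deriv])
    (auto intro: exp_recip_has_derivative)

lemma partial_deriv_exp_recip:
  "smooth_fun g \<Longrightarrow> partial_deriv i (\<lambda>x. exp_recip p (g x)) =
     (\<lambda>x. exp_recip (exp_recip_deriv p) (g x) * partial_deriv i g x)"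
  by (rule partial_deriv_comp[OF exp_recip_has_derivative smooth_fun_differentiable])

definition bump :: "real \<Rightarrow> real" where "bump = exp_recip 1"
definition bump' :: "real \<Rightarrow> real" where "bump' = exp_recip (exp_recip_deriv 1)"
definition bump'' :: "real \<Rightarrow> real" where "bump'' = exp_recip (exp_recip_deriv (exp_recip_deriv 1))"

lemma bump_simps:
  "s > 0 \<Longrightarrow> bump s = exp (- 1 / s)"
  "s > 0 \<Longrightarrow> bump' s = exp (- 1 / s) / s\<^sup>2"
  "s > 0 \<Longrightarrow> bump'' s = exp (- 1 / s) * (1 / s ^ 4 - 2 / s ^ 3)"
  "s \<le> 0 \<Longrightarrow> bump s = 0" "s \<le> 0 \<Longrightarrow> bump' s = 0" "s \<le> 0 \<Longrightarrow> bump'' s = 0"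
  by (auto simp: bump_def bump'_def bump''_def exp_recip_def exp_recip_deriv_def poly_monom
      pderiv_diff pderiv_mult pderiv_monom field_simps power2_eq_square power3_eq_cube power4_eq_xxxx)

lemma bump_nonneg: "0 \<le> bump s" and bump'_nonneg: "0 \<le> bump' s"
  by (cases "s > 0"; simp add: bump_simps)+

lemma bump_le_1: "bump s \<le> 1"
  by (cases "s > 0") (auto simp: bump_simps)

section \<open>Mollification\<close>

lemma lborel_integral_affine:
  fixes f :: "'a::euclidean_space \<Rightarrow> real"
  assumes f: "f \<in> borel_measurable borel" and c: "c \<noteq> (0::real)"
  shows "integral\<^sup>L lborel f = \<bar>c\<bar> ^ DIM('a) * (\<integral>x. f (t + c *\<^sub>R x) \<partial>lborel)"
proof -
  have "integral\<^sup>L lborel f = integral\<^sup>L (density (distr lborel borel (\<lambda>x. t + c *\<^sub>R x)) (\<lambda>_. \<bar>c\<bar> ^ DIM('a))) f"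
    using lborel_affine[OF c, of t] by simp
  also have "\<dots> = (\<integral>x. \<bar>c\<bar> ^ DIM('a) * f (t + c *\<^sub>R x) \<partial>lborel)"
    using f by (subst integral_density) (auto simp: integral_distr)
  finally show ?thesis by simp
qed

section \<open>Smoothness of convolutions with a compactly supported kernel\<close>

definition unit_supp :: "(real^'n \<Rightarrow> real) \<Rightarrow> bool" where
  "unit_supp k \<longleftrightarrow> (\<forall>y. norm y > 1 \<longrightarrow> k y = 0)"

text \<open>The point x enters only through the kernel, so every derivative falls on
  \<open>k\<close> and \<open>w\<close> need only be continuous. As \<open>k\<close> is taken at z -
  x, each derivative brings a minus sign, which cancels in second order.\<close>

definition conv :: "(real^'n \<Rightarrow> real) \<Rightarrow> (real^'n \<Rightarrow> real) \<Rightarrow> real^'n \<Rightarrow> real" where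
  "conv w k x = (\<integral>z. w z * k (z - x) \<partial>lborel)"

lemma smooth_fun_continuous: "smooth_fun f \<Longrightarrow> continuous_on S f"
  by (meson continuous_at_imp_continuous_on differentiable_imp_continuous_within smooth_fun_differentiable)

lemma integrable_continuous_bounded_support:
  fixes f :: "real^'n \<Rightarrow> real"
  assumes "continuous_on UNIV f" and "\<And>y. norm y > r \<Longrightarrow> f y = 0"
  shows "integrable lborel f"
proof -
  have "integrable lborel (\<lambda>x. indicator (cball 0 r) x *\<^sub>R f x)"
    by (rule borel_integrable_compact) (auto intro: continuous_on_subset[OF assms(1)])
  moreover have "(\<lambda>x. indicator (cball 0 r) x *\<^sub>R f x) = f"
    using assms(2) by (auto simp: indicator_def fun_eq_iff)
  ultimately show ?thesis by simp
qed

lemma lborel_integral_eq_box: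
  fixes f :: "real^'n \<Rightarrow> real"
  assumes c: "continuous_on UNIV f" and z: "\<And>y. norm y > r \<Longrightarrow> f y = 0" and a: "cball 0 r \<subseteq> cbox (-a) a"
  shows "integral\<^sup>L lborel f = integral (cbox (-a) a) f"
proof -
  have "(f has_integral integral (cbox (-a) a) f) (cbox (-a) a)"
    by (intro integrable_integral integrable_continuous continuous_on_subset[OF c]) auto
  then have 1: "(f has_integral integral (cbox (-a) a) f) UNIV"
    by (rule has_integral_on_superset) (use z a in \<open>force simp: subset_iff\<close>)+
  show ?thesis
    using has_integral_integral_lborel[OF integrable_continuous_bounded_support[OF c z]] 1
    by (rule has_integral_unique)
qed

lemma integrable_mult_unit_supp:
  fixes w :: "real^'n \<Rightarrow> real"
  assumes "continuous_on UNIV w" "continuous_on UNIV k" "unit_supp k"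
  shows "integrable lborel (\<lambda>y. w y * k y)"
  by (rule integrable_continuous_bounded_support[where r=1])
    (use assms in \<open>auto simp: unit_supp_def intro!: continuous_intros\<close>)

lemma conv_eq:
  assumes "continuous_on UNIV w" "continuous_on UNIV k"
  shows "conv w k x = (\<integral>y. w (x + y) * k y \<partial>lborel)"
proof -
  have "(\<lambda>z. w z * k (z - x)) \<in> borel_measurable borel"
    by (intro borel_measurable_continuous_onI continuous_intros
        continuous_on_compose2[OF assms(2)] assms) auto
  from lborel_integral_affine[OF this, of 1 x] show ?thesis
    by (simp add: conv_def)
qed

lemma unit_supp_partial:
  assumes "unit_supp k" and "smooth_fun k"
  shows "unit_supp (partial_deriv i k)"
  unfolding unit_supp_def
proof (intro allI impI)
  fix y :: "real^'a" assume y: "norm y > 1"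
  have "(k has_derivative (\<lambda>_. 0)) (at y)"
  proof (rule has_derivative_transform_within_open[where s="- cball 0 1"])
    show "((\<lambda>_. 0) has_derivative (\<lambda>_. 0)) (at y)" by simp
  qed (use y assms in \<open>auto simp: unit_supp_def\<close>)
  then show "partial_deriv i k y = 0" by (subst partial_deriv_eq) auto
qed

text \<open>Differentiation under the integral sign, over one box that contains the support of the
  shifted kernel for every x near x0.\<close>

lemma has_derivative_conv:
  fixes w k :: "real^'n \<Rightarrow> real"
  assumes w: "continuous_on UNIV w" and k: "smooth_fun k" "unit_supp k"
  shows "(conv w k has_derivative (\<lambda>v. \<Sum>i\<in>UNIV. v $ i * conv w (\<lambda>y. - partial_deriv i k y) x0)) (at x0)"
proof -
  \<comment> \<open>Points within 1 of x0 have norm below |x0| + 1, and the kernel reaches 1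
    further.\<close>
  obtain a :: "real^'n" where a: "cball 0 (norm x0 + 2) \<subseteq> cbox (-a) a"
    using bounded_subset_cbox_symmetric[OF bounded_cball] by blast
  let ?U = "ball x0 1"
  define G :: "real^'n \<Rightarrow> real^'n" where "G y = (\<chi> i. - partial_deriv i k y)" for y
  have contk: "continuous_on S k" for S using k smooth_fun_continuous by blast
  have contp: "continuous_on S (partial_deriv i k)" for S i
    using k smooth_fun_continuous smooth_fun_partial by blast
  have contG: "continuous_on S G" for S
    unfolding G_def by (intro continuous_intros contp)
  have to_box: "conv w u x = integral (cbox (-a) a) (\<lambda>z. w z * u (z - x))"
    if "x \<in> ?U" "continuous_on UNIV u" "unit_supp u" for u :: "real^'n \<Rightarrow> real" and x
    unfolding conv_def
  proof (rule lborel_integral_eq_box[OF _ _ a])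
    show "continuous_on UNIV (\<lambda>z. w z * u (z - x))"
      by (intro continuous_intros w continuous_on_compose2[OF that(2)]) auto
    fix z :: "real^'n" assume "norm x0 + 2 < norm z"
    moreover have "norm x < norm x0 + 1"
      using that(1) norm_triangle_ineq2[of x x0] by (simp add: dist_norm norm_minus_commute)
    ultimately have "norm (z - x) > 1" using norm_triangle_ineq2[of z x] by linarith
    then show "w z * u (z - x) = 0" using \<open>unit_supp u\<close> by (simp add: unit_supp_def)
  qed
  have "((\<lambda>x. integral (cbox (-a) a) (\<lambda>z. w z * k (z - x))) has_derivative
      integral (cbox (-a) a) (\<lambda>z. blinfun_inner_left (w z *\<^sub>R G (z - x0)))) (at x0 within ?U)"
  proof (rule leibniz_rule)
    fix x t assume "x \<in> ?U"
    have "((\<lambda>x. k (t - x)) has_derivative (\<lambda>v. \<Sum>i\<in>UNIV. (- v) $ i * partial_deriv i k (t - x))) (at x)"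
      by (rule has_derivative_compose[OF _ has_derivative_partial[OF smooth_fun_differentiable[OF k(1)]],
            of "\<lambda>x. t - x" "\<lambda>v. - v"]) (auto intro!: derivative_eq_intros)
    then have "((\<lambda>x. w t * k (t - x)) has_derivative (\<lambda>v. w t * (\<Sum>i\<in>UNIV. (- v) $ i * partial_deriv i k (t - x)))) (at x)"
      by (rule has_derivative_mult_right)
    moreover have "(\<lambda>v. w t * (\<Sum>i\<in>UNIV. (- v) $ i * partial_deriv i k (t - x)))
        = blinfun_apply (blinfun_inner_left (w t *\<^sub>R G (t - x)))"
      by (auto simp: G_def inner_vec_def sum_distrib_left fun_eq_iff blinfun_inner_left.rep_eq intro!: sum.cong)
    ultimately show "((\<lambda>x. w t * k (t - x)) has_derivative
        blinfun_apply (blinfun_inner_left (w t *\<^sub>R G (t - x)))) (at x within ?U)"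
      by (metis has_derivative_at_withinI)
  next
    fix x assume "x \<in> ?U"
    show "(\<lambda>z. w z * k (z - x)) integrable_on cbox (-a) a"
      by (intro integrable_continuous continuous_intros continuous_on_subset[OF w]
          continuous_on_compose2[OF contk[of UNIV]]) auto
  next
    show "continuous_on (?U \<times> cbox (-a) a) (\<lambda>(x, t). blinfun_inner_left (w t *\<^sub>R G (t - x)))"
      unfolding split_beta
      by (intro continuous_intros continuous_on_compose2[OF w] continuous_on_compose2[OF contG[of UNIV]]
          bounded_linear.continuous_on[OF bounded_linear_blinfun_inner_left]) auto
  qed auto
  moreover have "blinfun_apply (integral (cbox (-a) a) (\<lambda>z. blinfun_inner_left (w z *\<^sub>R G (z - x0)))) v
      = (\<Sum>i\<in>UNIV. v $ i * conv w (\<lambda>y. - partial_deriv i k y) x0)" for v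
  proof -
    have int: "(\<lambda>z. blinfun_inner_left (w z *\<^sub>R G (z - x0))) integrable_on cbox (-a) a"
      by (intro integrable_continuous continuous_intros continuous_on_subset[OF w] 
          continuous_on_compose2[OF contG[of UNIV]]
          bounded_linear.continuous_on[OF bounded_linear_blinfun_inner_left]) auto
    have "blinfun_apply (integral (cbox (-a) a) (\<lambda>z. blinfun_inner_left (w z *\<^sub>R G (z - x0)))) v
       = integral (cbox (-a) a) (\<lambda>z. blinfun_apply (blinfun_inner_left (w z *\<^sub>R G (z - x0))) v)"
      by (rule blinfun_apply_integral[OF int])
    also have "\<dots> = integral (cbox (-a) a) (\<lambda>z. \<Sum>i\<in>UNIV. v $ i * (w z * - partial_deriv i k (z - x0)))"
      by (auto simp: blinfun_inner_left.rep_eq inner_vec_def G_def intro!: integral_cong sum.cong)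
    also have "\<dots> = (\<Sum>i\<in>UNIV. v $ i * integral (cbox (-a) a) (\<lambda>z. w z * - partial_deriv i k (z - x0)))"
      by (subst integral_sum) (auto intro!: integrable_continuous continuous_intros continuous_on_subset[OF w]
          continuous_on_compose2[OF contp[of UNIV]])
    also have "\<dots> = (\<Sum>i\<in>UNIV. v $ i * conv w (\<lambda>y. - partial_deriv i k y) x0)"
      using unit_supp_partial[OF k(2,1)]
      by (intro sum.cong refl arg_cong2[where f="(*)"] to_box[symmetric])
        (auto simp: unit_supp_def intro!: continuous_intros contp)
    finally show ?thesis .
  qed
  ultimately have "((\<lambda>x. integral (cbox (-a) a) (\<lambda>z. w z * k (z - x))) has_derivative
      (\<lambda>v. \<Sum>i\<in>UNIV. v $ i * conv w (\<lambda>y. - partial_deriv i k y) x0)) (at x0 within ?U)"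
    by (metis (no_types, lifting) has_derivative_eq_rhs ext)
  then have "((\<lambda>x. integral (cbox (-a) a) (\<lambda>z. w z * k (z - x))) has_derivative
      (\<lambda>v. \<Sum>i\<in>UNIV. v $ i * conv w (\<lambda>y. - partial_deriv i k y) x0)) (at x0)"
    by (subst (asm) at_within_open) auto
  then show ?thesis
    by (rule has_derivative_transform_within_open[where s="?U"]) (auto simp: to_box contk k)
qed

lemma partial_deriv_conv:
  assumes "continuous_on UNIV w" "smooth_fun k" "unit_supp k"
  shows "partial_deriv i (conv w k) = conv w (\<lambda>y. - partial_deriv i k y)"
  by (rule ext, subst partial_deriv_eq[OF has_derivative_conv[OF assms]])
    (simp add: axis_def if_distrib[of "\<lambda>x. x * _"] cong: if_cong)

lemma smooth_fun_conv:
  assumes w: "continuous_on UNIV w" and "smooth_fun k" "unit_supp k"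
  shows "smooth_fun (conv w k)"
proof (rule smooth_fun_coinduct[where P="\<lambda>f. \<exists>k. smooth_fun k \<and> unit_supp k \<and> f = conv w k"])
  show "g differentiable (at x)" if "\<exists>k. smooth_fun k \<and> unit_supp k \<and> g = conv w k" for g x
    using that has_derivative_conv[OF w] unfolding differentiable_def by blast
  show "\<exists>k. smooth_fun k \<and> unit_supp k \<and> partial_deriv i g = conv w k"
    if "\<exists>k. smooth_fun k \<and> unit_supp k \<and> g = conv w k" for g i
  proof -
    from that obtain k where k: "smooth_fun k" "unit_supp k" "g = conv w k" by blast
    moreover have "unit_supp (\<lambda>y. - partial_deriv i k y)"
      using unit_supp_partial[OF k(2,1)] by (auto simp: unit_supp_def)
    ultimately show ?thesis
      using partial_deriv_conv[OF w k(1,2)] smooth_fun_uminus smooth_fun_partial by blast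
  qed
qed (use assms in auto)

lemma partial_deriv_uminus:
  assumes "smooth_fun f"
  shows "partial_deriv i (\<lambda>x. - f x) = (\<lambda>x. - partial_deriv i f x)"
  using partial_deriv_mult[OF smooth_fun_differentiable[OF smooth_fun_const[of "-1"]]
      smooth_fun_differentiable[OF assms], of i] by (simp add: partial_deriv_const)

lemma partial_derivs_conv2:
  assumes w: "continuous_on UNIV w" and k: "smooth_fun k" "unit_supp k"
  shows "partial_derivs [i, j] (conv w k) = conv w (partial_derivs [i, j] k)"
proof -
  have "unit_supp (\<lambda>y. - partial_deriv j k y)"
    using unit_supp_partial[OF k(2,1)] by (auto simp: unit_supp_def)
  then show ?thesis
    using k by (simp add: partial_deriv_conv[OF w] partial_deriv_uminus smooth_fun_partial smooth_fun_uminus)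
qed

lemma partial_deriv_scale:
  assumes "smooth_fun f"
  shows "partial_deriv i (\<lambda>x. f (c *\<^sub>R x)) = (\<lambda>x. c * partial_deriv i f (c *\<^sub>R x))"
proof
  fix x
  have "((\<lambda>x. f (c *\<^sub>R x)) has_derivative (\<lambda>v. frechet_derivative f (at (c *\<^sub>R x)) (c *\<^sub>R v))) (at x)"
    by (rule has_derivative_compose[OF _ smooth_fun_differentiable[OF assms, unfolded frechet_derivative_works]])
      (auto intro!: derivative_eq_intros)
  then show "partial_deriv i (\<lambda>x. f (c *\<^sub>R x)) x = c * partial_deriv i f (c *\<^sub>R x)"
    using linear_frechet_derivative[OF smooth_fun_differentiable[OF assms]]
    by (subst partial_deriv_eq) (auto simp: partial_deriv_def linear_cmul)
qed

lemma smooth_fun_scale: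
  assumes f: "smooth_fun f"
  shows "smooth_fun (\<lambda>x. f (c *\<^sub>R x))"
proof (rule smooth_fun_coinduct[where P="\<lambda>g. \<exists>a f. smooth_fun f \<and> g = (\<lambda>x. a * f (c *\<^sub>R x))"])
  have d: "(\<lambda>x. f (c *\<^sub>R x)) differentiable (at x)" if "smooth_fun f" for f x
    using differentiable_chain_at[OF _ smooth_fun_differentiable[OF that], of "\<lambda>x. c *\<^sub>R x" x]
    by (auto simp: o_def intro!: derivative_intros)
  then show "g differentiable (at x)" if "\<exists>a f. smooth_fun f \<and> g = (\<lambda>x. a * f (c *\<^sub>R x))" for g x
    using that by (auto intro!: derivative_intros)
  show "\<exists>a f. smooth_fun f \<and> partial_deriv i g = (\<lambda>x. a * f (c *\<^sub>R x))"
    if "\<exists>a f. smooth_fun f \<and> g = (\<lambda>x. a * f (c *\<^sub>R x))" for g i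
  proof -
    from that obtain a f where f: "smooth_fun f" and g: "g = (\<lambda>x. a * f (c *\<^sub>R x))" by blast
    have "partial_deriv i g = (\<lambda>x. (a * c) * partial_deriv i f (c *\<^sub>R x))"
      unfolding g by (subst partial_deriv_mult) (auto simp: d f partial_deriv_const partial_deriv_scale)
    then show ?thesis using smooth_fun_partial[OF f] by blast
  qed
  show "\<exists>a fa. smooth_fun fa \<and> (\<lambda>x. f (c *\<^sub>R x)) = (\<lambda>x. a * fa (c *\<^sub>R x))"
    using f by (intro exI[of _ 1] exI[of _ f]) auto
qed

text \<open>The kernel \<open>kap\<close> is determined by \<open>\<nabla>rho(y) = - kap(y) y\<close>.  As both are radial,
  \<open>\<Delta>rho = - div(kap(y) y)\<close> is minus the derivative at \<open>\<tau> = 1\<close> of \<open>\<tau>\<^sup>d kap(\<tau>y)\<close>, so the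
  Laplacian of a mollified convex function is a derivative in the scale, where convexity applies.\<close>

definition rho :: "real^'n \<Rightarrow> real" where "rho y = bump (1 - (norm y)\<^sup>2)"
definition kap :: "real^'n \<Rightarrow> real" where "kap y = 2 * bump' (1 - (norm y)\<^sup>2)"

lemma norm_sq_sum: "(norm (y::real^'n))\<^sup>2 = (\<Sum>i\<in>UNIV. y $ i * y $ i)"
  by (simp add: power2_norm_eq_inner inner_vec_def)

lemma smooth_fun_norm_sq: "smooth_fun (\<lambda>y::real^'n. c - (norm (y - z))\<^sup>2)"
  unfolding norm_sq_sum vector_minus_component
  by (intro smooth_fun_diff smooth_fun_sum smooth_fun_mult smooth_fun_const smooth_fun_component finite)

lemma partial_deriv_norm_sq: "partial_deriv j (\<lambda>y::real^'n. c - (norm y)\<^sup>2) = (\<lambda>y. - 2 * y $ j)"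
proof
  fix y :: "real^'n"
  have "((\<lambda>y. c - y \<bullet> y) has_derivative (\<lambda>v. - (2 * (y \<bullet> v)))) (at y)"
    by (auto intro!: derivative_eq_intros simp: inner_commute)
  then show "partial_deriv j (\<lambda>y. c - (norm y)\<^sup>2) y = - 2 * y $ j"
    unfolding power2_norm_eq_inner by (simp add: partial_deriv_eq inner_axis)
qed

lemma smooth_rho: "smooth_fun rho" and smooth_kap: "smooth_fun kap"
  using smooth_fun_norm_sq[of 1 0] unfolding rho_def kap_def bump_def bump'_def
  by (auto intro!: smooth_fun_exp_recip smooth_fun_mult)

lemma unit_supp_rho: "unit_supp rho" and unit_supp_kap: "unit_supp kap"
  using power_mono[of 1 _ 2] by (force simp: unit_supp_def rho_def kap_def bump_simps)+

lemma kap_nonneg: "0 \<le> kap y" and rho_nonneg: "0 \<le> rho y" and kap_uminus: "kap (- y) = kap y"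
  by (simp_all add: kap_def rho_def bump_nonneg bump'_nonneg)

lemma continuous_kap: "continuous_on S kap" and continuous_rho: "continuous_on S rho"
  by (auto intro: smooth_fun_continuous smooth_kap smooth_rho)

lemma partial_deriv_rho: "partial_deriv j rho = (\<lambda>y. - (y $ j) * kap y)"
  using smooth_fun_norm_sq[of 1 0] unfolding rho_def[abs_def] bump_def
  by (subst partial_deriv_exp_recip)
    (auto simp: partial_deriv_norm_sq kap_def bump'_def)

lemma partial_derivs_rho:
  "partial_derivs [j, j] rho = (\<lambda>y. - kap y - y $ j * partial_deriv j kap y)"
proof -
  have "partial_derivs [j, j] rho = partial_deriv j (\<lambda>y. (- (y $ j)) * kap y)"
    by (simp add: partial_deriv_rho)
  also have "\<dots> = (\<lambda>y. - kap y - y $ j * partial_deriv j kap y)"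
    by (subst partial_deriv_mult)
      (auto simp: partial_deriv_uminus partial_deriv_component intro!: smooth_fun_differentiable smooth_kap)
  finally show ?thesis .
qed

lemma convex_on_UNIV_D:
  "convex_on UNIV f \<Longrightarrow> 0 \<le> u \<Longrightarrow> 0 \<le> v \<Longrightarrow> u + v = 1 \<Longrightarrow> f (u *\<^sub>R x + v *\<^sub>R y) \<le> u * f x + v * f y"
  by (auto simp: convex_on_def)

lemma convex_on_affine_compose:
  assumes "convex_on UNIV f" "\<And>t a b. T ((1 - t) *\<^sub>R a + t *\<^sub>R b) = (1 - t) *\<^sub>R T a + t *\<^sub>R T b"
  shows "convex_on UNIV (\<lambda>a. f (T a))"
  by (rule convex_onI) (auto simp: assms(2) intro!: convex_on_UNIV_D[OF assms(1)])

text \<open>Substitution turns \<open>K \<tau>\<close> into the \<open>kap\<close>-weighted integral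
  of w(x + y/\<tau>), and for \<tau> \<ge> 1 convexity bounds it by J1/\<tau> + (1 - 1/\<tau>) J0.
  Both sides agree at \<tau> = 1, so their derivatives there are ordered.\<close>

lemma laplacian_conv_ge:
  fixes w :: "real^'n \<Rightarrow> real"
  assumes w: "continuous_on UNIV w" and cvx: "convex_on UNIV w"
  shows "(\<integral>y. (w (x + y) - w x) * kap y \<partial>lborel) \<le> (\<Sum>j\<in>UNIV. conv w (partial_derivs [j, j] rho) x)"
proof -
  let ?d = "CARD('n)"
  define K where "K \<tau> = (\<integral>y. w (x + y) * (kap (\<tau> *\<^sub>R y) * \<tau> ^ ?d) \<partial>lborel)" for \<tau>
  define dk where "dk \<tau> y = (\<Sum>j\<in>UNIV. y $ j * partial_deriv j kap (\<tau> *\<^sub>R y))" for \<tau> and y :: "real^'n"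
  obtain a :: "real^'n" where a: "cball 0 2 \<subseteq> cbox (-a) a"
    using bounded_subset_cbox_symmetric[OF bounded_cball] by blast
  \<comment> \<open>Bounded away from 0, so that kap(\<tau> y) vanishes for |y| > 2 and one box
    serves all these \<tau>.\<close>
  let ?U = "{1/2<..<2::real}"
  have wc: "continuous_on S (\<lambda>y. w (x + y))" for S
    by (intro continuous_on_compose2[OF w] continuous_intros) auto
  have kc: "continuous_on S (\<lambda>y. kap (\<tau> *\<^sub>R y))" for S and \<tau>
    by (intro continuous_on_compose2[OF continuous_kap[of UNIV]] continuous_intros) auto
  have pc: "continuous_on S (partial_deriv j (kap :: real^'n \<Rightarrow> real))" for S j
    by (intro smooth_fun_continuous smooth_fun_partial smooth_kap)
  have supp: "unit_supp (partial_deriv j (kap :: real^'n \<Rightarrow> real))" for j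
    by (intro unit_supp_partial unit_supp_kap smooth_kap)
  have skap: "unit_supp (kap :: real^'n \<Rightarrow> real)" by (rule unit_supp_kap)
  have K_box: "K \<tau> = integral (cbox (-a) a) (\<lambda>y. w (x + y) * (kap (\<tau> *\<^sub>R y) * \<tau> ^ ?d))" if "\<tau> \<in> ?U" for \<tau>
    unfolding K_def
  proof (rule lborel_integral_eq_box[OF _ _ a])
    fix y :: "real^'n" assume "norm y > 2"
    then have "1/2 * 2 < \<tau> * norm y" using that by (intro mult_strict_mono) auto
    then have "norm (\<tau> *\<^sub>R y) > 1" using that by simp
    then show "w (x + y) * (kap (\<tau> *\<^sub>R y) * \<tau> ^ ?d) = 0"
      using unit_supp_kap unfolding unit_supp_def by (metis mult_zero_left mult_zero_right)
  qed (intro continuous_intros wc kc)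
  have "((\<lambda>\<tau>. integral (cbox (-a) a) (\<lambda>y. w (x + y) * (kap (\<tau> *\<^sub>R y) * \<tau> ^ ?d))) has_real_derivative
      integral (cbox (-a) a) (\<lambda>y. w (x + y) * (dk 1 y * 1 ^ ?d + kap (1 *\<^sub>R y) * (real ?d * 1 ^ (?d - 1))))) (at 1 within ?U)"
  proof (rule leibniz_rule_field_derivative[where
        fx="\<lambda>\<tau> y. w (x + y) * (dk \<tau> y * \<tau> ^ ?d + kap (\<tau> *\<^sub>R y) * (real ?d * \<tau> ^ (?d - 1)))"])
    fix \<tau> :: real and y :: "real^'n" assume "\<tau> \<in> ?U"
    have "((\<lambda>\<tau>. kap (\<tau> *\<^sub>R y)) has_derivative (\<lambda>v. \<Sum>j\<in>UNIV. (v *\<^sub>R y) $ j * partial_deriv j kap (\<tau> *\<^sub>R y))) (at \<tau>)"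
      by (rule has_derivative_compose[OF _ has_derivative_partial[OF smooth_fun_differentiable[OF smooth_kap]],
            of "\<lambda>\<tau>. \<tau> *\<^sub>R y" "\<lambda>v. v *\<^sub>R y"]) (auto intro!: derivative_eq_intros)
    moreover have "(\<lambda>v. \<Sum>j\<in>UNIV. (v *\<^sub>R y) $ j * partial_deriv j kap (\<tau> *\<^sub>R y)) = (*) (dk \<tau> y)"
      by (auto simp: dk_def sum_distrib_left sum_distrib_right fun_eq_iff mult_ac)
    ultimately have "((\<lambda>\<tau>. kap (\<tau> *\<^sub>R y)) has_real_derivative dk \<tau> y) (at \<tau> within ?U)"
      unfolding has_field_derivative_def by (metis has_derivative_at_withinI)
    then show "((\<lambda>\<tau>. w (x + y) * (kap (\<tau> *\<^sub>R y) * \<tau> ^ ?d)) has_real_derivative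
        w (x + y) * (dk \<tau> y * \<tau> ^ ?d + kap (\<tau> *\<^sub>R y) * (real ?d * \<tau> ^ (?d - 1)))) (at \<tau> within ?U)"
      by (auto intro!: derivative_eq_intros simp: algebra_simps)
  next
    show "(\<lambda>y. w (x + y) * (kap (\<tau> *\<^sub>R y) * \<tau> ^ ?d)) integrable_on cbox (-a) a" for \<tau>
      by (intro integrable_continuous continuous_intros wc kc)
  next
    show "continuous_on (?U \<times> cbox (-a) a)
       (\<lambda>(\<tau>, y). w (x + y) * (dk \<tau> y * \<tau> ^ ?d + kap (\<tau> *\<^sub>R y) * (real ?d * \<tau> ^ (?d - 1))))"
      unfolding split_beta dk_def
      by (intro continuous_intros continuous_on_compose2[OF w] continuous_on_compose2[OF continuous_kap[of UNIV]]
          continuous_on_compose2[OF pc[of UNIV]]) auto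
  qed auto
  moreover have "integral (cbox (-a) a) (\<lambda>y. w (x + y) * (dk 1 y * 1 ^ ?d + kap (1 *\<^sub>R y) * (real ?d * 1 ^ (?d - 1))))
     = - (\<Sum>j\<in>UNIV. conv w (partial_derivs [j, j] rho) x)" (is "?L = ?R")
  proof -
    have "?L = (\<integral>y. w (x + y) * (dk 1 y * 1 ^ ?d + kap (1 *\<^sub>R y) * (real ?d * 1 ^ (?d - 1))) \<partial>lborel)"
    proof (rule lborel_integral_eq_box[OF _ _ a, symmetric])
      show "continuous_on UNIV (\<lambda>y. w (x + y) * (dk 1 y * 1 ^ ?d + kap (1 *\<^sub>R y) * (real ?d * 1 ^ (?d - 1))))"
        unfolding dk_def by (intro continuous_intros wc kc continuous_on_compose2[OF pc[of UNIV]]) auto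
      fix y :: "real^'n" assume "norm y > 2"
      then show "w (x + y) * (dk 1 y * 1 ^ ?d + kap (1 *\<^sub>R y) * (real ?d * 1 ^ (?d - 1))) = 0"
        using supp skap by (simp add: dk_def unit_supp_def)
    qed
    also have "\<dots> = (\<integral>y. (\<Sum>j\<in>UNIV. - (w (x + y) * partial_derivs [j, j] rho y)) \<partial>lborel)"
      by (intro Bochner_Integration.integral_cong refl)
        (simp add: partial_derivs_rho[simplified] dk_def sum_distrib_left algebra_simps sum.distrib sum_negf)
    also have "\<dots> = (\<Sum>j\<in>UNIV. \<integral>y. - (w (x + y) * partial_derivs [j, j] rho y) \<partial>lborel)"
      by (intro Bochner_Integration.integral_sum integrable_minus integrable_mult_unit_supp wc
          smooth_fun_continuous smooth_fun_partials smooth_rho)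
        (simp add: unit_supp_partial unit_supp_rho smooth_rho smooth_fun_partial)
    also have "\<dots> = ?R"
      by (simp add: sum_negf conv_eq[OF w] smooth_fun_continuous smooth_fun_partial smooth_rho)
    finally show ?thesis .
  qed
  ultimately have "((\<lambda>\<tau>. integral (cbox (-a) a) (\<lambda>y. w (x + y) * (kap (\<tau> *\<^sub>R y) * \<tau> ^ ?d))) has_real_derivative
      - (\<Sum>j\<in>UNIV. conv w (partial_derivs [j, j] rho) x)) (at 1)"
    by (subst (asm) at_within_open) auto
  then have K': "(K has_real_derivative - (\<Sum>j\<in>UNIV. conv w (partial_derivs [j, j] rho) x)) (at 1)"
    by (rule has_field_derivative_transform_within_open[where S="?U"]) (auto simp: K_box)
  define J1 where "J1 = (\<integral>y. w (x + y) * kap y \<partial>lborel)"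
  define J0 where "J0 = (\<integral>y. w x * kap (y::real^'n) \<partial>lborel)"
  have i1: "integrable lborel (\<lambda>y. w (x + y) * kap y)" and i0: "integrable lborel (\<lambda>y::real^'n. w x * kap y)"
    by (intro integrable_mult_unit_supp wc continuous_kap unit_supp_kap continuous_intros)+
  have K_le: "K \<tau> \<le> J1 / \<tau> + (1 - 1 / \<tau>) * J0" if "\<tau> \<ge> 1" for \<tau>
  proof -
    have "(\<lambda>y. w (x + y) * kap (\<tau> *\<^sub>R y)) \<in> borel_measurable borel"
      by (intro borel_measurable_continuous_onI continuous_intros wc kc)
    from lborel_integral_affine[OF this, of "1/\<tau>" 0] that
    have "(\<integral>y. w (x + y) * kap (\<tau> *\<^sub>R y) \<partial>lborel) = (1/\<tau>) ^ ?d * (\<integral>y. w (x + (1/\<tau>) *\<^sub>R y) * kap y \<partial>lborel)"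
      by simp
    moreover have "K \<tau> = \<tau> ^ ?d * (\<integral>y. w (x + y) * kap (\<tau> *\<^sub>R y) \<partial>lborel)"
      unfolding K_def by (subst integral_mult_right_zero[symmetric]) (simp add: mult_ac)
    ultimately have "K \<tau> = (\<integral>y. w (x + (1/\<tau>) *\<^sub>R y) * kap y \<partial>lborel)"
      using that by (simp add: power_one_over)
    also have "\<dots> \<le> (\<integral>y. (1/\<tau>) * (w (x + y) * kap y) + (1 - 1/\<tau>) * (w x * kap y) \<partial>lborel)"
    proof (rule integral_mono)
      show "integrable lborel (\<lambda>y. w (x + (1/\<tau>) *\<^sub>R y) * kap y)"
        by (intro integrable_mult_unit_supp continuous_kap unit_supp_kap continuous_on_compose2[OF w] continuous_intros) auto
      show "integrable lborel (\<lambda>y. (1/\<tau>) * (w (x + y) * kap y) + (1 - 1/\<tau>) * (w x * kap y))"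
        by (intro Bochner_Integration.integrable_add integrable_mult_right i0 i1)
      fix y
      have "w ((1/\<tau>) *\<^sub>R (x + y) + (1 - 1/\<tau>) *\<^sub>R x) \<le> (1/\<tau>) * w (x + y) + (1 - 1/\<tau>) * w x"
        by (rule convex_on_UNIV_D[OF cvx]) (use that in auto)
      moreover have "(1/\<tau>) *\<^sub>R (x + y) + (1 - 1/\<tau>) *\<^sub>R x = x + (1/\<tau>) *\<^sub>R y"
        by (simp add: algebra_simps)
      ultimately have "w (x + (1/\<tau>) *\<^sub>R y) \<le> (1/\<tau>) * w (x + y) + (1 - 1/\<tau>) * w x" by simp
      from mult_right_mono[OF this kap_nonneg[of y]]
      show "w (x + (1/\<tau>) *\<^sub>R y) * kap y \<le> (1/\<tau>) * (w (x + y) * kap y) + (1 - 1/\<tau>) * (w x * kap y)"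
        by (simp add: algebra_simps)
    qed
    also have "\<dots> = J1 / \<tau> + (1 - 1 / \<tau>) * J0"
      by (subst Bochner_Integration.integral_add[OF integrable_mult_right[OF i1] integrable_mult_right[OF i0]])
        (simp only: integral_mult_right_zero J0_def J1_def, simp)
    finally show ?thesis .
  qed
  have K1: "K 1 = J1" by (simp add: K_def J1_def)
  let ?l = "- J1 + J0 + (\<Sum>j\<in>UNIV. conv w (partial_derivs [j, j] rho) x)"
  have "((\<lambda>\<tau>. J1 / \<tau> + (1 - 1 / \<tau>) * J0 - K \<tau>) has_real_derivative ?l) (at 1)"
    by (auto intro!: derivative_eq_intros K')
  \<comment> \<open>A negative derivative would make the difference negative just to the right of 1,
    where it starts from 0, against \<open>K_le\<close>.\<close>
  then have "\<not> ?l < 0"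
    using DERIV_neg_dec_right[of "\<lambda>\<tau>. J1 / \<tau> + (1 - 1 / \<tau>) * J0 - K \<tau>" ?l 1] K_le K1
    by (smt (verit) dense div_by_1 mult_eq_0_iff)
  moreover have "(\<integral>y. (w (x + y) - w x) * kap y \<partial>lborel) = J1 - J0"
    unfolding J0_def J1_def left_diff_distrib by (rule Bochner_Integration.integral_diff[OF i1 i0])
  ultimately show ?thesis by linarith
qed

section \<open>Mean value inequalities for convex functions\<close>

definition mv_const :: "'n::finite itself \<Rightarrow> real" where
  "mv_const _ = exp (- 4/3) * measure lborel (cball (0::real^'n) (1/4))"

definition kap_mass :: "'n::finite itself \<Rightarrow> real" where
  "kap_mass _ = integral\<^sup>L lborel (kap :: real^'n \<Rightarrow> real)"

lemma mv_const_pos: "0 < mv_const TYPE('n::finite)"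
  by (simp add: mv_const_def content_cball)

text \<open>Average over v and -v and use convexity at the midpoint c.\<close>

lemma ball_mean_value:
  fixes \<phi> :: "real^'n \<Rightarrow> real"
  assumes c: "continuous_on UNIV \<phi>" and cvx: "convex_on UNIV \<phi>"
  shows "measure lborel (cball (0::real^'n) r) * \<phi> c \<le> (\<integral>v. indicator (cball 0 r) v * \<phi> (c + v) \<partial>lborel)"
proof -
  let ?I = "\<lambda>g. \<integral>v. indicator (cball (0::real^'n) r) v * g v \<partial>lborel"
  have int: "integrable lborel (\<lambda>v. indicator (cball (0::real^'n) r) v * g v)" if "continuous_on UNIV g" for g :: "real^'n \<Rightarrow> real"
    using borel_integrable_compact[OF compact_cball continuous_on_subset[OF that], of 0 r] by simp
  have c1: "continuous_on UNIV (\<lambda>v. \<phi> (c + v))" and c2: "continuous_on UNIV (\<lambda>v. \<phi> (c - v))"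
    by (intro continuous_on_compose2[OF c] continuous_intros; simp)+
  have "?I (\<lambda>v. \<phi> (c + v)) = ?I (\<lambda>v. \<phi> (c - v))"
    using lborel_integral_affine[of "\<lambda>v. indicator (cball 0 r) v * \<phi> (c + v)" "-1" 0] int[OF c1]
    by (simp add: borel_measurable_integrable indicator_def)
  moreover have "?I (\<lambda>v. \<phi> (c + v)) + ?I (\<lambda>v. \<phi> (c - v)) = ?I (\<lambda>v. \<phi> (c + v) + \<phi> (c - v))"
    by (subst Bochner_Integration.integral_add[symmetric]) (simp_all add: int c1 c2 distrib_left)
  moreover have "?I (\<lambda>v. 2 * \<phi> c) \<le> ?I (\<lambda>v. \<phi> (c + v) + \<phi> (c - v))"
  proof (rule integral_mono)
    fix v
    have "\<phi> ((1/2) *\<^sub>R (c + v) + (1/2) *\<^sub>R (c - v)) \<le> (1/2) * \<phi> (c + v) + (1/2) * \<phi> (c - v)"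
      by (rule convex_on_UNIV_D[OF cvx]) auto
    moreover have "(1/2) *\<^sub>R (c + v) + (1/2) *\<^sub>R (c - v) = c"
      by (simp add: algebra_simps flip: scaleR_add_left)
    ultimately show "indicator (cball 0 r) v * (2 * \<phi> c) \<le> indicator (cball 0 r) v * (\<phi> (c + v) + \<phi> (c - v))"
      by (simp add: indicator_def)
  qed (intro int continuous_intros c1 c2)+
  moreover have "?I (\<lambda>v. 2 * \<phi> c) = measure lborel (cball (0::real^'n) r) * (2 * \<phi> c)"
    by simp
  ultimately show ?thesis by linarith
qed

text \<open>For |y| \<le> 1/2 one has 1 - |y|^2 \<ge> 3/4 and the kernel is at least exp(-4/3). The
  ball of radius 1/4 around c lies in that region, where the unweighted inequality applies;
  nonnegativity of \<phi> discards the rest. This is the origin of \<open>mv_const\<close>.\<close>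

lemma kap_weighted_mean_value:
  fixes \<phi> :: "real^'n \<Rightarrow> real"
  assumes c: "continuous_on UNIV \<phi>" and cvx: "convex_on UNIV \<phi>" and nn: "\<And>y. 0 \<le> \<phi> y"
    and "norm c \<le> 1/4"
  shows "mv_const TYPE('n) * \<phi> c \<le> (\<integral>y. \<phi> y * kap y \<partial>lborel)"
proof -
  have kap: "exp (- 4/3) \<le> kap y" if "norm y \<le> 1/2" for y :: "real^'n"
  proof -
    define s where "s = 1 - (norm y)\<^sup>2"
    have "(norm y)\<^sup>2 \<le> (1/2)\<^sup>2" using that by (intro power_mono) auto
    then have s: "3/4 \<le> s" "s \<le> 1" by (auto simp: s_def power2_eq_square)
    have "exp (- 4/3) \<le> exp (- 1 / s)" using s by (simp add: field_simps)
    moreover have "exp (- 1 / s) \<le> exp (- 1 / s) / s\<^sup>2"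
      using s by (simp add: field_simps power_le_one)
    moreover have "kap y = 2 * (exp (- 1 / s) / s\<^sup>2)"
      using s by (simp add: kap_def bump_simps flip: s_def)
    moreover have "0 < exp (- 4/3 :: real)" by simp
    ultimately show ?thesis by linarith
  qed
  have c1: "continuous_on UNIV (\<lambda>v. \<phi> (c + v))"
    by (intro continuous_on_compose2[OF c] continuous_intros; simp)
  have int: "integrable lborel (\<lambda>y. indicator (cball c (1/4)) y * \<phi> y)"
    using borel_integrable_compact[OF compact_cball continuous_on_subset[OF c], of c "1/4"] by simp
  then have meas: "(\<lambda>y. indicator (cball c (1/4)) y * \<phi> y) \<in> borel_measurable borel"
    using borel_measurable_integrable by fastforce
  have "exp (- 4/3) * (measure lborel (cball (0::real^'n) (1/4)) * \<phi> c)
      \<le> exp (- 4/3) * (\<integral>v. indicator (cball 0 (1/4)) v * \<phi> (c + v) \<partial>lborel)"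
    by (intro mult_left_mono ball_mean_value c cvx) auto
  also have "(\<integral>v. indicator (cball 0 (1/4)) v * \<phi> (c + v) \<partial>lborel)
      = (\<integral>y. indicator (cball c (1/4)) y * \<phi> y \<partial>lborel)"
    using lborel_integral_affine[OF meas, of 1 c] by (simp add: indicator_def dist_norm)
  also have "exp (- 4/3) * \<dots> = (\<integral>y. exp (- 4/3) * (indicator (cball c (1/4)) y * \<phi> y) \<partial>lborel)"
    by simp
  also have "\<dots> \<le> (\<integral>y. \<phi> y * kap y \<partial>lborel)"
  proof (rule integral_mono)
    show "integrable lborel (\<lambda>y. exp (- 4/3) * (indicator (cball c (1/4)) y * \<phi> y))"
      using int by simp
    show "integrable lborel (\<lambda>y. \<phi> y * kap y)"
      by (intro integrable_mult_unit_supp c continuous_kap unit_supp_kap)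
    fix y
    show "exp (- 4/3) * (indicator (cball c (1/4)) y * \<phi> y) \<le> \<phi> y * kap y"
    proof (cases "y \<in> cball c (1/4)")
      case True
      then have "norm y \<le> 1/2" using \<open>norm c \<le> 1/4\<close> norm_triangle_sub[of y c] by (simp add: dist_norm norm_minus_commute)
      from mult_right_mono[OF kap[OF this] nn[of y]] True show ?thesis by (simp add: mult.commute)
    qed (simp add: nn kap_nonneg)
  qed
  finally show ?thesis by (simp add: mv_const_def mult_ac)
qed

lemma mv_const_le_kap_mass: "mv_const TYPE('n::finite) \<le> kap_mass TYPE('n)"
  using kap_weighted_mean_value[of "\<lambda>_::real^'n. 1" 0] by (simp add: kap_mass_def convex_on_const)

text \<open>Only the value of \<open>w\<close> near the node \<open>x + yk\<close> is controlled, not the one at \<open>x\<close>.  Writing \<open>0\<close> as a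
  convex combination of \<open>yk\<close> and the far point \<open>-s yk\<close>, and bounding the value there by the mean, absorbs
  the difference into half of the mean.\<close>

lemma laplacian_conv_ge_kink:
  fixes w :: "real^'n \<Rightarrow> real"
  assumes w: "continuous_on UNIV w" and cvx: "convex_on UNIV w"
    and supp: "\<And>y. b + q \<bullet> y \<le> w (x + y)"
    and yk: "w (x + yk) \<le> b + q \<bullet> yk + \<delta>" "norm yk \<le> mv_const TYPE('n) / (8 * kap_mass TYPE('n))"
    and c: "norm c \<le> 1/4"
  shows "mv_const TYPE('n) / 2 * (w (x + c) - b - q \<bullet> c) - kap_mass TYPE('n) * \<delta>
    \<le> (\<Sum>j\<in>UNIV. conv w (partial_derivs [j, j] rho) x)"
proof -
  define \<beta> where "\<beta> = mv_const TYPE('n)"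
  define K where "K = kap_mass TYPE('n)"
  have \<beta>: "0 < \<beta>" "\<beta> \<le> K" using mv_const_pos mv_const_le_kap_mass by (auto simp: \<beta>_def K_def)
  define \<phi> where "\<phi> y = w (x + y) - (b + q \<bullet> y)" for y
  have wc: "continuous_on S (\<lambda>y. w (x + y))" for S
    by (intro continuous_on_compose2[OF w] continuous_intros) auto
  have \<phi>c: "continuous_on UNIV \<phi>"
    unfolding \<phi>_def by (intro continuous_intros wc)
  have \<phi>cvx: "convex_on UNIV \<phi>"
  proof (rule convex_onI)
    fix t and y z :: "real^'n" assume t: "0 < t" "t < (1::real)"
    have "w ((1 - t) *\<^sub>R (x + y) + t *\<^sub>R (x + z)) \<le> (1 - t) * w (x + y) + t * w (x + z)"
      by (rule convex_on_UNIV_D[OF cvx]) (use t in auto)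
    moreover have "(1 - t) *\<^sub>R (x + y) + t *\<^sub>R (x + z) = x + ((1 - t) *\<^sub>R y + t *\<^sub>R z)"
      by (simp add: algebra_simps)
    ultimately show "\<phi> ((1 - t) *\<^sub>R y + t *\<^sub>R z) \<le> (1 - t) * \<phi> y + t * \<phi> z"
      by (simp add: \<phi>_def inner_simps algebra_simps)
  qed auto
  have \<phi>nn: "0 \<le> \<phi> y" for y using supp by (simp add: \<phi>_def)
  have i\<phi>: "integrable lborel (\<lambda>y. \<phi> y * kap y)"
    by (intro integrable_mult_unit_supp \<phi>c continuous_kap unit_supp_kap)
  have i1: "integrable lborel (\<lambda>y::real^'n. a * kap y)" for a
    by (intro integrable_mult_unit_supp continuous_intros continuous_kap unit_supp_kap)
  have iq: "integrable lborel (\<lambda>y. q \<bullet> y * kap y)"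
    by (intro integrable_mult_unit_supp continuous_intros continuous_kap unit_supp_kap)
  have q0: "(\<integral>y. q \<bullet> y * kap y \<partial>lborel) = 0"
    using lborel_integral_affine[of "\<lambda>y. q \<bullet> y * kap y" "-1" 0] iq
    by (simp add: borel_measurable_integrable kap_uminus)
  define A where "A = (\<integral>y. \<phi> y * kap y \<partial>lborel)"
  have A_ge: "\<beta> * \<phi> c \<le> A" if "norm c \<le> 1/4" for c
    unfolding A_def \<beta>_def by (intro kap_weighted_mean_value \<phi>c \<phi>cvx \<phi>nn that)
  \<comment> \<open>The largest s for which the bound on |yk| still guarantees that the far point -s
    yk has norm at most 1/4, as the mean value inequality demands. It makes (1 + s) \<beta> equal to
    \<beta> + 2K, so that K times the weight of the far point costs at most A/2.\<close>
  define s where "s = 2 * K / \<beta>"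
  have s: "s > 0" using \<beta> by (simp add: s_def)
  have "norm ((- s) *\<^sub>R yk) \<le> s * (\<beta> / (8 * K))"
    using mult_left_mono[OF yk(2), of s] s by (simp add: \<beta>_def K_def)
  also have "\<dots> = 1/4" using \<beta> by (simp add: s_def field_simps)
  finally have 1: "\<beta> * \<phi> ((- s) *\<^sub>R yk) \<le> A" by (rule A_ge)
  have "\<phi> ((s / (1 + s)) *\<^sub>R yk + (1 / (1 + s)) *\<^sub>R ((- s) *\<^sub>R yk)) \<le> s / (1 + s) * \<phi> yk + 1 / (1 + s) * \<phi> ((- s) *\<^sub>R yk)"
    by (rule convex_on_UNIV_D[OF \<phi>cvx]) (use s in \<open>auto simp: field_simps\<close>)
  moreover have "(s / (1 + s)) *\<^sub>R yk + (1 / (1 + s)) *\<^sub>R ((- s) *\<^sub>R yk) = 0"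
    by (simp flip: scaleR_add_left)
  moreover have "s / (1 + s) * \<phi> yk \<le> 1 * \<delta>"
    using yk(1) s \<phi>nn[of yk] by (intro mult_mono) (auto simp: \<phi>_def)
  moreover have "1 / (1 + s) * \<phi> ((- s) *\<^sub>R yk) \<le> 1 / (1 + s) * (A / \<beta>)"
    using 1 \<beta> s by (intro mult_left_mono) (auto simp: field_simps)
  ultimately have "\<phi> 0 \<le> \<delta> + A / ((1 + s) * \<beta>)" by simp
  also have "(1 + s) * \<beta> = \<beta> + 2 * K" using \<beta> by (simp add: s_def field_simps)
  finally have "K * \<phi> 0 \<le> K * \<delta> + A * (K / (\<beta> + 2 * K))"
    using \<beta> mult_left_mono[of "\<phi> 0" "\<delta> + A / (\<beta> + 2 * K)" K] by (simp add: algebra_simps)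
  moreover have "A * (K / (\<beta> + 2 * K)) \<le> A * (1/2)"
  proof (rule mult_left_mono)
    show "0 \<le> A" unfolding A_def by (intro Bochner_Integration.integral_nonneg mult_nonneg_nonneg \<phi>nn kap_nonneg)
  qed (use \<beta> in \<open>simp add: field_simps\<close>)
  moreover have "(\<integral>y. (w (x + y) - w x) * kap y \<partial>lborel) = A - K * \<phi> 0"
  proof -
    have "(\<integral>y. (w (x + y) - w x) * kap y \<partial>lborel) = (\<integral>y. (\<phi> y * kap y - \<phi> 0 * kap y) + q \<bullet> y * kap y \<partial>lborel)"
      by (intro Bochner_Integration.integral_cong refl) (simp add: \<phi>_def algebra_simps)
    also have "\<dots> = A - \<phi> 0 * K"
      using i\<phi> i1 iq q0 by (simp add: A_def K_def kap_mass_def)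
    finally show ?thesis by simp
  qed
  moreover have "\<beta> * \<phi> c \<le> A" using c by (rule A_ge)
  moreover note laplacian_conv_ge[OF w cvx, of x]
  ultimately have "\<beta> * \<phi> c / 2 - K * \<delta> \<le> (\<Sum>j\<in>UNIV. conv w (partial_derivs [j, j] rho) x)"
    by linarith
  then show ?thesis
    by (simp add: \<phi>_def diff_diff_eq flip: \<beta>_def K_def)
qed

section \<open>Derivatives along lines: convexity and Lipschitz bounds\<close>

lemma has_real_derivative_line:
  assumes "smooth_fun f"
  shows "((\<lambda>t. f (x + t *\<^sub>R \<xi>)) has_real_derivative (\<Sum>j\<in>UNIV. \<xi> $ j * partial_deriv j f (x + t *\<^sub>R \<xi>))) (at t)"
proof -
  have "((\<lambda>t. f (x + t *\<^sub>R \<xi>)) has_derivative (\<lambda>v. \<Sum>j\<in>UNIV. (v *\<^sub>R \<xi>) $ j * partial_deriv j f (x + t *\<^sub>R \<xi>))) (at t)"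
    by (rule has_derivative_compose[OF _ has_derivative_partial[OF smooth_fun_differentiable[OF assms]],
          of "\<lambda>t. x + t *\<^sub>R \<xi>" "\<lambda>v. v *\<^sub>R \<xi>"]) (auto intro!: derivative_eq_intros)
  then show ?thesis
    by (rule has_derivative_imp_has_field_derivative) (auto simp: sum_distrib_left sum_distrib_right mult_ac)
qed

abbreviation laplacian :: "(real^'n \<Rightarrow> real) \<Rightarrow> real^'n \<Rightarrow> real" where
  "laplacian f x \<equiv> (\<Sum>j\<in>UNIV. partial_derivs [j, j] f x)"

text \<open>On each line the tangent inequality makes the first derivative monotone; its derivative
  is the Hessian form.\<close>

lemma hessian_nonneg_of_convex:
  fixes f :: "real^'n \<Rightarrow> real"
  assumes f: "smooth_fun f" and cvx: "convex_on UNIV f"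
  shows "0 \<le> (\<Sum>i\<in>UNIV. \<Sum>j\<in>UNIV. \<xi> $ i * \<xi> $ j * partial_derivs [i, j] f x)"
proof -
  define g where "g t = f (x + t *\<^sub>R \<xi>)" for t
  define g' where "g' t = (\<Sum>j\<in>UNIV. \<xi> $ j * partial_deriv j f (x + t *\<^sub>R \<xi>))" for t
  have g: "(g has_real_derivative g' t) (at t)" for t
    unfolding g_def[abs_def] g'_def by (rule has_real_derivative_line[OF f])
  have gcvx: "convex_on UNIV g"
    unfolding g_def[abs_def] by (rule convex_on_affine_compose[OF cvx]) (simp add: algebra_simps)
  have tangent: "g' a * (b - a) \<le> g b - g a" for a b
    by (rule convex_on_imp_above_tangent[OF gcvx]) (use g in auto)
  have mono: "mono_on UNIV g'"
  proof (rule mono_onI)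
    fix a b :: real assume "a \<le> b"
    then show "g' a \<le> g' b"
      using tangent[of a b] tangent[of b a]
      by (cases "a = b") (auto simp: algebra_simps intro: mult_right_le_imp_le[of _ "b - a"])
  qed
  have "(g' has_real_derivative (\<Sum>j\<in>UNIV. \<xi> $ j * (\<Sum>i\<in>UNIV. \<xi> $ i * partial_deriv i (partial_deriv j f) (x + 0 *\<^sub>R \<xi>)))) (at 0)"
    unfolding g'_def[abs_def]
    by (intro DERIV_sum DERIV_cmult has_real_derivative_line smooth_fun_partial f)
  then have "0 \<le> (\<Sum>j\<in>UNIV. \<xi> $ j * (\<Sum>i\<in>UNIV. \<xi> $ i * partial_deriv i (partial_deriv j f) (x + 0 *\<^sub>R \<xi>)))"
    using mono_on_imp_deriv_nonneg[OF mono] by auto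
  also have "\<dots> = (\<Sum>i\<in>UNIV. \<Sum>j\<in>UNIV. \<xi> $ i * \<xi> $ j * partial_derivs [i, j] f x)"
    by (subst sum.swap) (simp add: sum_distrib_left mult_ac)
  finally show ?thesis .
qed

lemma abs_partial_deriv_le:
  assumes f: "smooth_fun f" and lip: "\<And>y. \<bar>f y - f x\<bar> \<le> A * norm (y - x)"
  shows "\<bar>partial_deriv i f x\<bar> \<le> A"
proof -
  have "((\<lambda>t. f (x + t *\<^sub>R axis i 1)) has_real_derivative partial_deriv i f x) (at 0)"
    using has_real_derivative_line[OF f, of x "axis i 1" 0]
    by (simp add: axis_def if_distrib[of "\<lambda>x. x * _"] cong: if_cong)
  then have "((\<lambda>h. (f (x + h *\<^sub>R axis i 1) - f x) / h) \<longlongrightarrow> partial_deriv i f x) (at 0)"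
    by (simp add: DERIV_def)
  then have "((\<lambda>h. \<bar>(f (x + h *\<^sub>R axis i 1) - f x) / h\<bar>) \<longlongrightarrow> \<bar>partial_deriv i f x\<bar>) (at 0)"
    by (rule tendsto_rabs)
  then show ?thesis
  proof (rule tendsto_upperbound)
    show "\<forall>\<^sub>F h in at 0. \<bar>(f (x + h *\<^sub>R axis i 1) - f x) / h\<bar> \<le> A"
      unfolding eventually_at_filter
    proof (rule always_eventually, intro allI impI)
      fix h :: real assume "h \<noteq> 0"
      then show "\<bar>(f (x + h *\<^sub>R axis i 1) - f x) / h\<bar> \<le> A"
        using lip[of "x + h *\<^sub>R axis i 1"] by (simp add: field_simps norm_axis_1)
    qed
  qed simp
qed

section \<open>Mollification of convex Lipschitz functions at length L\<close>

definition rho_mass :: "'n::finite itself \<Rightarrow> real" where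
  "rho_mass _ = integral\<^sup>L lborel (rho :: real^'n \<Rightarrow> real)"

lemma abs_integral_rho_le:
  fixes f :: "real^'n \<Rightarrow> real"
  assumes "continuous_on UNIV f" "\<And>y. norm y \<le> 1 \<Longrightarrow> \<bar>f y\<bar> \<le> M"
  shows "\<bar>\<integral>y. f y * rho y \<partial>lborel\<bar> \<le> M * rho_mass TYPE('n)"
proof -
  have "\<bar>\<integral>y. f y * rho y \<partial>lborel\<bar> \<le> (\<integral>y. M * rho (y::real^'n) \<partial>lborel)"
  proof (rule integral_abs_bound_integral)
    fix y :: "real^'n"
    show "\<bar>f y * rho y\<bar> \<le> M * rho y"
    proof (cases "norm y \<le> 1")
      case True
      then show ?thesis using assms(2) by (simp add: abs_mult rho_nonneg mult_right_mono)
    next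
      case False
      then have "rho y = 0" using unit_supp_rho unfolding unit_supp_def by (auto simp: not_le)
      then show ?thesis by simp
    qed
  qed (intro integrable_mult_unit_supp assms continuous_intros continuous_rho unit_supp_rho)+
  then show ?thesis by (simp add: rho_mass_def)
qed

text \<open>Written through the unit-scale convolution of the rescaled function, so that the results
  on \<open>conv\<close> apply; two derivatives then bring the factor 1/L^2. As \<open>rho\<close>
  is not normalised, \<open>rho_mass\<close> appears in the bounds.\<close>

definition smoothing :: "real \<Rightarrow> (real^'n \<Rightarrow> real) \<Rightarrow> real^'n \<Rightarrow> real" where
  "smoothing L \<psi> x = conv (\<lambda>z. \<psi> (L *\<^sub>R z)) rho ((1 / L) *\<^sub>R x)"

context
  fixes L A :: real and \<psi> :: "real^'n \<Rightarrow> real"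
  assumes L: "0 < L" and cvx: "convex_on UNIV \<psi>"
    and lip: "\<And>x y. \<bar>\<psi> x - \<psi> y\<bar> \<le> A * norm (x - y)"
begin

lemma continuous_lipschitz: "continuous_on S \<psi>"
proof -
  have "A \<ge> 0" using lip[of "axis undefined 1" 0] by (auto simp: norm_axis_1 intro: order_trans[OF abs_ge_zero])
  then have "A-lipschitz_on S \<psi>"
    using lip by (intro lipschitz_onI) (auto simp: dist_norm)
  then show ?thesis by (rule lipschitz_on_continuous_on)
qed

lemma continuous_lipschitz_scale: "continuous_on S (\<lambda>z. \<psi> (L *\<^sub>R z))"
  by (intro continuous_on_compose2[OF continuous_lipschitz[of UNIV]] continuous_intros) auto

lemma smooth_smoothing: "smooth_fun (smoothing L \<psi>)"
  unfolding smoothing_def[abs_def]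
  by (intro smooth_fun_scale[of "conv (\<lambda>z. \<psi> (L *\<^sub>R z)) rho"] smooth_fun_conv continuous_lipschitz_scale smooth_rho unit_supp_rho)

lemma smoothing_eq: "smoothing L \<psi> x = (\<integral>y. \<psi> (x + L *\<^sub>R y) * rho y \<partial>lborel)"
  using L by (simp add: smoothing_def conv_eq[OF continuous_lipschitz_scale continuous_rho] scaleR_add_right)

lemma smoothing_integrable: "integrable lborel (\<lambda>y. \<psi> (x + L *\<^sub>R y) * rho y)"
  by (intro integrable_mult_unit_supp continuous_rho unit_supp_rho
      continuous_on_compose2[OF continuous_lipschitz[of UNIV]] continuous_intros) auto

lemma convex_smoothing: "convex_on UNIV (smoothing L \<psi>)"
proof (rule convex_onI)
  fix t and a b :: "real^'n" assume t: "0 < t" "t < (1::real)"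
  have "smoothing L \<psi> ((1 - t) *\<^sub>R a + t *\<^sub>R b) \<le>
      (\<integral>y. (1 - t) * (\<psi> (a + L *\<^sub>R y) * rho y) + t * (\<psi> (b + L *\<^sub>R y) * rho y) \<partial>lborel)"
    unfolding smoothing_eq
  proof (rule integral_mono[OF smoothing_integrable])
    fix y :: "real^'n"
    have "\<psi> ((1 - t) *\<^sub>R (a + L *\<^sub>R y) + t *\<^sub>R (b + L *\<^sub>R y)) \<le> (1 - t) * \<psi> (a + L *\<^sub>R y) + t * \<psi> (b + L *\<^sub>R y)"
      by (rule convex_on_UNIV_D[OF cvx]) (use t in auto)
    moreover have "(1 - t) *\<^sub>R (a + L *\<^sub>R y) + t *\<^sub>R (b + L *\<^sub>R y) = (1 - t) *\<^sub>R a + t *\<^sub>R b + L *\<^sub>R y"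
      by (simp add: algebra_simps)
    ultimately have "\<psi> ((1 - t) *\<^sub>R a + t *\<^sub>R b + L *\<^sub>R y) \<le> (1 - t) * \<psi> (a + L *\<^sub>R y) + t * \<psi> (b + L *\<^sub>R y)"
      by simp
    from mult_right_mono[OF this rho_nonneg[of y]]
    show "\<psi> ((1 - t) *\<^sub>R a + t *\<^sub>R b + L *\<^sub>R y) * rho y
        \<le> (1 - t) * (\<psi> (a + L *\<^sub>R y) * rho y) + t * (\<psi> (b + L *\<^sub>R y) * rho y)"
      by (simp add: algebra_simps)
  qed (simp add: smoothing_integrable)
  also have "\<dots> = (1 - t) * smoothing L \<psi> a + t * smoothing L \<psi> b"
    unfolding smoothing_eq by (simp add: smoothing_integrable)
  finally show "smoothing L \<psi> ((1 - t) *\<^sub>R a + t *\<^sub>R b) \<le> (1 - t) * smoothing L \<psi> a + t * smoothing L \<psi> b" .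
qed auto

lemma abs_smoothing_le:
  assumes "L \<le> 1" "norm x \<le> 1" "\<And>z. norm z \<le> 2 \<Longrightarrow> \<bar>\<psi> z\<bar> \<le> M"
  shows "\<bar>smoothing L \<psi> x\<bar> \<le> M * rho_mass TYPE('n)"
  unfolding smoothing_eq
proof (rule abs_integral_rho_le)
  fix y :: "real^'n" assume "norm y \<le> 1"
  then have "norm (L *\<^sub>R y) \<le> 1" using L assms(1) by (simp add: mult_le_one)
  then have "norm (x + L *\<^sub>R y) \<le> 2" using norm_triangle_ineq[of x "L *\<^sub>R y"] assms(2) by linarith
  then show "\<bar>\<psi> (x + L *\<^sub>R y)\<bar> \<le> M" by (rule assms(3))
qed (intro continuous_on_compose2[OF continuous_lipschitz[of UNIV]] continuous_intros; simp)

lemma abs_partial_smoothing_le: "\<bar>partial_deriv i (smoothing L \<psi>) x\<bar> \<le> A * rho_mass TYPE('n)"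
proof (rule abs_partial_deriv_le[OF smooth_smoothing])
  fix y :: "real^'n"
  have "smoothing L \<psi> y - smoothing L \<psi> x = (\<integral>z. (\<psi> (y + L *\<^sub>R z) - \<psi> (x + L *\<^sub>R z)) * rho z \<partial>lborel)"
    unfolding smoothing_eq by (simp add: left_diff_distrib smoothing_integrable)
  also have "\<bar>\<dots>\<bar> \<le> (A * norm (y - x)) * rho_mass TYPE('n)"
  proof (rule abs_integral_rho_le)
    show "\<bar>\<psi> (y + L *\<^sub>R z) - \<psi> (x + L *\<^sub>R z)\<bar> \<le> A * norm (y - x)" for z
      using lip[of "y + L *\<^sub>R z" "x + L *\<^sub>R z"] by simp
  qed (intro continuous_on_compose2[OF continuous_lipschitz[of UNIV]] continuous_intros; simp)
  finally show "\<bar>smoothing L \<psi> y - smoothing L \<psi> x\<bar> \<le> A * rho_mass TYPE('n) * norm (y - x)"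
    by (simp add: mult_ac)
qed

text \<open>Planes of slopes p and q through the same point separate at rate |p - q| in the
  direction of p - q. A step of length L/4, the longest that the kink lemma allows, gains |p - q|
  L/4, and the offset of x from xk loses at most half of it. The excess |p - q| L/8 of \<psi> over
  the q-plane enters \<open>laplacian_conv_ge_kink\<close> with the factor \<open>mv_const\<close> /
  2.\<close>

lemma laplacian_smoothing_ge:
  assumes p: "\<And>z. \<tau> + p \<bullet> (z - xk) \<le> \<psi> z" and q: "\<And>z. \<tau> + q \<bullet> (z - xk) \<le> \<psi> z"
    and xk: "\<psi> xk \<le> \<tau> + \<delta>" and near: "norm (x - xk) \<le> mv_const TYPE('n) / (8 * kap_mass TYPE('n)) * L"
  shows "(mv_const TYPE('n) / 16 * norm (p - q) * L - kap_mass TYPE('n) * \<delta>) / L\<^sup>2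
    \<le> laplacian (smoothing L \<psi>) x"
proof -
  let ?w = "\<lambda>z. \<psi> (L *\<^sub>R z)"
  let ?\<beta> = "mv_const TYPE('n)" and ?K = "kap_mass TYPE('n)"
  have \<beta>: "0 < ?\<beta>" "?\<beta> \<le> ?K" using mv_const_pos mv_const_le_kap_mass by auto
  have wcvx: "convex_on UNIV ?w"
    by (rule convex_on_affine_compose[OF cvx]) (simp add: algebra_simps)
  define X where "X = (1 / L) *\<^sub>R x"
  define yk where "yk = (1 / L) *\<^sub>R (xk - x)"
  define b where "b = \<tau> + q \<bullet> (x - xk)"
  have LX: "L *\<^sub>R (X + y) = x + L *\<^sub>R y" for y using L by (simp add: X_def scaleR_add_right)
  have Lyk: "x + L *\<^sub>R yk = xk" using L by (simp add: yk_def)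
  have Lq: "(L *\<^sub>R q) \<bullet> yk = q \<bullet> (xk - x)" using L by (simp add: yk_def)
  obtain e :: "real^'n" where e: "norm e = 1" "(p - q) \<bullet> e = norm (p - q)"
  proof (cases "p = q")
    case True
    then show ?thesis using that[of "axis undefined 1"] by (simp add: norm_axis_1)
  next
    case False
    then show ?thesis using that[of "(1 / norm (p - q)) *\<^sub>R (p - q)"]
      by (simp add: dot_square_norm power2_eq_square)
  qed
  define c where "c = (1/4) *\<^sub>R e"
  have "?\<beta> / 2 * (?w (X + c) - b - (L *\<^sub>R q) \<bullet> c) - ?K * \<delta>
      \<le> (\<Sum>j\<in>UNIV. conv ?w (partial_derivs [j, j] rho) X)"
  proof (rule laplacian_conv_ge_kink[OF continuous_lipschitz_scale wcvx])
    show "b + L *\<^sub>R q \<bullet> y \<le> \<psi> (L *\<^sub>R (X + y))" for y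
      using q[of "x + L *\<^sub>R y"] by (simp add: LX b_def inner_simps)
    show "\<psi> (L *\<^sub>R (X + yk)) \<le> b + L *\<^sub>R q \<bullet> yk + \<delta>"
      using xk unfolding LX Lyk Lq by (simp add: b_def inner_diff_right)
    show "norm yk \<le> ?\<beta> / (8 * ?K)"
      using near L by (simp add: yk_def norm_minus_commute pos_divide_le_eq)
    show "norm c \<le> 1/4" by (simp add: c_def e)
  qed
  moreover have "norm (p - q) * L / 8 \<le> ?w (X + c) - b - (L *\<^sub>R q) \<bullet> c"
  proof -
    have "?\<beta> / (8 * ?K) * L \<le> 1/8 * L" using \<beta> L by (intro mult_right_mono) (auto simp: field_simps)
    with near have "norm (x - xk) \<le> L/8" by linarith
    then have "norm (p - q) * norm (x - xk) \<le> norm (p - q) * (L/8)" by (intro mult_left_mono) auto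
    moreover have "- (norm (p - q) * norm (x - xk)) \<le> (p - q) \<bullet> (x - xk)"
      using Cauchy_Schwarz_ineq2[of "p - q" "x - xk"] by linarith
    moreover have "(p - q) \<bullet> (L *\<^sub>R c) = norm (p - q) * (L/4)"
      using e by (simp add: c_def)
    moreover have "?w (X + c) \<ge> \<tau> + p \<bullet> (x + L *\<^sub>R c - xk)"
      using p by (simp only: LX)
    ultimately show ?thesis
      by (simp add: b_def inner_simps algebra_simps)
  qed
  ultimately have "?\<beta> / 2 * (norm (p - q) * L / 8) - ?K * \<delta> \<le> (\<Sum>j\<in>UNIV. conv ?w (partial_derivs [j, j] rho) X)"
    using \<beta> by (meson diff_right_mono dual_order.trans half_gt_zero less_imp_le mult_left_mono)
  then have 1: "(?\<beta> / 16 * norm (p - q) * L - ?K * \<delta>) / L\<^sup>2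
      \<le> (\<Sum>j\<in>UNIV. conv ?w (partial_derivs [j, j] rho) X) / L\<^sup>2"
    by (intro divide_right_mono) auto
  have s: "smooth_fun (conv ?w rho)"
    by (intro smooth_fun_conv continuous_lipschitz_scale smooth_rho unit_supp_rho)
  have 2: "partial_derivs [j, j] (smoothing L \<psi>) x = conv ?w (partial_derivs [j, j] rho) X / L\<^sup>2" for j
  proof -
    have "partial_deriv j (smoothing L \<psi>) = (\<lambda>x. 1 / L * partial_deriv j (conv ?w rho) ((1 / L) *\<^sub>R x))"
      unfolding smoothing_def[abs_def] by (rule partial_deriv_scale[OF s])
    moreover have "partial_deriv j (\<lambda>x. 1 / L * partial_deriv j (conv ?w rho) ((1 / L) *\<^sub>R x))
      = (\<lambda>x. 1 / L * (1 / L * partial_deriv j (partial_deriv j (conv ?w rho)) ((1 / L) *\<^sub>R x)))"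
      by (subst partial_deriv_mult)
        (auto simp: partial_deriv_const partial_deriv_scale smooth_fun_partial s
          intro!: smooth_fun_differentiable smooth_fun_scale)
    moreover have "partial_deriv j (partial_deriv j (conv ?w rho)) = conv ?w (partial_derivs [j, j] rho)"
      using partial_derivs_conv2[OF continuous_lipschitz_scale smooth_rho unit_supp_rho, of j j] by simp
    ultimately show ?thesis by (simp add: X_def power2_eq_square)
  qed
  show ?thesis using 1 by (simp only: 2 flip: sum_divide_distrib)
qed

end

section \<open>Convex functions with prescribed kinks\<close>

text \<open>Slopes \<open>p\<close> for which the plane of slope \<open>p\<close> through \<open>(x k, - t k)\<close> lies below \<open>(x j, - t j)\<close> for
  every \<open>j\<close>, and below \<open>0\<close> on the sphere of radius \<open>2\<close>.\<close>

definition contact_slopes :: "'i set \<Rightarrow> ('i \<Rightarrow> real^'n) \<Rightarrow> ('i \<Rightarrow> real) \<Rightarrow> 'i \<Rightarrow> (real^'n) set" where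
  "contact_slopes I x t k = {p. (\<forall>j\<in>I. p \<bullet> (x j - x k) \<le> t k - t j) \<and> 2 * norm p \<le> t k + p \<bullet> x k}"

lemma contact_slopes_norm_le:
  assumes "p \<in> contact_slopes I x t k" "norm (x k) \<le> 1"
  shows "norm p \<le> t k"
proof -
  have "p \<bullet> x k \<le> norm p * norm (x k)" by (rule norm_cauchy_schwarz)
  also have "\<dots> \<le> norm p * 1" using assms by (intro mult_left_mono) auto
  finally show ?thesis using assms(1) by (auto simp: contact_slopes_def)
qed

lemma compact_contact_slopes:
  assumes "norm (x k) \<le> 1"
  shows "compact (contact_slopes I x t k)"
proof -
  have "closed (contact_slopes I x t k)"
    unfolding contact_slopes_def Ball_def imp_conv_disj
    by (intro closed_Collect_conj closed_Collect_all closed_Collect_disj closed_Collect_const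
        closed_Collect_le continuous_intros)
  moreover have "bounded (contact_slopes I x t k)"
    by (rule boundedI[of _ "t k"]) (use contact_slopes_norm_le[where x=x and k=k and I=I and t=t] assms in blast)
  ultimately show ?thesis by (simp add: compact_eq_bounded_closed)
qed

text \<open>Lift a plane of slope p from far below until it first touches one of the points (x j, -
  t j): the node touched maximises t j + p \<bullet> x j. As |x k| \<le> 1, the bound 3 |p| \<le> t
  k leaves at least 2 |p| for this maximum, which keeps the plane below 0 on the sphere.\<close>

lemma contact_slopes_cover:
  assumes "finite I" "k \<in> I" "\<And>j. j \<in> I \<Longrightarrow> norm (x j) \<le> 1" "3 * norm p \<le> t k"
  shows "\<exists>j\<in>I. p \<in> contact_slopes I x t j"
proof -
  define h where "h j = t j + p \<bullet> x j" for j
  have "finite (h ` I)" "h ` I \<noteq> {}" using assms by auto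
  then have "Max (h ` I) \<in> h ` I" "\<And>i. i \<in> I \<Longrightarrow> h i \<le> Max (h ` I)" by (auto intro: Max_in)
  then obtain j where j: "j \<in> I" "\<And>i. i \<in> I \<Longrightarrow> h i \<le> h j" by auto
  have "- (p \<bullet> x k) \<le> norm p * norm (x k)" using Cauchy_Schwarz_ineq2[of p "x k"] by linarith
  also have "\<dots> \<le> norm p * 1" using assms by (intro mult_left_mono) auto
  finally have "2 * norm p \<le> h k" using assms(4) by (simp add: h_def)
  then have "2 * norm p \<le> h j" using j(2)[OF assms(2)] by linarith
  moreover have "p \<bullet> (x i - x j) \<le> t j - t i" if "i \<in> I" for i
    using j(2)[OF that] by (simp add: h_def inner_diff_right)
  ultimately have "p \<in> contact_slopes I x t j" by (simp add: contact_slopes_def h_def)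
  then show ?thesis using j(1) by blast
qed

text \<open>Raising depth k shrinks the contact sets at all other nodes. If a maximal admissible
  vector stops being admissible when depth k is raised by \<delta>, the contact set at k itself must
  have become too large, and it no longer fits into the ball of radius r k around one of its own
  elements. The two slopes belong to the raised vector, a different one for each k; the \<delta> in
  the later lemmas pays for this.\<close>

lemma discrete_monge_ampere:
  fixes x :: "'i \<Rightarrow> real^'n"
  assumes I: "finite I" and x: "\<And>k. k \<in> I \<Longrightarrow> norm (x k) \<le> 1"
    and r: "\<And>k. k \<in> I \<Longrightarrow> 0 \<le> r k" and N: "(\<Sum>k\<in>I. r k ^ CARD('n)) \<le> N ^ CARD('n)" "0 \<le> N"
    and \<delta>: "0 < \<delta>"
  shows "\<exists>t. \<forall>k\<in>I. 0 \<le> t k \<and> t k \<le> 3 * N \<and>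
     (\<exists>p\<in>contact_slopes I x (t(k := t k + \<delta>)) k. \<exists>q\<in>contact_slopes I x (t(k := t k + \<delta>)) k. r k \<le> norm (p - q))"
proof -
  let ?d = "CARD('n)"
  let ?V = "contact_slopes I x"
  let ?\<mu> = "measure (lborel :: (real^'n) measure)"
  define \<omega> where "\<omega> = unit_ball_vol ?d"
  have \<omega>: "\<omega> > 0" by (simp add: \<omega>_def)
  have ball: "?\<mu> (cball c s) = \<omega> * s ^ ?d" if "s \<ge> 0" for c s
    using content_cball[OF that, of c] by (simp add: \<omega>_def)
  have Vc: "compact (?V t k)" if "k \<in> I" for t k
    using x[OF that] by (rule compact_contact_slopes[where x=x and k=k])
  have Vm: "?V t k \<in> sets lborel" if "k \<in> I" for t k
    using borel_compact[OF Vc[OF that]] by simp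
  have Vfin: "emeasure lborel (?V t k) < \<infinity>" if "k \<in> I" for t k
    by (rule emeasure_compact_finite[OF Vc[OF that]])
  \<comment> \<open>Depths are multiples of \<open>\<delta>\<close>, so a maximal admissible vector exists without any continuity of volumes.\<close>
  define S where "S n \<longleftrightarrow> (\<forall>k\<in>I. ?\<mu> (?V (\<lambda>k. \<delta> * real (n k)) k) \<le> \<omega> * r k ^ ?d)" for n :: "'i \<Rightarrow> nat"
  have bound: "\<delta> * real (n k) \<le> 3 * N" if S: "S n" and k: "k \<in> I" for n k
  proof -
    let ?t = "\<lambda>k. \<delta> * real (n k)"
    have "cball 0 (?t k / 3) \<subseteq> (\<Union>j\<in>I. ?V ?t j)"
    proof
      fix p :: "real^'n" assume "p \<in> cball 0 (?t k / 3)"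
      then have "3 * norm p \<le> ?t k" by simp
      then have "\<exists>j\<in>I. p \<in> ?V ?t j"
        by (intro contact_slopes_cover[where k=k]) (use I k x in auto)
      then show "p \<in> (\<Union>j\<in>I. ?V ?t j)" by blast
    qed
    then have "?\<mu> (cball 0 (?t k / 3)) \<le> ?\<mu> (\<Union>j\<in>I. ?V ?t j)"
    proof (rule measure_mono_fmeasurable)
      show "(\<Union>j\<in>I. ?V ?t j) \<in> fmeasurable lborel"
        using I Vm Vfin by (intro fmeasurable.finite_UN fmeasurableI) auto
    qed auto
    also have "\<dots> \<le> (\<Sum>j\<in>I. ?\<mu> (?V ?t j))"
      using I Vm Vfin by (intro measure_UNION_le) auto
    also have "\<dots> \<le> (\<Sum>j\<in>I. \<omega> * r j ^ ?d)" using S by (intro sum_mono) (auto simp: S_def)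
    also have "\<dots> \<le> \<omega> * N ^ ?d" using N(1) \<omega> by (simp flip: sum_distrib_left)
    finally have "(?t k / 3) ^ ?d \<le> N ^ ?d" using \<delta> \<omega> by (subst (asm) ball) auto
    then have "?t k / 3 \<le> N" using N(2) power_mono_iff[of "?t k / 3" N ?d] \<delta> by auto
    then show ?thesis by simp
  qed
  have S0: "S (\<lambda>_. 0)"
    unfolding S_def
  proof
    fix k assume k: "k \<in> I"
    have "?V (\<lambda>_. 0) k \<subseteq> {0}"
      using contact_slopes_norm_le[where I=I and x=x and t="\<lambda>_. 0" and k=k] x[OF k] by auto
    then have "?\<mu> (?V (\<lambda>_. 0) k) \<le> ?\<mu> {0}"
      by (rule measure_mono_fmeasurable) (use Vm k in \<open>auto intro!: fmeasurableI\<close>)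
    then have "?\<mu> (?V (\<lambda>_. 0) k) \<le> 0" by simp
    also have "0 \<le> \<omega> * r k ^ ?d" using \<omega> r[OF k] by auto
    finally show "?\<mu> (?V (\<lambda>k. \<delta> * real 0) k) \<le> \<omega> * r k ^ ?d" by simp
  qed
  have "\<forall>n. S n \<longrightarrow> (\<Sum>k\<in>I. n k) \<le> card I * nat \<lceil>3 * N / \<delta>\<rceil>"
  proof (intro allI impI sum_bounded_above[of I _ "nat \<lceil>3 * N / \<delta>\<rceil>", simplified])
    fix n k assume "S n" "k \<in> I"
    from bound[OF this] \<delta> have "real (n k) \<le> 3 * N / \<delta>" by (simp add: field_simps)
    then show "n k \<le> nat \<lceil>3 * N / \<delta>\<rceil>" by linarith
  qed
  then have "\<forall>n. S n \<longrightarrow> (\<Sum>k\<in>I. n k) < Suc (card I * nat \<lceil>3 * N / \<delta>\<rceil>)"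
    by (simp add: less_Suc_eq_le)
  \<comment> \<open>Maximising the total depth suffices: increasing a single entry increases the sum
    and so cannot be admissible.\<close>
  from ex_has_greatest_nat[where P=S and f="\<lambda>n. \<Sum>k\<in>I. n k", OF S0 this]
  obtain n where n: "S n" "\<And>n'. S n' \<Longrightarrow> (\<Sum>k\<in>I. n' k) \<le> (\<Sum>k\<in>I. n k)" by blast
  define t where "t k = \<delta> * real (n k)" for k
  show ?thesis
  proof (intro exI[of _ t] ballI conjI)
    fix k assume k: "k \<in> I"
    show "0 \<le> t k" using \<delta> by (simp add: t_def)
    show "t k \<le> 3 * N" using bound[OF n(1) k] by (simp add: t_def)
    let ?n' = "n(k := Suc (n k))"
    let ?t' = "t(k := t k + \<delta>)"
    have t': "(\<lambda>j. \<delta> * real (?n' j)) = ?t'" by (auto simp: t_def fun_eq_iff algebra_simps)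
    have "(\<Sum>j\<in>I. ?n' j) = Suc (\<Sum>j\<in>I. n j)"
      using I k by (subst (1 2) sum.remove[of _ k]) auto
    then have "\<not> S ?n'" using n(2) by fastforce
    then obtain j where j: "j \<in> I" "\<omega> * r j ^ ?d < ?\<mu> (?V ?t' j)"
      unfolding S_def t' by (auto simp: not_le)
    have "j = k"
    proof (rule ccontr)
      assume "j \<noteq> k"
      \<comment> \<open>The constraints at j are the bounds t j - t i; raising t k lowers the one
        with i = k and leaves the others alone.\<close>
      have "?V ?t' j \<subseteq> ?V t j"
      proof
        fix p assume p: "p \<in> ?V ?t' j"
        have "p \<bullet> (x i - x j) \<le> t j - t i" if "i \<in> I" for i
        proof -
          have "p \<bullet> (x i - x j) \<le> ?t' j - ?t' i" using p that unfolding contact_slopes_def by blast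
          then show ?thesis using \<open>j \<noteq> k\<close> \<delta> by (auto split: if_splits)
        qed
        then show "p \<in> ?V t j" using p \<open>j \<noteq> k\<close> by (simp add: contact_slopes_def)
      qed
      then have "?\<mu> (?V ?t' j) \<le> ?\<mu> (?V t j)"
        using Vm Vfin j(1) by (intro measure_mono_fmeasurable fmeasurableI) auto
      also have "\<dots> \<le> \<omega> * r j ^ ?d" using n(1) j(1) by (auto simp: S_def t_def[abs_def])
      finally show False using j(2) by simp
    qed
    with j have big: "\<omega> * r k ^ ?d < ?\<mu> (?V ?t' k)" by simp
    moreover have "0 \<le> \<omega> * r k ^ ?d" using \<omega> r[OF k] by auto
    ultimately have "?V ?t' k \<noteq> {}" by (metis less_le_not_le measure_empty)
    then obtain q where q: "q \<in> ?V ?t' k" by blast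
    have "\<not> ?V ?t' k \<subseteq> cball q (r k)"
    proof
      assume "?V ?t' k \<subseteq> cball q (r k)"
      then have "?\<mu> (?V ?t' k) \<le> ?\<mu> (cball q (r k))"
        using Vm k emeasure_bounded_finite[OF bounded_cball, of q "r k"]
        by (intro measure_mono_fmeasurable fmeasurableI) auto
      with big show False by (simp add: ball r k)
    qed
    then obtain p where "p \<in> ?V ?t' k" "p \<notin> cball q (r k)" by blast
    then have "p \<in> ?V ?t' k" "r k < norm (p - q)"
      by (auto simp: dist_norm norm_minus_commute)
    with q show "\<exists>p\<in>?V ?t' k. \<exists>q\<in>?V ?t' k. r k \<le> norm (p - q)" by (meson less_imp_le)
  qed
qed

section \<open>Maxima of finitely many affine functions\<close>

lemma max_affine_convex:
  fixes s :: "'j \<Rightarrow> 'v::real_inner"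
  assumes J: "finite J" "J \<noteq> {}"
  shows "convex_on UNIV (\<lambda>z. Max ((\<lambda>j. a j + s j \<bullet> z) ` J))"
proof (rule convex_onI)
  fix t :: real and y z :: 'v assume t: "0 < t" "t < 1"
  let ?M = "\<lambda>z. Max ((\<lambda>j. a j + s j \<bullet> z) ` J)"
  have "a j + s j \<bullet> ((1 - t) *\<^sub>R y + t *\<^sub>R z) \<le> (1 - t) * ?M y + t * ?M z" if "j \<in> J" for j
  proof -
    have "a j + s j \<bullet> ((1 - t) *\<^sub>R y + t *\<^sub>R z) = (1 - t) * (a j + s j \<bullet> y) + t * (a j + s j \<bullet> z)"
      by (simp add: inner_simps algebra_simps)
    also have "\<dots> \<le> (1 - t) * ?M y + t * ?M z"
      using J that t by (intro add_mono mult_left_mono) auto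
    finally show ?thesis .
  qed
  then show "?M ((1 - t) *\<^sub>R y + t *\<^sub>R z) \<le> (1 - t) * ?M y + t * ?M z"
    using J by (subst Max_le_iff) auto
qed auto

lemma max_affine_lipschitz:
  fixes s :: "'j \<Rightarrow> 'v::real_inner"
  assumes J: "finite J" "J \<noteq> {}" and s: "\<And>j. j \<in> J \<Longrightarrow> norm (s j) \<le> A"
  shows "\<bar>Max ((\<lambda>j. a j + s j \<bullet> y) ` J) - Max ((\<lambda>j. a j + s j \<bullet> z) ` J)\<bar> \<le> A * norm (y - z)"
proof -
  let ?M = "\<lambda>z. Max ((\<lambda>j. a j + s j \<bullet> z) ` J)"
  have "?M y \<le> ?M z + A * norm (y - z)" for y z
  proof -
    have "a j + s j \<bullet> y \<le> ?M z + A * norm (y - z)" if "j \<in> J" for j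
    proof -
      have "s j \<bullet> (y - z) \<le> norm (s j) * norm (y - z)" by (rule norm_cauchy_schwarz)
      also have "\<dots> \<le> A * norm (y - z)" using s[OF that] by (intro mult_right_mono) auto
      finally have "a j + s j \<bullet> y \<le> (a j + s j \<bullet> z) + A * norm (y - z)" by (simp add: inner_simps)
      also have "a j + s j \<bullet> z \<le> ?M z" using J that by auto
      finally show ?thesis by simp
    qed
    then show ?thesis using J by (subst Max_le_iff) auto
  qed
  from this[of y z] this[of z y] show ?thesis by (simp add: norm_minus_commute abs_le_iff)
qed

text \<open>\<psi> is the maximum of the planes of slopes P k and Q k through (x k, - t k -
  \<delta>). The contact inequalities for the vector raised at node j say that the planes of j stay
  at or below - t k at x k, so \<psi> exceeds the height of the two planes of k there by at most
  \<delta>.\<close>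

lemma convex_with_prescribed_kinks:
  fixes x :: "'i \<Rightarrow> real^'n"
  assumes I: "finite I" "I \<noteq> {}" and x: "\<And>k. k \<in> I \<Longrightarrow> norm (x k) \<le> 1"
    and r: "\<And>k. k \<in> I \<Longrightarrow> 0 \<le> r k" and N: "(\<Sum>k\<in>I. r k ^ CARD('n)) \<le> N ^ CARD('n)"
    and \<delta>: "0 < \<delta>" "\<delta> \<le> N"
  obtains \<psi> :: "real^'n \<Rightarrow> real" where "convex_on UNIV \<psi>"
    "\<And>y z. \<bar>\<psi> y - \<psi> z\<bar> \<le> 4 * N * norm (y - z)"
    "\<And>z. norm z \<le> 2 \<Longrightarrow> \<bar>\<psi> z\<bar> \<le> 16 * N"
    "\<And>k. k \<in> I \<Longrightarrow> \<exists>\<tau> p q. (\<forall>z. \<tau> + p \<bullet> (z - x k) \<le> \<psi> z) \<and> (\<forall>z. \<tau> + q \<bullet> (z - x k) \<le> \<psi> z)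
       \<and> \<psi> (x k) \<le> \<tau> + \<delta> \<and> r k \<le> norm (p - q)"
proof -
  have N0: "0 \<le> N" using \<delta> by linarith
  let ?V = "\<lambda>t k. contact_slopes I x (t(k := t k + \<delta>)) k"
  let ?T = "\<lambda>t. \<forall>k\<in>I. 0 \<le> t k \<and> t k \<le> 3 * N \<and> (\<exists>p\<in>?V t k. \<exists>q\<in>?V t k. r k \<le> norm (p - q))"
  have "\<exists>t. ?T t"
    by (rule discrete_monge_ampere) (use I x r N N0 \<delta> in auto)
  then obtain t where t: "?T t" ..
  then have "\<forall>k\<in>I. \<exists>p q. p \<in> contact_slopes I x (t(k := t k + \<delta>)) k \<and> q \<in> contact_slopes I x (t(k := t k + \<delta>)) k
      \<and> r k \<le> norm (p - q)" by blast
  then obtain P Q where PQ: "\<And>k. k \<in> I \<Longrightarrow> P k \<in> contact_slopes I x (t(k := t k + \<delta>)) k"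
    "\<And>k. k \<in> I \<Longrightarrow> Q k \<in> contact_slopes I x (t(k := t k + \<delta>)) k"
    "\<And>k. k \<in> I \<Longrightarrow> r k \<le> norm (P k - Q k)" by metis
  define s where "s j = (if snd j then P (fst j) else Q (fst j))" for j :: "'i \<times> bool"
  define a where "a j = - t (fst j) - \<delta> - s j \<bullet> x (fst j)" for j
  define J where "J = I \<times> (UNIV :: bool set)"
  define \<psi> where "\<psi> z = Max ((\<lambda>j. a j + s j \<bullet> z) ` J)" for z
  have J: "finite J" "J \<noteq> {}" using I by (auto simp: J_def)
  have s_in: "s j \<in> contact_slopes I x (t(fst j := t (fst j) + \<delta>)) (fst j)" if "j \<in> J" for j
    using that PQ by (auto simp: s_def J_def)
  have s_norm: "norm (s j) \<le> 4 * N" if "j \<in> J" for j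
  proof -
    have k: "fst j \<in> I" using that by (auto simp: J_def)
    show ?thesis using contact_slopes_norm_le[where k="fst j", OF s_in[OF that] x[OF k]] bspec[OF t k] \<delta> by simp
  qed
  have s_le: "a j + s j \<bullet> z \<le> \<psi> z" if "j \<in> J" for j z
    unfolding \<psi>_def using J that by auto
  show ?thesis
  proof
    show "convex_on UNIV \<psi>" unfolding \<psi>_def[abs_def] by (rule max_affine_convex[OF J])
    show "\<bar>\<psi> y - \<psi> z\<bar> \<le> 4 * N * norm (y - z)" for y z
      unfolding \<psi>_def by (rule max_affine_lipschitz[OF J s_norm])
    show "\<bar>\<psi> z\<bar> \<le> 16 * N" if z: "norm z \<le> 2" for z
    proof -
      have "\<psi> z \<in> (\<lambda>j. a j + s j \<bullet> z) ` J" unfolding \<psi>_def using J by (intro Max_in) auto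
      then obtain j where j: "j \<in> J" "\<psi> z = a j + s j \<bullet> z" by blast
      have k: "fst j \<in> I" using j by (auto simp: J_def)
      have "\<psi> z = - (t (fst j) + \<delta>) + s j \<bullet> (z - x (fst j))" using j by (simp add: a_def inner_simps)
      then have "\<bar>\<psi> z\<bar> \<le> \<bar>t (fst j) + \<delta>\<bar> + \<bar>s j \<bullet> (z - x (fst j))\<bar>" by linarith
      also have "\<bar>s j \<bullet> (z - x (fst j))\<bar> \<le> norm (s j) * norm (z - x (fst j))" by (rule Cauchy_Schwarz_ineq2)
      \<comment> \<open>Slopes are at most the raised depth, hence at most 4 N, and z has distance
        at most 3 from a node. Together with the raised depth itself this makes 16 N.\<close>
      also have "\<dots> \<le> (4 * N) * 3"
        using s_norm[OF j(1)] norm_triangle_ineq4[of z "x (fst j)"] z x[OF k] N0 by (intro mult_mono) auto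
      finally show ?thesis using bspec[OF t k] \<delta> by simp
    qed
    fix k assume k: "k \<in> I"
    show "\<exists>\<tau> p q. (\<forall>z. \<tau> + p \<bullet> (z - x k) \<le> \<psi> z) \<and> (\<forall>z. \<tau> + q \<bullet> (z - x k) \<le> \<psi> z)
       \<and> \<psi> (x k) \<le> \<tau> + \<delta> \<and> r k \<le> norm (p - q)"
    proof (rule exI[of _ "- t k - \<delta>"], rule exI[of _ "P k"], rule exI[of _ "Q k"], intro conjI allI)
      show "- t k - \<delta> + P k \<bullet> (z - x k) \<le> \<psi> z" "- t k - \<delta> + Q k \<bullet> (z - x k) \<le> \<psi> z" for z
        using s_le[of "(k, True)" z] s_le[of "(k, False)" z] k
        by (simp_all add: J_def a_def s_def inner_simps)
      show "r k \<le> norm (P k - Q k)" by (rule PQ(3)[OF k])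
      have "a j + s j \<bullet> x k \<le> - t k" if j: "j \<in> J" for j
      proof -
        have "s j \<bullet> (x k - x (fst j)) \<le> (t(fst j := t (fst j) + \<delta>)) (fst j) - (t(fst j := t (fst j) + \<delta>)) k"
          using s_in[OF j] k unfolding contact_slopes_def by blast
        then have "s j \<bullet> (x k - x (fst j)) \<le> t (fst j) + \<delta> - t k" using \<delta> by (auto split: if_splits)
        then show ?thesis by (simp add: a_def inner_simps)
      qed
      then show "\<psi> (x k) \<le> - t k - \<delta> + \<delta>"
        unfolding \<psi>_def using J by (subst Max_le_iff) auto
    qed
  qed
qed

text \<open>A finite cover by balls of radius h/2 bounds the size of h-separated sets, since each
  ball holds at most one point. To a separated set of largest cardinality, a point at distance at
  least h from all its elements could still be added.\<close>

lemma maximal_separated_set: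
  fixes S :: "'a::euclidean_space set"
  assumes S: "bounded S" and h: "0 < h"
  obtains X where "finite X" "X \<subseteq> S" "\<And>x y. x \<in> X \<Longrightarrow> y \<in> X \<Longrightarrow> x \<noteq> y \<Longrightarrow> h \<le> dist x y"
    "\<And>x. x \<in> S \<Longrightarrow> \<exists>y\<in>X. dist x y < h"
proof -
  have "seq_compact (closure S)" using S by (simp add: compact_closure flip: compact_eq_seq_compact_metric)
  from seq_compact_imp_totally_bounded[OF this, rule_format, of "h/2"] h
  obtain T where T: "finite T" "closure S \<subseteq> (\<Union>x\<in>T. ball x (h/2))" by auto
  define P where "P X \<longleftrightarrow> finite X \<and> X \<subseteq> S \<and> (\<forall>x\<in>X. \<forall>y\<in>X. x \<noteq> y \<longrightarrow> h \<le> dist x y)" for X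
  have "card X \<le> card T" if X: "P X" for X
  proof -
    have "\<forall>x\<in>X. \<exists>c\<in>T. dist c x < h/2" using X T(2) closure_subset[of S] unfolding P_def by fastforce
    then obtain f where f: "\<And>x. x \<in> X \<Longrightarrow> f x \<in> T \<and> dist (f x) x < h/2" by metis
    have "inj_on f X"
    proof (rule inj_onI, rule ccontr)
      fix x y assume xy: "x \<in> X" "y \<in> X" "f x = f y" "x \<noteq> y"
      have "dist x y \<le> dist (f x) x + dist (f x) y" by (metis dist_commute dist_triangle)
      also have "\<dots> < h" using f[OF xy(1)] f[OF xy(2)] xy(3) by simp
      finally show False using X xy unfolding P_def by fastforce
    qed
    then show ?thesis using f T(1) by (intro card_inj_on_le[of f]) auto
  qed
  then have "\<forall>X. P X \<longrightarrow> card X < Suc (card T)" by (simp add: less_Suc_eq_le)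
  moreover have "P {}" by (simp add: P_def)
  ultimately obtain X where X: "P X" "\<And>Y. P Y \<Longrightarrow> card Y \<le> card X"
    using ex_has_greatest_nat[where P=P and f=card] by metis
  have "\<exists>y\<in>X. dist x y < h" if x: "x \<in> S" for x
  proof (rule ccontr)
    assume "\<not> ?thesis"
    then have far: "\<forall>y\<in>X. h \<le> dist x y" by (auto simp: not_less)
    then have "x \<notin> X" using h by fastforce
    moreover have "P (insert x X)" using X(1) x far unfolding P_def by (auto simp: dist_commute)
    ultimately show False using X(2)[of "insert x X"] X(1) by (simp add: P_def)
  qed
  then show ?thesis using that X(1) unfolding P_def by blast
qed

text \<open>Kinks are placed on an h-net of the half ball and smoothed at length L = h/\<theta>,
  where \<theta> L is the reach of a kink in \<open>laplacian_smoothing_ge\<close>. A jump 64 L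
  g/\<beta> contributes 4 g(k) to the Laplacian near the node k; the depth error may use up 2 g(k),
  and the remaining 2 g(k) dominates g at distance less than h.\<close>

lemma convex_potential:
  "\<exists>C>0. \<forall>(g :: real^'n \<Rightarrow> real) N. continuous_on UNIV g \<longrightarrow> (\<forall>x. 0 < g x) \<longrightarrow> 0 < N \<longrightarrow>
     (\<integral>x. indicator (ball 0 1) x * g x ^ CARD('n) \<partial>lborel) \<le> N ^ CARD('n) \<longrightarrow>
     (\<exists>\<Psi>. smooth_fun \<Psi> \<and> convex_on UNIV \<Psi> \<and> (\<forall>x. norm x \<le> 1 \<longrightarrow> \<bar>\<Psi> x\<bar> \<le> C * N) \<and>
       (\<forall>x i. \<bar>partial_deriv i \<Psi> x\<bar> \<le> C * N) \<and>
       (\<forall>x. norm x < 1/2 \<longrightarrow> g x \<le> laplacian \<Psi> x))"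
proof -
  let ?d = "CARD('n)"
  define \<beta> where "\<beta> = mv_const TYPE('n)"
  define K where "K = kap_mass TYPE('n)"
  define P where "P = rho_mass TYPE('n)"
  define \<omega> where "\<omega> = unit_ball_vol ?d"
  \<comment> \<open>Chosen with 1/\<omega> \<le> \<omega>1^d, which moves the volume factor inside
    the d-th power without taking roots.\<close>
  define \<omega>1 where "\<omega>1 = max 1 (1 / \<omega>)"
  define \<theta> where "\<theta> = \<beta> / (8 * K)"
  \<comment> \<open>The factor 64/(\<beta> \<theta>) converts h g into the jump r; 4 \<omega>1 is
    the loss in comparing the sum over the net with the integral of g^d.\<close>
  define D where "D = 256 * \<omega>1 / (\<beta> * \<theta>)"
  have \<beta>: "0 < \<beta>" "\<beta> \<le> K" using mv_const_pos mv_const_le_kap_mass by (auto simp: \<beta>_def K_def)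
  have P: "0 \<le> P" unfolding P_def rho_mass_def by (intro Bochner_Integration.integral_nonneg rho_nonneg)
  have \<omega>: "0 < \<omega>" by (simp add: \<omega>_def)
  have \<omega>1: "1 \<le> \<omega>1" "1 / \<omega> \<le> \<omega>1 ^ ?d"
  proof -
    show 1: "1 \<le> \<omega>1" by (simp add: \<omega>1_def)
    have "1 / \<omega> \<le> \<omega>1 ^ 1" by (simp add: \<omega>1_def)
    also have "\<dots> \<le> \<omega>1 ^ ?d" using 1 by (intro power_increasing) (auto simp: Suc_le_eq)
    finally show "1 / \<omega> \<le> \<omega>1 ^ ?d" .
  qed
  have \<theta>: "0 < \<theta>" "\<theta> \<le> 1/8" using \<beta> by (auto simp: \<theta>_def field_simps)
  have D: "0 < D" using \<beta> \<theta> \<omega>1 by (simp add: D_def)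
  show ?thesis
  proof (intro exI[of _ "16 * D * (P + 1)"] conjI allI impI)
    show "0 < 16 * D * (P + 1)" using D P by simp
    fix g :: "real^'n \<Rightarrow> real" and N :: real
    assume g: "continuous_on UNIV g" and gpos: "\<forall>x. 0 < g x" and N: "0 < N"
      and int: "(\<integral>x. indicator (ball 0 1) x * g x ^ ?d \<partial>lborel) \<le> N ^ ?d"
    let ?B = "cball (0::real^'n) 1"
    have cpt: "compact ?B" "?B \<noteq> {}" by auto
    obtain x0 where x0: "\<And>x. x \<in> ?B \<Longrightarrow> g x0 \<le> g x"
      using continuous_attains_inf[OF cpt continuous_on_subset[OF g subset_UNIV]] by blast
    define m where "m = g x0"
    have m: "0 < m" "\<And>x. norm x \<le> 1 \<Longrightarrow> m \<le> g x" using x0 gpos by (auto simp: m_def)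
    have "uniformly_continuous_on ?B g"
      by (rule compact_uniformly_continuous[OF continuous_on_subset[OF g] cpt(1)]) auto
    then obtain h0 where h0: "h0 > 0" "\<And>x y. x \<in> ?B \<Longrightarrow> y \<in> ?B \<Longrightarrow> dist y x < h0 \<Longrightarrow> dist (g y) (g x) < m"
      unfolding uniformly_continuous_on_def using m(1) by metis
    have g2: "g y \<le> 2 * g x" if "norm x \<le> 1" "norm y \<le> 1" "dist y x < h0" for x y
      using h0(2)[of x y] m(2)[of x] that by (auto simp: dist_real_def)
    \<comment> \<open>Below h0 the function g varies by at most a factor 2; h \<le> 1/2 keeps the
      balls around the nodes in the unit ball; h \<le> \<theta> gives L \<le> 1.\<close>
    define h where "h = min (min (h0 / 2) (1/2)) \<theta>"
    have h: "0 < h" "h < h0" "h \<le> 1/2" "h \<le> \<theta>" using h0 \<theta> by (auto simp: h_def)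
    define L where "L = h / \<theta>"
    have L: "0 < L" "L \<le> 1" "h = \<theta> * L" using h \<theta> by (auto simp: L_def)
    obtain X where X: "finite X" "X \<subseteq> ball (0::real^'n) (1/2)"
      "\<And>x y. x \<in> X \<Longrightarrow> y \<in> X \<Longrightarrow> x \<noteq> y \<Longrightarrow> h \<le> dist x y"
      "\<And>x. x \<in> ball 0 (1/2) \<Longrightarrow> \<exists>y\<in>X. dist x y < h"
      using maximal_separated_set[OF bounded_ball h(1)] by metis
    have Xne: "X \<noteq> {}" using X(4)[of 0] by auto
    have Xn: "norm x < 1/2" if "x \<in> X" for x using X(2) that by auto
    have int_ball: "integrable lborel (\<lambda>x. indicator (ball a s) x * g x ^ ?d)" for a s
    proof (rule Bochner_Integration.integrable_bound)
      show "integrable lborel (\<lambda>x. indicator (cball a s) x *\<^sub>R g x ^ ?d)"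
        by (intro borel_integrable_compact continuous_intros continuous_on_subset[OF g]) auto
      show "(\<lambda>x. indicator (ball a s) x * g x ^ ?d) \<in> borel_measurable lborel"
        using borel_measurable_continuous_onI[OF g]
        by (auto intro!: borel_measurable_times borel_measurable_power borel_measurable_indicator)
    qed (use gpos in \<open>auto simp: indicator_def less_imp_le\<close>)
    \<comment> \<open>One factor 2^d comes from the radius h/2, the other from g y \<ge> g x / 2 on
      that ball.\<close>
    have local: "h ^ ?d * g x ^ ?d \<le> 4 ^ ?d / \<omega> * (\<integral>y. indicator (ball x (h/2)) y * g y ^ ?d \<partial>lborel)"
      if x: "x \<in> X" for x
    proof -
      have "(\<omega> * (h/2) ^ ?d) * (g x / 2) ^ ?d = (\<integral>y. indicator (ball x (h/2)) y * (g x / 2) ^ ?d \<partial>lborel)"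
        using h content_ball[of "h/2" x] by (simp add: \<omega>_def)
      also have "\<dots> \<le> (\<integral>y. indicator (ball x (h/2)) y * g y ^ ?d \<partial>lborel)"
      proof (rule integral_mono[OF _ int_ball])
        show "integrable lborel (\<lambda>y. indicator (ball x (h/2)) y * (g x / 2) ^ ?d)"
          using emeasure_bounded_finite[of "ball x (h/2)"] by simp
        fix y
        show "indicator (ball x (h/2)) y * (g x / 2) ^ ?d \<le> indicator (ball x (h/2)) y * g y ^ ?d"
        proof (cases "y \<in> ball x (h/2)")
          case True
          then have "dist x y < h0" "norm y \<le> 1"
            using h Xn[OF x] norm_triangle_ineq2[of y x] by (auto simp: dist_norm norm_minus_commute)
          then have "g x / 2 \<le> g y" using g2[of y x] Xn[OF x] by simp
          then have "(g x / 2) ^ ?d \<le> g y ^ ?d" using gpos by (intro power_mono) (auto simp: less_imp_le)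
          then show ?thesis using True by simp
        qed simp
      qed
      finally have "\<omega> * (h ^ ?d * g x ^ ?d) / 4 ^ ?d \<le> (\<integral>y. indicator (ball x (h/2)) y * g y ^ ?d \<partial>lborel)"
        using power_mult_distrib[of "2::real" 2 ?d] by (simp add: power_divide mult_ac)
      then show ?thesis using \<omega> by (simp add: field_simps)
    qed
    have disj: "(\<Sum>x\<in>X. indicator (ball x (h/2)) y) \<le> (indicator (ball 0 1) y :: real)" for y
    proof (cases "\<exists>x\<in>X. y \<in> ball x (h/2)")
      case True
      then obtain x where x: "x \<in> X" "y \<in> ball x (h/2)" by blast
      have "y \<notin> ball x' (h/2)" if "x' \<in> X" "x' \<noteq> x" for x'
      proof
        assume "y \<in> ball x' (h/2)"
        then have "dist x' x < h" using x(2) dist_triangle_half_r[of y x' h x]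
          by (simp add: dist_commute)
        then show False using X(3)[OF that(1) x(1) that(2)] by simp
      qed
      then have "(\<Sum>x'\<in>X. indicator (ball x' (h/2)) y) = (\<Sum>x'\<in>X. if x' = x then 1 else (0::real))"
        using x(2) by (intro sum.cong) auto
      also have "\<dots> = 1" using X(1) x(1) by simp
      finally show ?thesis
        using x h Xn[OF x(1)] norm_triangle_ineq2[of y x] by (auto simp: dist_norm norm_minus_commute)
    next
      case False
      then have "(\<Sum>x'\<in>X. indicator (ball x' (h/2)) y) = (0::real)" by (intro sum.neutral) auto
      then show ?thesis by simp
    qed
    define r where "r x = 64 * L * g x / \<beta>" for x
    define N' where "N' = D * N"
    have r0: "0 \<le> r x" for x using L \<beta> gpos by (auto simp: r_def less_imp_le)
    have N': "0 < N'" using D N by (simp add: N'_def)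
    have "(\<Sum>x\<in>X. h ^ ?d * g x ^ ?d) \<le> (\<Sum>x\<in>X. 4 ^ ?d / \<omega> * (\<integral>y. indicator (ball x (h/2)) y * g y ^ ?d \<partial>lborel))"
      by (intro sum_mono local)
    also have "\<dots> = 4 ^ ?d / \<omega> * (\<integral>y. (\<Sum>x\<in>X. indicator (ball x (h/2)) y * g y ^ ?d) \<partial>lborel)"
      by (subst Bochner_Integration.integral_sum) (auto simp: int_ball sum_distrib_left)
    also have "\<dots> \<le> 4 ^ ?d / \<omega> * (\<integral>y. indicator (ball 0 1) y * g y ^ ?d \<partial>lborel)"
    proof (intro mult_left_mono integral_mono)
      show "(\<Sum>x\<in>X. indicator (ball x (h/2)) y * g y ^ ?d) \<le> indicator (ball 0 1) y * g y ^ ?d" for y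
        unfolding sum_distrib_right[symmetric] using gpos by (intro mult_right_mono disj) (auto simp: less_imp_le)
    qed (use \<omega> in \<open>auto intro: int_ball\<close>)
    also have "\<dots> \<le> 4 ^ ?d / \<omega> * N ^ ?d" using \<omega> int by (intro mult_left_mono) auto
    also have "\<dots> \<le> 4 ^ ?d * \<omega>1 ^ ?d * N ^ ?d"
      using \<omega>1(2) N by (intro mult_right_mono) (auto simp: divide_inverse)
    finally have "(\<Sum>x\<in>X. h ^ ?d * g x ^ ?d) \<le> (4 * \<omega>1 * N) ^ ?d" by (simp add: power_mult_distrib)
    then have "(64 / (\<beta> * \<theta>)) ^ ?d * (\<Sum>x\<in>X. h ^ ?d * g x ^ ?d) \<le> (64 / (\<beta> * \<theta>)) ^ ?d * (4 * \<omega>1 * N) ^ ?d"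
      using \<beta> \<theta> by (intro mult_left_mono) auto
    also have "(64 / (\<beta> * \<theta>)) ^ ?d * (4 * \<omega>1 * N) ^ ?d = (64 / (\<beta> * \<theta>) * (4 * \<omega>1 * N)) ^ ?d"
      by (simp only: power_mult_distrib)
    also have "64 / (\<beta> * \<theta>) * (4 * \<omega>1 * N) = N'"
      by (simp add: N'_def D_def)
    also have "(64 / (\<beta> * \<theta>)) ^ ?d * (\<Sum>x\<in>X. h ^ ?d * g x ^ ?d) = (\<Sum>x\<in>X. r x ^ ?d)"
      unfolding sum_distrib_left power_mult_distrib[symmetric]
      using \<theta> L by (intro sum.cong refl arg_cong[where f="\<lambda>x. x ^ ?d"]) (simp add: r_def field_simps)
    finally have sum_r: "(\<Sum>x\<in>X. r x ^ ?d) \<le> N' ^ ?d" .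
    \<comment> \<open>The second entry makes the loss K \<delta> / L^2 in the Laplacian at most 2 m,
      where m is the minimum of g on the closed unit ball.\<close>
    define \<delta> where "\<delta> = min N' (2 * L\<^sup>2 * m / K)"
    have \<delta>: "0 < \<delta>" "\<delta> \<le> N'" "K * \<delta> \<le> 2 * L\<^sup>2 * m"
    proof -
      show "0 < \<delta>" "\<delta> \<le> N'" using N' L m \<beta> by (auto simp: \<delta>_def)
      have "K * \<delta> \<le> K * (2 * L\<^sup>2 * m / K)" using \<beta> by (intro mult_left_mono) (auto simp: \<delta>_def)
      then show "K * \<delta> \<le> 2 * L\<^sup>2 * m" using \<beta> by simp
    qed
    have Xle1: "norm x \<le> 1" if "x \<in> X" for x using Xn[OF that] by simp
    obtain \<psi> :: "real^'n \<Rightarrow> real" where \<psi>: "convex_on UNIV \<psi>"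
      "\<And>y z. \<bar>\<psi> y - \<psi> z\<bar> \<le> 4 * N' * norm (y - z)"
      "\<And>z. norm z \<le> 2 \<Longrightarrow> \<bar>\<psi> z\<bar> \<le> 16 * N'"
      and kink: "\<And>k. k \<in> X \<Longrightarrow> \<exists>\<tau> p q. (\<forall>z. \<tau> + p \<bullet> (z - k) \<le> \<psi> z) \<and> (\<forall>z. \<tau> + q \<bullet> (z - k) \<le> \<psi> z)
       \<and> \<psi> k \<le> \<tau> + \<delta> \<and> r k \<le> norm (p - q)"
      by (rule convex_with_prescribed_kinks[of X "\<lambda>x. x" r N' \<delta>, OF X(1) Xne Xle1 r0 sum_r \<delta>(1,2)]) blast+
    note sm = L(1) \<psi>(1,2)
    show "\<exists>\<Psi>. smooth_fun \<Psi> \<and> convex_on UNIV \<Psi> \<and> (\<forall>x. norm x \<le> 1 \<longrightarrow> \<bar>\<Psi> x\<bar> \<le> 16 * D * (P + 1) * N) \<and>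
       (\<forall>x i. \<bar>partial_deriv i \<Psi> x\<bar> \<le> 16 * D * (P + 1) * N) \<and>
       (\<forall>x. norm x < 1/2 \<longrightarrow> g x \<le> laplacian \<Psi> x)"
    proof (intro exI[of _ "smoothing L \<psi>"] conjI allI impI)
      show "smooth_fun (smoothing L \<psi>)" by (rule smooth_smoothing[OF sm])
      show "convex_on UNIV (smoothing L \<psi>)" by (rule convex_smoothing[OF sm])
      fix x :: "real^'n"
      have N'P: "16 * N' * P \<le> 16 * D * (P + 1) * N" "4 * N' * P \<le> 16 * N' * P"
        using N' P D N by (auto simp: N'_def algebra_simps)
      show "\<bar>smoothing L \<psi> x\<bar> \<le> 16 * D * (P + 1) * N" if "norm x \<le> 1"
        using abs_smoothing_le[OF sm L(2) that \<psi>(3)] N'P unfolding P_def[symmetric] by linarith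
      show "\<bar>partial_deriv i (smoothing L \<psi>) x\<bar> \<le> 16 * D * (P + 1) * N" for i
        using abs_partial_smoothing_le[OF sm, of i x] N'P unfolding P_def[symmetric] by linarith
      assume x: "norm x < 1/2"
      then obtain k where k: "k \<in> X" "dist x k < h" using X(4)[of x] by auto
      from kink[OF k(1)] obtain \<tau> p q where kk: "\<forall>z. \<tau> + p \<bullet> (z - k) \<le> \<psi> z" "\<forall>z. \<tau> + q \<bullet> (z - k) \<le> \<psi> z"
        "\<psi> k \<le> \<tau> + \<delta>" "r k \<le> norm (p - q)" by blast
      have "(\<beta> / 16 * norm (p - q) * L - K * \<delta>) / L\<^sup>2 \<le> laplacian (smoothing L \<psi>) x"
        unfolding \<beta>_def K_def
        using k(2) L(3)
        by (intro laplacian_smoothing_ge[OF sm, of \<tau> p k q]) (use kk in \<open>auto simp: \<theta>_def \<beta>_def K_def dist_norm\<close>)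
      moreover have "2 * g k \<le> (\<beta> / 16 * norm (p - q) * L - K * \<delta>) / L\<^sup>2"
      proof -
        have "\<beta> / 16 * r k * L = 4 * L\<^sup>2 * g k" using \<beta> by (simp add: r_def power2_eq_square)
        moreover have "\<beta> / 16 * r k * L \<le> \<beta> / 16 * norm (p - q) * L"
          using \<beta> L kk(4) by (intro mult_right_mono mult_left_mono) auto
        moreover have "2 * L\<^sup>2 * m \<le> 2 * L\<^sup>2 * g k" using m(2)[OF Xle1[OF k(1)]] by (intro mult_left_mono) auto
        ultimately have "2 * L\<^sup>2 * g k \<le> \<beta> / 16 * norm (p - q) * L - K * \<delta>" using \<delta>(3) by linarith
        then show ?thesis using L by (simp add: pos_le_divide_eq mult_ac)
      qed
      moreover have "g x \<le> 2 * g k" using g2[of k x] x Xle1[OF k(1)] k(2) h(2) by simp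
      ultimately show "g x \<le> laplacian (smoothing L \<psi>) x" by linarith
    qed
  qed
qed

section \<open>The test function\<close>

text \<open>Elimination writes A as a sum of rank-one matrices, and each of them contributes a value
  of the quadratic form of B. The induction is over a set J of rows outside which A
  vanishes.\<close>

lemma trace_mult_nonneg:
  fixes A B :: "'n::finite \<Rightarrow> 'n \<Rightarrow> real"
  assumes sym: "\<And>i j. A i j = A j i"
    and A: "\<And>\<xi>. 0 \<le> (\<Sum>i\<in>UNIV. \<Sum>j\<in>UNIV. A i j * \<xi> i * \<xi> j)"
    and B: "\<And>\<xi>. 0 \<le> (\<Sum>i\<in>UNIV. \<Sum>j\<in>UNIV. B i j * \<xi> i * \<xi> j)"
  shows "0 \<le> (\<Sum>i\<in>UNIV. \<Sum>j\<in>UNIV. A i j * B i j)"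
proof -
  have "0 \<le> (\<Sum>i\<in>UNIV. \<Sum>j\<in>UNIV. A i j * B i j)"
    if "finite J" "\<And>i j. A i j = A j i" "\<And>\<xi>. 0 \<le> (\<Sum>i\<in>UNIV. \<Sum>j\<in>UNIV. A i j * \<xi> i * \<xi> j)"
      "\<And>i j. i \<notin> J \<Longrightarrow> A i j = 0" for J A
    using that
  proof (induction J arbitrary: A rule: finite_induct)
    case (insert k J)
    let ?Q = "\<lambda>\<xi>. \<Sum>i\<in>UNIV. \<Sum>j\<in>UNIV. A i j * \<xi> i * \<xi> j"
    have expand: "?Q (\<lambda>i. \<xi> i + t * (if i = k then 1 else 0)) = ?Q \<xi> + 2 * t * (\<Sum>j\<in>UNIV. A k j * \<xi> j) + t\<^sup>2 * A k k" for \<xi> t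
    proof -
      have "?Q (\<lambda>i. \<xi> i + t * (if i = k then 1 else 0))
        = ?Q \<xi> + t * (\<Sum>i\<in>UNIV. \<Sum>j\<in>UNIV. A i j * \<xi> i * (if j = k then 1 else 0))
          + t * (\<Sum>i\<in>UNIV. \<Sum>j\<in>UNIV. A i j * \<xi> j * (if i = k then 1 else 0))
          + t\<^sup>2 * (\<Sum>i\<in>UNIV. \<Sum>j\<in>UNIV. A i j * (if i = k then 1 else 0) * (if j = k then 1 else 0))"
        unfolding sum_distrib_left sum.distrib[symmetric]
        by (intro sum.cong refl) (simp add: algebra_simps power2_eq_square)
      also have "(\<Sum>i\<in>UNIV. \<Sum>j\<in>UNIV. A i j * \<xi> i * (if j = k then 1 else 0)) = (\<Sum>j\<in>UNIV. A k j * \<xi> j)"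
        by (simp add: if_distrib[of "\<lambda>x. _ * x"] insert.prems(1)[of _ k] cong: if_cong)
      also have "(\<Sum>i\<in>UNIV. \<Sum>j\<in>UNIV. A i j * \<xi> j * (if i = k then 1 else 0)) = (\<Sum>j\<in>UNIV. A k j * \<xi> j)"
        by (subst sum.swap) (simp add: if_distrib[of "\<lambda>x. _ * x"] cong: if_cong)
      also have "(\<Sum>i\<in>UNIV. \<Sum>j\<in>UNIV. A i j * (if i = k then 1 else 0) * (if j = k then 1 else 0)) = A k k"
        by (simp add: if_distrib[of "\<lambda>x. _ * x"] cong: if_cong)
      finally show ?thesis by simp
    qed
    have Akk: "0 \<le> A k k"
      using insert.prems(2)[of "\<lambda>i. 0 + 1 * (if i = k then 1 else 0)"] unfolding expand by simp
    show ?case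
    proof (cases "A k k = 0")
      case True
      have "A k l = 0" for l
      proof (rule ccontr)
        assume "A k l \<noteq> 0"
        \<comment> \<open>With A k k = 0 the form of A at e_l + t e_k is A l l + 2 t A k l, and this
          t makes it -1.\<close>
        define t where "t = - (A l l + 1) / (2 * A k l)"
        have "0 \<le> ?Q (\<lambda>i. if i = l then 1 else 0) + 2 * t * (\<Sum>j\<in>UNIV. A k j * (if j = l then 1 else 0))"
          using insert.prems(2)[of "\<lambda>i. (if i = l then 1 else 0) + t * (if i = k then 1 else 0)"]
          unfolding expand True by simp
        also have "\<dots> = A l l + 2 * t * A k l"
          by (simp add: if_distrib[of "\<lambda>x. _ * x"] cong: if_cong)
        also have "\<dots> = -1" using \<open>A k l \<noteq> 0\<close> by (simp add: t_def field_simps)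
        finally show False by simp
      qed
      then have zero: "A i j = 0" if "i \<notin> J" for i j
        using insert.prems(3)[of i j] that by (cases "i = k") auto
      show ?thesis by (rule insert.IH[OF insert.prems(1,2) zero])
    next
      case False
      with Akk have pos: "0 < A k k" by simp
      \<comment> \<open>Split off a rank-one matrix; the Schur complement has one row less.\<close>
      define A' where "A' i j = A i j - A k i * A k j / A k k" for i j
      have "0 \<le> (\<Sum>i\<in>UNIV. \<Sum>j\<in>UNIV. A' i j * B i j)"
      proof (rule insert.IH)
        show "A' i j = A' j i" for i j by (simp add: A'_def insert.prems(1)[of i j])
        show "A' i j = 0" if "i \<notin> J" for i j
          using that insert.prems(1,3) pos by (cases "i = k") (auto simp: A'_def)
        fix \<xi> :: "'n \<Rightarrow> real"
        let ?s = "\<Sum>j\<in>UNIV. A k j * \<xi> j"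
        have "A' i j * \<xi> i * \<xi> j = A i j * \<xi> i * \<xi> j - (A k i * \<xi> i) * (A k j * \<xi> j) / A k k" for i j
          by (simp add: A'_def algebra_simps)
        then have "(\<Sum>i\<in>UNIV. \<Sum>j\<in>UNIV. A' i j * \<xi> i * \<xi> j) = ?Q \<xi> - (\<Sum>i\<in>UNIV. \<Sum>j\<in>UNIV. (A k i * \<xi> i) * (A k j * \<xi> j)) / A k k"
          by (simp add: sum_subtractf sum_divide_distrib)
        also have "\<dots> = ?Q \<xi> - ?s\<^sup>2 / A k k" by (simp add: sum_product power2_eq_square)
        also have "\<dots> = ?Q (\<lambda>i. \<xi> i + (- ?s / A k k) * (if i = k then 1 else 0))"
          unfolding expand using pos by (simp add: power2_eq_square field_simps)
        also have "0 \<le> \<dots>" by (rule insert.prems(2))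
        finally show "0 \<le> (\<Sum>i\<in>UNIV. \<Sum>j\<in>UNIV. A' i j * \<xi> i * \<xi> j)" .
      qed
      moreover have "A i j * B i j = A' i j * B i j + B i j * A k i * A k j / A k k" for i j
        by (simp add: A'_def algebra_simps)
      then have "(\<Sum>i\<in>UNIV. \<Sum>j\<in>UNIV. A i j * B i j) = (\<Sum>i\<in>UNIV. \<Sum>j\<in>UNIV. A' i j * B i j)
          + (\<Sum>i\<in>UNIV. \<Sum>j\<in>UNIV. B i j * A k i * A k j) / A k k"
        by (simp add: sum.distrib sum_divide_distrib)
      moreover have "0 \<le> (\<Sum>i\<in>UNIV. \<Sum>j\<in>UNIV. B i j * A k i * A k j) / A k k"
        using B[of "A k"] pos by simp
      ultimately show ?thesis by simp
    qed
  qed simp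
  from this[of UNIV A] show ?thesis using sym A by simp
qed

definition elliptic :: "real \<Rightarrow> real \<Rightarrow> ('n::finite \<Rightarrow> 'n \<Rightarrow> real) \<Rightarrow> bool" where
  "elliptic lam Lam A \<longleftrightarrow> (\<forall>i j. A i j = A j i) \<and>
     (\<forall>\<xi>::real^'n. lam * (norm \<xi>)\<^sup>2 \<le> (\<Sum>i\<in>UNIV. \<Sum>j\<in>UNIV. A i j * \<xi> $ i * \<xi> $ j) \<and>
        (\<Sum>i\<in>UNIV. \<Sum>j\<in>UNIV. A i j * \<xi> $ i * \<xi> $ j) \<le> Lam * (norm \<xi>)\<^sup>2)"

text \<open>The matrix A - lam I is still nonnegative, so its trace product with B is nonnegative
  too.\<close>

lemma elliptic_trace_ge:
  fixes A B :: "'n::finite \<Rightarrow> 'n \<Rightarrow> real"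
  assumes A: "elliptic lam Lam A"
    and B: "\<And>\<xi>::real^'n. 0 \<le> (\<Sum>i\<in>UNIV. \<Sum>j\<in>UNIV. \<xi> $ i * \<xi> $ j * B i j)"
  shows "lam * (\<Sum>j\<in>UNIV. B j j) \<le> (\<Sum>i\<in>UNIV. \<Sum>j\<in>UNIV. A i j * B i j)"
proof -
  define A' where "A' i j = A i j - (if i = j then lam else 0)" for i j
  have "0 \<le> (\<Sum>i\<in>UNIV. \<Sum>j\<in>UNIV. A' i j * B i j)"
  proof (rule trace_mult_nonneg)
    show "A' i j = A' j i" for i j using A by (auto simp: elliptic_def A'_def)
    fix \<xi> :: "'n \<Rightarrow> real"
    define v :: "real^'n" where "v = (\<chi> i. \<xi> i)"
    have "A' i j * \<xi> i * \<xi> j = A i j * v $ i * v $ j - (if j = i then lam * (v $ i * v $ i) else 0)" for i j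
      by (simp add: A'_def v_def algebra_simps)
    then have "(\<Sum>i\<in>UNIV. \<Sum>j\<in>UNIV. A' i j * \<xi> i * \<xi> j)
        = (\<Sum>i\<in>UNIV. \<Sum>j\<in>UNIV. A i j * v $ i * v $ j) - lam * (norm v)\<^sup>2"
      by (simp add: norm_sq_sum sum_subtractf sum_distrib_left)
    then show "0 \<le> (\<Sum>i\<in>UNIV. \<Sum>j\<in>UNIV. A' i j * \<xi> i * \<xi> j)"
      using A by (simp add: elliptic_def)
    show "0 \<le> (\<Sum>i\<in>UNIV. \<Sum>j\<in>UNIV. B i j * \<xi> i * \<xi> j)"
      using B[of v] by (simp add: v_def mult_ac)
  qed
  also have "\<dots> = (\<Sum>i\<in>UNIV. \<Sum>j\<in>UNIV. A i j * B i j) - lam * (\<Sum>j\<in>UNIV. B j j)"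
    by (simp add: A'_def left_diff_distrib sum_subtractf sum_distrib_left
        if_distrib[of "\<lambda>x. x * _"] cong: if_cong)
  finally show ?thesis by simp
qed

text \<open>Nonnegativity of the form at e_i + e_j and e_i - e_j bounds 2 |A i j| by A i i + A j j,
  and the diagonal entries are at most Lam.\<close>

lemma elliptic_abs_le:
  fixes A :: "'n::finite \<Rightarrow> 'n \<Rightarrow> real"
  assumes A: "elliptic lam Lam A" and lam: "0 < lam"
  shows "\<bar>A i j\<bar> \<le> Lam"
proof -
  define Q where "Q \<xi> = (\<Sum>i\<in>UNIV. \<Sum>j\<in>UNIV. A i j * \<xi> $ i * \<xi> $ j)" for \<xi> :: "real^'n"
  have Q: "0 \<le> Q \<xi>" "Q \<xi> \<le> Lam * (norm \<xi>)\<^sup>2" for \<xi>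
    using A lam order_trans[of 0 "lam * (norm \<xi>)\<^sup>2" "Q \<xi>"] unfolding elliptic_def Q_def by auto
  have diag: "Q (axis i 1) = A i i" for i
    unfolding Q_def axis_def by (simp add: if_distrib[of "\<lambda>x. _ * x"] cong: if_cong)
  then have d: "A i i \<le> Lam" for i using Q(2)[of "axis i 1"] by (simp add: norm_axis_1)
  have "Q (axis i 1 + s *\<^sub>R axis j 1) = A i i + s * A i j + s * A j i + s\<^sup>2 * A j j" for s
    unfolding Q_def axis_def
    by (simp add: distrib_left distrib_right sum.distrib power2_eq_square if_distrib[of "\<lambda>x. _ * x"] if_distrib[of "\<lambda>x. x * _"] cong: if_cong)
  from Q(1)[of "axis i 1 + 1 *\<^sub>R axis j 1"] Q(1)[of "axis i 1 + (-1) *\<^sub>R axis j 1"] this[of 1] this[of "-1"]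
  have "\<bar>2 * A i j\<bar> \<le> A i i + A j j" using A by (auto simp: elliptic_def)
  then show ?thesis using d[of i] d[of j] by linarith
qed

lemma sum_axis_mult:
  "(\<Sum>i\<in>UNIV. \<Sum>j\<in>UNIV. (axis k 1 :: real^'n) $ i * (axis k 1 :: real^'n) $ j * H i j) = (H k k :: real)"
proof -
  have "(\<Sum>j\<in>UNIV. (axis k 1 :: real^'n) $ i * (axis k 1 :: real^'n) $ j * H i j) = (if i = k then H k k else 0)" for i
    by (cases "i = k") (auto simp: axis_def if_distrib[of "\<lambda>x. x * _"] cong: if_cong)
  then show ?thesis by simp
qed

text \<open>Where it is positive this is exp(-K / (1/2 - |x|^2)). It vanishes from |x|^2 = 1/2 on,
  between the half ball and the unit sphere. K governs the steepness: for |x| \<ge> 1/2 inside the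
  support, \<open>bump''\<close> exceeds \<open>bump'\<close> by a factor of order K^2.\<close>

definition cutoff :: "real \<Rightarrow> real^'n \<Rightarrow> real" where
  "cutoff K x = bump ((1/2 - (norm x)\<^sup>2) / K)"

lemma smooth_cutoff: "smooth_fun (cutoff K)"
proof -
  have "smooth_fun (\<lambda>x::real^'n. (1/K) * (1/2 - (norm x)\<^sup>2))"
    using smooth_fun_norm_sq[of "1/2" 0] by (intro smooth_fun_mult) auto
  then show ?thesis
    unfolding cutoff_def bump_def by (intro smooth_fun_exp_recip) simp
qed

lemma partial_cutoff:
  fixes K :: real
  defines "s \<equiv> \<lambda>x::real^'n. (1/2 - (norm x)\<^sup>2) / K"
  shows "partial_deriv i (cutoff K) = (\<lambda>x. bump' (s x) * (- 2 * x $ i / K))"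
    and "partial_derivs [i, j] (cutoff K) =
      (\<lambda>x. bump'' (s x) * (4 * x $ i * x $ j / K\<^sup>2) - (if i = j then 2 * bump' (s x) / K else 0))"
proof -
  have s: "smooth_fun s"
  proof -
    have "smooth_fun (\<lambda>x::real^'n. (1/K) * (1/2 - (norm x)\<^sup>2))"
      using smooth_fun_norm_sq[of "1/2" 0] by (intro smooth_fun_mult) auto
    then show ?thesis by (simp add: s_def)
  qed
  have ps: "partial_deriv i s = (\<lambda>x. - 2 * x $ i / K)" for i
  proof -
    have "partial_deriv i (\<lambda>x::real^'n. (1/K) * (1/2 - (norm x)\<^sup>2)) = (\<lambda>x. - 2 * x $ i / K)"
      using smooth_fun_norm_sq[of "1/2" 0]
      by (subst partial_deriv_mult) (auto intro!: smooth_fun_differentiable simp: partial_deriv_const partial_deriv_norm_sq)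
    then show ?thesis by (simp add: s_def)
  qed
  have c: "cutoff K = (\<lambda>x. exp_recip 1 (s x))" by (auto simp: cutoff_def s_def bump_def)
  show 1: "partial_deriv i (cutoff K) = (\<lambda>x. bump' (s x) * (- 2 * x $ i / K))" for i
    unfolding c by (subst partial_deriv_exp_recip[OF s]) (simp add: ps bump'_def)
  have "partial_deriv i (\<lambda>x. bump' (s x) * ((- 2 / K) * x $ j)) =
      (\<lambda>x. (bump'' (s x) * (- 2 * x $ i / K)) * ((- 2 / K) * x $ j) + bump' (s x) * ((- 2 / K) * (if i = j then 1 else 0)))"
  proof (subst partial_deriv_mult)
    show "(\<lambda>x. bump' (s x)) differentiable at x" for x
      unfolding bump'_def by (intro smooth_fun_differentiable smooth_fun_exp_recip s)
    show "(\<lambda>x. - 2 / K * x $ j) differentiable at x" for x :: "real^'n"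
      by (intro smooth_fun_differentiable smooth_fun_mult) auto
    show "(\<lambda>x. partial_deriv i (\<lambda>x. bump' (s x)) x * (- 2 / K * x $ j) + bump' (s x) * partial_deriv i (\<lambda>x. - 2 / K * x $ j) x) =
      (\<lambda>x. (bump'' (s x) * (- 2 * x $ i / K)) * ((- 2 / K) * x $ j) + bump' (s x) * ((- 2 / K) * (if i = j then 1 else 0)))"
      unfolding bump'_def bump''_def
      by (subst partial_deriv_exp_recip[OF s], subst partial_deriv_mult)
        (auto intro!: smooth_fun_differentiable simp: ps partial_deriv_const partial_deriv_component)
  qed
  then show "partial_derivs [i, j] (cutoff K) =
      (\<lambda>x. bump'' (s x) * (4 * x $ i * x $ j / K\<^sup>2) - (if i = j then 2 * bump' (s x) / K else 0))"
    by (auto simp: 1 power2_eq_square fun_eq_iff mult_ac)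
qed

section \<open>The elliptic operator applied to cutoff times convex function\<close>

lemma sum_sum_abs_le:
  fixes A B :: "'n::finite \<Rightarrow> 'n \<Rightarrow> real"
  assumes "\<And>i j. \<bar>A i j\<bar> \<le> a" "\<And>i j. \<bar>B i j\<bar> \<le> b"
  shows "\<bar>\<Sum>i\<in>UNIV. \<Sum>j\<in>UNIV. A i j * B i j\<bar> \<le> (real CARD('n))\<^sup>2 * (a * b)"
proof -
  have "\<bar>A i j * B i j\<bar> \<le> a * b" for i j
    unfolding abs_mult using assms by (intro mult_mono) (auto intro: order_trans[OF abs_ge_zero])
  then have row: "(\<Sum>j\<in>UNIV. \<bar>A i j * B i j\<bar>) \<le> CARD('n) * (a * b)" for i
    using sum_bounded_above[of UNIV "\<lambda>j. \<bar>A i j * B i j\<bar>" "a * b"] by simp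
  have "\<bar>\<Sum>i\<in>UNIV. \<Sum>j\<in>UNIV. A i j * B i j\<bar> \<le> (\<Sum>i\<in>UNIV. \<Sum>j\<in>UNIV. \<bar>A i j * B i j\<bar>)"
    by (intro order_trans[OF sum_abs] sum_mono sum_abs)
  also have "\<dots> \<le> CARD('n) * (CARD('n) * (a * b))"
    using sum_bounded_above[of UNIV "\<lambda>i. \<Sum>j\<in>UNIV. \<bar>A i j * B i j\<bar>" "CARD('n) * (a * b)"] row by simp
  finally show ?thesis by (simp add: power2_eq_square mult_ac)
qed

text \<open>The Leibniz expansion of the operator on a product of \<eta> with a second factor whose
  value, gradient and Hessian at x are free parameters P, D and H.\<close>

abbreviation product_operator :: "('n::finite \<Rightarrow> 'n \<Rightarrow> real) \<Rightarrow> (real^'n \<Rightarrow> real) \<Rightarrow> real \<Rightarrow> ('n \<Rightarrow> real) \<Rightarrow>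
    ('n \<Rightarrow> 'n \<Rightarrow> real) \<Rightarrow> real^'n \<Rightarrow> real" where
  "product_operator A \<eta> P D H x \<equiv> (\<Sum>i\<in>UNIV. \<Sum>j\<in>UNIV. A i j * (partial_derivs [i, j] \<eta> x * P
     + partial_deriv j \<eta> x * D i + partial_deriv i \<eta> x * D j + \<eta> x * H i j))"

text \<open>The term with H is nonnegative. For the others let b be \<open>bump'\<close> at s = (1/2
  - |x|^2)/K. Since s \<le> 1/(4K), the term with \<open>bump''\<close> is at least 12 b lam P,
  while the trace of A costs at most 2 b lam P. As P \<ge> S, at least 10 b lam S is left against
  mixed terms of at most 4 b lam S.\<close>

lemma elliptic_cutoff_outer:
  fixes x :: "real^'n" and A H :: "'n \<Rightarrow> 'n \<Rightarrow> real"
  assumes A: "elliptic lam Lam A" and lam: "0 < lam" and K: "2 \<le> K" "(real CARD('n))\<^sup>2 * Lam \<le> K * lam"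
    and D: "\<And>i. \<bar>D i\<bar> \<le> S" and P: "S \<le> P" and H: "\<And>\<xi>::real^'n. 0 \<le> (\<Sum>i\<in>UNIV. \<Sum>j\<in>UNIV. \<xi> $ i * \<xi> $ j * H i j)"
    and x: "1/2 \<le> norm x" "norm x < 1"
  shows "0 \<le> product_operator A (cutoff K) P D H x"
proof -
  let ?d = "real CARD('n)"
  define s where "s = (1/2 - (norm x)\<^sup>2) / K"
  define b where "b = bump' s"
  define q where "q = (\<Sum>i\<in>UNIV. \<Sum>j\<in>UNIV. A i j * x $ i * x $ j)"
  define tr where "tr = (\<Sum>i\<in>UNIV. A i i)"
  define X where "X = (\<Sum>i\<in>UNIV. \<Sum>j\<in>UNIV. A i j * (- x $ j * D i - x $ i * D j))"
  define T where "T = (\<Sum>i\<in>UNIV. \<Sum>j\<in>UNIV. A i j * H i j)"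
  have K0: "K > 0" using K by simp
  have S: "0 \<le> S" using D[of undefined] by linarith
  have b: "0 \<le> b" by (simp add: b_def bump'_nonneg)
  have Lam: "0 \<le> Lam" using elliptic_abs_le[OF A lam, of undefined undefined] by linarith
  have sq: "1/4 \<le> (norm x)\<^sup>2" using power_mono[OF x(1), of 2] by (simp add: power2_eq_square)
  have T: "0 \<le> T"
  proof -
    have "0 \<le> H i i" for i
      using H[of "axis i 1"] by (simp only: sum_axis_mult)
    then have "0 \<le> lam * (\<Sum>j\<in>UNIV. H j j)" using lam by (intro mult_nonneg_nonneg sum_nonneg) auto
    also have "\<dots> \<le> T" unfolding T_def by (rule elliptic_trace_ge[OF A H])
    finally show ?thesis .
  qed
  have X: "- (?d\<^sup>2 * (Lam * (2 * S))) \<le> X"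
  proof -
    have "\<bar>- x $ j * D i - x $ i * D j\<bar> \<le> 2 * S" for i j
    proof -
      have "\<bar>x $ k\<bar> \<le> 1" for k using component_le_norm_cart[of x k] x by simp
      then have "\<bar>x $ j\<bar> * \<bar>D i\<bar> \<le> 1 * S" "\<bar>x $ i\<bar> * \<bar>D j\<bar> \<le> 1 * S"
        by (intro mult_mono; use D in simp)+
      then have "\<bar>x $ j * D i\<bar> \<le> S" "\<bar>x $ i * D j\<bar> \<le> S" by (simp_all add: abs_mult)
      then show ?thesis by linarith
    qed
    from sum_sum_abs_le[where A=A and B="\<lambda>i j. - x $ j * D i - x $ i * D j", OF elliptic_abs_le[OF A lam] this]
    show ?thesis unfolding X_def by linarith
  qed
  have tr: "tr \<le> ?d * Lam"
  proof -
    have "A i i \<le> Lam" for i using elliptic_abs_le[OF A lam, of i i] by linarith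
    then show ?thesis unfolding tr_def by (intro sum_bounded_above[of UNIV _ Lam, simplified])
  qed
  have q: "lam / 4 \<le> q"
  proof -
    have "lam * (1/4) \<le> lam * (norm x)\<^sup>2" using lam sq by (intro mult_left_mono) auto
    also have "\<dots> \<le> q" using A by (simp add: elliptic_def q_def)
    finally show ?thesis by simp
  qed
  have eq: "product_operator A (cutoff K) P D H x
     = P * (bump'' s * (4 / K\<^sup>2) * q - 2 * b / K * tr) + 2 * b / K * X + cutoff K x * T"
  proof -
    have "product_operator A (cutoff K) P D H x
     = (\<Sum>i\<in>UNIV. \<Sum>j\<in>UNIV. P * (bump'' s * (4 / K\<^sup>2) * (A i j * x $ i * x $ j) - 2 * b / K * (if j = i then A i j else 0))
         + 2 * b / K * (A i j * (- x $ j * D i - x $ i * D j)) + cutoff K x * (A i j * H i j))"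
      unfolding partial_cutoff s_def[symmetric] b_def[symmetric]
      by (intro sum.cong refl) (simp add: algebra_simps)
    also have "\<dots> = P * (bump'' s * (4 / K\<^sup>2) * q - 2 * b / K * tr) + 2 * b / K * X + cutoff K x * T"
      unfolding q_def tr_def X_def T_def
      by (simp only: sum.distrib sum_subtractf sum_distrib_left[symmetric]) simp
    finally show ?thesis .
  qed
  show ?thesis
  proof (cases "s > 0")
    case False
    then have "bump'' s = 0" "b = 0" "cutoff K x = 0" by (auto simp: b_def bump_simps cutoff_def simp flip: s_def)
    then show ?thesis unfolding eq by simp
  next
    case True
    have "s \<le> (1/4) / K" unfolding s_def using sq K0 by (intro divide_right_mono) auto
    then have s1: "4 * K \<le> 1 / s" using True K0 by (simp add: field_simps)
    have bb: "bump'' s = b * (1 / s * (1 / s - 2))"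
      using True by (simp add: b_def bump_simps power2_eq_square power3_eq_cube power4_eq_xxxx field_simps)
    have "(4 * K) * (4 * K - 2) \<le> 1 / s * (1 / s - 2)"
      using s1 K True by (intro mult_mono) auto
    \<comment> \<open>Here 16 K^2 - 8 K \<ge> 12 K^2 because K \<ge> 2.\<close>
    moreover have "12 * K\<^sup>2 \<le> (4 * K) * (4 * K - 2)" using K by (simp add: algebra_simps power2_eq_square)
    ultimately have "b * (12 * K\<^sup>2) \<le> bump'' s" unfolding bb using b by (intro mult_left_mono) auto
    then have "(b * (12 * K\<^sup>2)) * (4 / K\<^sup>2 * q) \<le> bump'' s * (4 / K\<^sup>2 * q)"
      using q lam by (intro mult_right_mono) auto
    then have "48 * b * q \<le> bump'' s * (4 / K\<^sup>2) * q" using K0 by simp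
    moreover have "48 * b * (lam / 4) \<le> 48 * b * q" using b q by (intro mult_left_mono) auto
    moreover have "2 * b / K * tr \<le> 2 * b / K * (?d * Lam)" using b K0 tr by (intro mult_left_mono) auto
    moreover have "2 * b / K * (?d * Lam) \<le> 2 * b * lam"
    proof -
      have "?d * Lam \<le> ?d\<^sup>2 * Lam" using Lam by (intro mult_right_mono) (auto simp: power2_eq_square Suc_le_eq)
      then have "?d * Lam \<le> K * lam" using K(2) by simp
      then have "2 * b / K * (?d * Lam) \<le> 2 * b / K * (K * lam)" using b K0 by (intro mult_left_mono) auto
      then show ?thesis using K0 by simp
    qed
    ultimately have "10 * b * lam \<le> bump'' s * (4 / K\<^sup>2) * q - 2 * b / K * tr" by linarith
    then have "S * (10 * b * lam) \<le> P * (bump'' s * (4 / K\<^sup>2) * q - 2 * b / K * tr)"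
      using S P b lam by (intro mult_mono) auto
    moreover have "- (4 * S * b * lam) \<le> 2 * b / K * X"
    proof -
      have "(2 * b / K) * ((?d\<^sup>2 * Lam) * (2 * S)) \<le> (2 * b / K) * ((K * lam) * (2 * S))"
        using b K0 S K(2) by (intro mult_left_mono mult_right_mono) auto
      moreover have "(2 * b / K) * (- (?d\<^sup>2 * (Lam * (2 * S)))) \<le> (2 * b / K) * X"
        using b K0 X by (intro mult_left_mono) auto
      ultimately show ?thesis using K0 by (simp add: mult_ac)
    qed
    moreover have "0 \<le> S * b * lam" using S b lam by simp
    moreover have "0 \<le> cutoff K x * T" using T by (simp add: cutoff_def bump_nonneg)
    ultimately show ?thesis unfolding eq by linarith
  qed
qed

text \<open>On the half ball 1/2 - |x|^2 \<ge> 1/4 gives \<eta> \<ge> exp(-4K). The derivatives of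
  \<eta> have no useful sign there and are taken in absolute value: 3 E S from the term with P and E
  S from each of the two mixed terms.\<close>

lemma elliptic_cutoff_inner:
  fixes x :: "real^'n" and A H :: "'n \<Rightarrow> 'n \<Rightarrow> real"
  assumes A: "elliptic lam Lam A" and lam: "0 < lam" and K: "0 < K"
    and D: "\<And>i. \<bar>D i\<bar> \<le> S" and P: "\<bar>P\<bar> \<le> 3 * S" and H: "\<And>\<xi>::real^'n. 0 \<le> (\<Sum>i\<in>UNIV. \<Sum>j\<in>UNIV. \<xi> $ i * \<xi> $ j * H i j)"
    and x: "norm x < 1/2" and E: "\<And>i j. \<bar>partial_derivs [i, j] (cutoff K) x\<bar> \<le> E" "\<And>i. \<bar>partial_deriv i (cutoff K) x\<bar> \<le> E"
  shows "exp (- 4 * K) * lam * (\<Sum>j\<in>UNIV. H j j) - 5 * (real CARD('n))\<^sup>2 * Lam * E * S \<le>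
    product_operator A (cutoff K) P D H x"
proof -
  let ?d = "real CARD('n)"
  let ?R = "\<lambda>i j. partial_derivs [i, j] (cutoff K) x * P + partial_deriv j (cutoff K) x * D i
     + partial_deriv i (cutoff K) x * D j"
  have S: "0 \<le> S" using D[of undefined] by linarith
  have E0: "0 \<le> E" using E(2)[of undefined] by linarith
  have "\<bar>?R i j\<bar> \<le> 5 * E * S" for i j
  proof -
    have "\<bar>partial_derivs [i, j] (cutoff K) x\<bar> * \<bar>P\<bar> \<le> E * (3 * S)"
      "\<bar>partial_deriv j (cutoff K) x\<bar> * \<bar>D i\<bar> \<le> E * S" "\<bar>partial_deriv i (cutoff K) x\<bar> * \<bar>D j\<bar> \<le> E * S"
      using E D P E0 S by (auto intro!: mult_mono simp del: partial_derivs.simps)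
    then have "\<bar>partial_derivs [i, j] (cutoff K) x * P\<bar> \<le> 3 * (E * S)"
      "\<bar>partial_deriv j (cutoff K) x * D i\<bar> \<le> E * S" "\<bar>partial_deriv i (cutoff K) x * D j\<bar> \<le> E * S"
      by (simp_all add: abs_mult del: partial_derivs.simps)
    then show ?thesis by linarith
  qed
  from sum_sum_abs_le[where A=A and B="?R", OF elliptic_abs_le[OF A lam] this]
  have 1: "- (?d\<^sup>2 * (Lam * (5 * E * S))) \<le> (\<Sum>i\<in>UNIV. \<Sum>j\<in>UNIV. A i j * ?R i j)" by linarith
  have "(norm x)\<^sup>2 \<le> (1/2)\<^sup>2" using x by (intro power_mono) auto
  then have sq: "(norm x)\<^sup>2 \<le> 1/4" by (simp add: power2_eq_square)
  have "exp (- 4 * K) \<le> cutoff K x"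
  proof -
    define s where "s = (1/2 - (norm x)\<^sup>2) / K"
    have "(1/4) / K \<le> s" unfolding s_def using sq K by (intro divide_right_mono) auto
    moreover have "0 < (1/4) / K" using K by simp
    ultimately have s0: "0 < s" and "1 / (4 * K) \<le> s" by (linarith, simp)
    then have "- (4 * K) \<le> - 1 / s" using K by (simp add: field_simps)
    with s0 have "0 < s" "- (4 * K) \<le> - 1 / s" by auto
    then show ?thesis by (simp add: cutoff_def bump_simps flip: s_def)
  qed
  moreover have tr: "0 \<le> lam * (\<Sum>j\<in>UNIV. H j j)"
  proof -
    have "0 \<le> H i i" for i
      using H[of "axis i 1"] by (simp only: sum_axis_mult)
    then show ?thesis using lam by (intro mult_nonneg_nonneg sum_nonneg) auto
  qed
  ultimately have "exp (- 4 * K) * (lam * (\<Sum>j\<in>UNIV. H j j)) \<le> cutoff K x * (lam * (\<Sum>j\<in>UNIV. H j j))"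
    by (intro mult_right_mono)
  also have "\<dots> \<le> cutoff K x * (\<Sum>i\<in>UNIV. \<Sum>j\<in>UNIV. A i j * H i j)"
    by (intro mult_left_mono elliptic_trace_ge[OF A H]) (simp add: cutoff_def bump_nonneg)
  also have "\<dots> = (\<Sum>i\<in>UNIV. \<Sum>j\<in>UNIV. A i j * (cutoff K x * H i j))"
    by (simp add: sum_distrib_left mult_ac)
  finally have "exp (- 4 * K) * (lam * (\<Sum>j\<in>UNIV. H j j)) - ?d\<^sup>2 * (Lam * (5 * E * S))
    \<le> (\<Sum>i\<in>UNIV. \<Sum>j\<in>UNIV. A i j * ?R i j) + (\<Sum>i\<in>UNIV. \<Sum>j\<in>UNIV. A i j * (cutoff K x * H i j))"
    using 1 by linarith
  also have "\<dots> = (\<Sum>i\<in>UNIV. \<Sum>j\<in>UNIV. A i j * (?R i j + cutoff K x * H i j))"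
    unfolding sum.distrib[symmetric] by (intro sum.cong refl) (simp only: distrib_left)
  finally show ?thesis by (simp only: mult_ac)
qed

section \<open>Testing the equation\<close>

lemma integrable_mult_AE_bounded:
  fixes m h :: "'a \<Rightarrow> real"
  assumes m: "integrable M m" and h: "h \<in> borel_measurable M" "AE x in M. \<bar>h x\<bar> \<le> b"
  shows "integrable M (\<lambda>x. m x * h x)"
proof (rule Bochner_Integration.integrable_bound)
  show "integrable M (\<lambda>x. b * m x)" using m by simp
  show "(\<lambda>x. m x * h x) \<in> borel_measurable M"
    using borel_measurable_integrable[OF m] h(1) by (rule borel_measurable_times)
  show "AE x in M. norm (m x * h x) \<le> norm (b * m x)"
    using h(2)
  proof eventually_elim
    case (elim x)
    then have "\<bar>m x\<bar> * \<bar>h x\<bar> \<le> \<bar>m x\<bar> * \<bar>b\<bar>" by (intro mult_left_mono) auto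
    then show ?case by (simp add: abs_mult mult.commute)
  qed
qed

lemma continuous_bounded_on_ball:
  fixes h :: "real^'n \<Rightarrow> real"
  assumes "continuous_on UNIV h"
  shows "\<exists>b\<ge>0. \<forall>x. norm x \<le> 1 \<longrightarrow> \<bar>h x\<bar> \<le> b"
proof -
  have "bounded (h ` cball 0 1)"
    by (intro compact_imp_bounded compact_continuous_image continuous_on_subset[OF assms]) auto
  then obtain b where "\<forall>y\<in>h ` cball 0 1. norm y \<le> b" unfolding bounded_iff by blast
  then show ?thesis by (intro exI[of _ "max b 0"]) (auto intro: max.coboundedI1)
qed

lemma continuous_family_bounded_on_ball:
  fixes h :: "'i::finite \<Rightarrow> real^'n \<Rightarrow> real"
  assumes "\<And>i. continuous_on UNIV (h i)"
  shows "\<exists>b\<ge>0. \<forall>i x. norm x \<le> 1 \<longrightarrow> \<bar>h i x\<bar> \<le> b"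
proof -
  have "\<forall>i. \<exists>b\<ge>0. \<forall>x. norm x \<le> 1 \<longrightarrow> \<bar>h i x\<bar> \<le> b"
    by (intro allI continuous_bounded_on_ball assms)
  then obtain b where b: "\<And>i. 0 \<le> b i" "\<And>i x. norm x \<le> 1 \<Longrightarrow> \<bar>h i x\<bar> \<le> b i" by metis
  have "b i \<le> (\<Sum>i\<in>UNIV. b i)" for i by (rule member_le_sum) (auto simp: b)
  then have "\<bar>h i x\<bar> \<le> (\<Sum>i\<in>UNIV. b i)" if "norm x \<le> 1" for i x using b(2)[OF that] order_trans by blast
  then show ?thesis by (intro exI[of _ "\<Sum>i\<in>UNIV. b i"]) (simp add: sum_nonneg b)
qed

lemma measurable_lebesgue_on_continuous:
  fixes h :: "real^'n \<Rightarrow> real"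
  shows "continuous_on UNIV h \<Longrightarrow> S \<in> sets lebesgue \<Longrightarrow> h \<in> borel_measurable (lebesgue_on S)"
  by (meson continuous_imp_measurable_on_sets_lebesgue continuous_on_subset subset_UNIV)

text \<open>The form in which F and u enter the estimate: a measurable field of elliptic matrices,
  with B in the place of the sup norm of the right-hand side.\<close>

definition adjoint_solution ::
    "real \<Rightarrow> real \<Rightarrow> (real^'n \<Rightarrow> 'n \<Rightarrow> 'n \<Rightarrow> real) \<Rightarrow> (real^'n \<Rightarrow> real) \<Rightarrow> (real^'n \<Rightarrow> real) \<Rightarrow> real \<Rightarrow> bool" where
  "adjoint_solution lam Lam a m f B \<longleftrightarrow> (let M = lebesgue_on (ball 0 1) in
    (\<forall>i j. (\<lambda>x. a x i j) \<in> borel_measurable M) \<and> (AE x in M. elliptic lam Lam (a x)) \<and>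
    integrable M m \<and> (AE x in M. 0 \<le> m x) \<and>
    f \<in> borel_measurable M \<and> (AE x in M. \<bar>f x\<bar> \<le> B) \<and> 0 \<le> B \<and>
    (\<forall>\<phi>. test_fun (ball 0 1) \<phi> \<longrightarrow>
       (\<integral>x. (\<Sum>i\<in>UNIV. \<Sum>j\<in>UNIV. a x i j * m x * partial_derivs [i, j] \<phi> x) \<partial>M) = (\<integral>x. f x * \<phi> x \<partial>M)))"

text \<open>The operator applied to the test function \<phi> is at least c0 g - c1 S on the half
  ball and nonnegative off it. Integration against m leaves c0 times the integral of g m bounded by
  c1 S times the integral of m, both over the half ball, plus the integral of f \<phi>, where
  |\<phi>| \<le> 3 S. As S = C0 N, the bound is linear in N.\<close>

lemma weighted_integral_le:
  fixes lam Lam :: real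
  assumes lam: "0 < lam" "lam \<le> Lam"
  defines "M \<equiv> lebesgue_on (ball (0::real^'n) 1)"
  shows "\<exists>C>0. \<forall>(a :: real^'n \<Rightarrow> 'n \<Rightarrow> 'n \<Rightarrow> real) m f B g N.
    adjoint_solution lam Lam a m f B \<longrightarrow>
    continuous_on UNIV g \<longrightarrow> (\<forall>x. 0 < g x) \<longrightarrow> 0 < N \<longrightarrow>
    (\<integral>x. indicator (ball 0 1) x * g x ^ CARD('n) \<partial>lborel) \<le> N ^ CARD('n) \<longrightarrow>
    (\<integral>x. m x * (indicator (ball 0 (1/2)) x * g x) \<partial>M) \<le> C * N * ((\<integral>x. m x * indicator (ball 0 (1/2)) x \<partial>M) + B)"
proof -
  let ?d = "real CARD('n)"
  obtain C0 where C0: "C0 > 0" and pot: "\<And>(g :: real^'n \<Rightarrow> real) N. continuous_on UNIV g \<Longrightarrow> (\<forall>x. 0 < g x) \<Longrightarrow> 0 < N \<Longrightarrow>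
     (\<integral>x. indicator (ball 0 1) x * g x ^ CARD('n) \<partial>lborel) \<le> N ^ CARD('n) \<Longrightarrow>
     (\<exists>\<Psi>. smooth_fun \<Psi> \<and> convex_on UNIV \<Psi> \<and> (\<forall>x. norm x \<le> 1 \<longrightarrow> \<bar>\<Psi> x\<bar> \<le> C0 * N) \<and>
       (\<forall>x i. \<bar>partial_deriv i \<Psi> x\<bar> \<le> C0 * N) \<and>
       (\<forall>x. norm x < 1/2 \<longrightarrow> g x \<le> laplacian \<Psi> x))"
    using convex_potential[where 'n='n] by blast
  \<comment> \<open>Large enough for both conditions of \<open>elliptic_cutoff_outer\<close>. It
    depends on lam, Lam and d only, and so do all bounds for the derivatives of the cutoff.\<close>
  define K where "K = max 2 (?d\<^sup>2 * Lam / lam)"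
  have K: "2 \<le> K" "?d\<^sup>2 * Lam \<le> K * lam" "0 < K"
  proof -
    show "2 \<le> K" "0 < K" by (auto simp: K_def)
    have "?d\<^sup>2 * Lam / lam \<le> K" by (simp add: K_def)
    then show "?d\<^sup>2 * Lam \<le> K * lam" using lam by (simp add: pos_divide_le_eq)
  qed
  let ?\<eta> = "cutoff K :: real^'n \<Rightarrow> real"
  have sm\<eta>: "smooth_fun ?\<eta>" by (rule smooth_cutoff)
  \<comment> \<open>The pair k = (i, j) serves as the single finite index of
    \<open>continuous_family_bounded_on_ball\<close>.\<close>
  have "\<exists>b\<ge>0. \<forall>k x. norm x \<le> 1 \<longrightarrow> \<bar>partial_derivs [fst k, snd k] ?\<eta> x\<bar> \<le> b"
    by (intro continuous_family_bounded_on_ball smooth_fun_continuous smooth_fun_partials sm\<eta>)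
  then obtain b2 where b2: "0 \<le> b2" "\<And>k x. norm x \<le> 1 \<Longrightarrow> \<bar>partial_derivs [fst k, snd k] ?\<eta> x\<bar> \<le> b2" by blast
  have "\<exists>b\<ge>0. \<forall>i x. norm x \<le> 1 \<longrightarrow> \<bar>partial_deriv i ?\<eta> x\<bar> \<le> b"
    by (intro continuous_family_bounded_on_ball smooth_fun_continuous smooth_fun_partial sm\<eta>)
  then obtain b1 where b1: "\<And>i x. norm x \<le> 1 \<Longrightarrow> \<bar>partial_deriv i ?\<eta> x\<bar> \<le> b1" by blast
  define E where "E = max b1 b2"
  have E0: "0 \<le> E" using b2(1) by (simp add: E_def)
  have E2: "\<bar>partial_derivs [i, j] ?\<eta> x\<bar> \<le> E" if "norm x \<le> 1" for i j x
    using b2(2)[OF that, of "(i, j)"] by (simp add: E_def)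
  have E1: "\<bar>partial_deriv i ?\<eta> x\<bar> \<le> E" if "norm x \<le> 1" for i x
    using b1[OF that, of i] by (simp add: E_def)
  define c0 where "c0 = exp (- 4 * K) * lam"
  define c1 where "c1 = 5 * ?d\<^sup>2 * Lam * E"
  define vol where "vol = measure lebesgue (ball (0::real^'n) 1)"
  have c0: "0 < c0" using lam by (simp add: c0_def)
  have c1: "0 \<le> c1" using lam E0 by (simp add: c1_def)
  have vol: "0 \<le> vol" by (simp add: vol_def)
  \<comment> \<open>The summand 1 makes C positive, as c1 and vol are only known to be nonnegative
    at this point.\<close>
  define C where "C = C0 * (c1 + 3 * vol + 1) / c0"
  show ?thesis
  proof (intro exI[of _ C] conjI allI impI)
    show "C > 0" using C0 c0 c1 vol by (simp add: C_def)
    fix a :: "real^'n \<Rightarrow> 'n \<Rightarrow> 'n \<Rightarrow> real" and m f g :: "real^'n \<Rightarrow> real" and B N :: real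
    assume sol: "adjoint_solution lam Lam a m f B"
      and g: "continuous_on UNIV g" "\<forall>x. 0 < g x" and N: "0 < N"
      and gN: "(\<integral>x. indicator (ball 0 1) x * g x ^ CARD('n) \<partial>lborel) \<le> N ^ CARD('n)"
    have a: "\<forall>i j. (\<lambda>x. a x i j) \<in> borel_measurable M" and ell: "AE x in M. elliptic lam Lam (a x)"
      and m: "integrable M m" and m0: "AE x in M. 0 \<le> m x"
      and f: "f \<in> borel_measurable M" "AE x in M. \<bar>f x\<bar> \<le> B" and B: "0 \<le> B"
      and weak: "\<forall>\<phi>. test_fun (ball 0 1) \<phi> \<longrightarrow>
       (\<integral>x. (\<Sum>i\<in>UNIV. \<Sum>j\<in>UNIV. a x i j * m x * partial_derivs [i, j] \<phi> x) \<partial>M) = (\<integral>x. f x * \<phi> x \<partial>M)"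
      using sol unfolding adjoint_solution_def Let_def M_def by blast+
    define S where "S = C0 * N"
    have S: "0 < S" using C0 N by (simp add: S_def)
    from pot[OF g N gN] obtain \<Psi> where \<Psi>: "smooth_fun \<Psi>" "convex_on UNIV \<Psi>"
      and \<Psi>b: "\<And>x. norm x \<le> 1 \<Longrightarrow> \<bar>\<Psi> x\<bar> \<le> S" "\<And>x i. \<bar>partial_deriv i \<Psi> x\<bar> \<le> S"
      and \<Psi>g: "\<And>x. norm x < 1/2 \<Longrightarrow> g x \<le> laplacian \<Psi> x"
      unfolding S_def by blast
    \<comment> \<open>The shift places the second factor between S and 3 S on the unit ball; the
      lower bound is what \<open>elliptic_cutoff_outer\<close> asks for.\<close>
    define \<phi> where "\<phi> x = ?\<eta> x * (\<Psi> x + 2 * S)" for x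
    have sm\<Psi>: "smooth_fun (\<lambda>x. \<Psi> x + 2 * S)" using \<Psi> by (intro smooth_fun_add) auto
    have sm\<phi>: "smooth_fun \<phi>" unfolding \<phi>_def[abs_def] by (intro smooth_fun_mult sm\<eta> sm\<Psi>)
    have p\<Psi>: "partial_deriv j (\<lambda>x. \<Psi> x + 2 * S) = partial_deriv j \<Psi>" for j
      using \<Psi>(1) by (subst partial_deriv_add) (auto intro!: smooth_fun_differentiable simp: partial_deriv_const)
    have p\<phi>: "partial_derivs [i, j] \<phi> x = partial_derivs [i, j] ?\<eta> x * (\<Psi> x + 2 * S) + partial_deriv j ?\<eta> x * partial_deriv i \<Psi> x
      + partial_deriv i ?\<eta> x * partial_deriv j \<Psi> x + ?\<eta> x * partial_derivs [i, j] \<Psi> x" for i j x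
    proof -
      have "partial_deriv j \<phi> = (\<lambda>x. partial_deriv j ?\<eta> x * (\<Psi> x + 2 * S) + ?\<eta> x * partial_deriv j \<Psi> x)"
        unfolding \<phi>_def[abs_def] using sm\<eta> sm\<Psi>
        by (subst partial_deriv_mult) (auto intro!: smooth_fun_differentiable simp: p\<Psi>)
      then have "partial_derivs [i, j] \<phi> = partial_deriv i (\<lambda>x. partial_deriv j ?\<eta> x * (\<Psi> x + 2 * S) + ?\<eta> x * partial_deriv j \<Psi> x)"
        by simp
      also have "\<dots> = (\<lambda>x. partial_deriv i (\<lambda>x. partial_deriv j ?\<eta> x * (\<Psi> x + 2 * S)) x
           + partial_deriv i (\<lambda>x. ?\<eta> x * partial_deriv j \<Psi> x) x)"
        by (intro partial_deriv_add smooth_fun_differentiable smooth_fun_mult smooth_fun_partial sm\<eta> sm\<Psi> \<Psi>)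
      also have "partial_deriv i (\<lambda>x. partial_deriv j ?\<eta> x * (\<Psi> x + 2 * S))
          = (\<lambda>x. partial_deriv i (partial_deriv j ?\<eta>) x * (\<Psi> x + 2 * S) + partial_deriv j ?\<eta> x * partial_deriv i \<Psi> x)"
        using sm\<eta> sm\<Psi> by (subst partial_deriv_mult) (auto intro!: smooth_fun_differentiable smooth_fun_partial simp: p\<Psi>)
      also have "partial_deriv i (\<lambda>x. ?\<eta> x * partial_deriv j \<Psi> x)
          = (\<lambda>x. partial_deriv i ?\<eta> x * partial_deriv j \<Psi> x + ?\<eta> x * partial_deriv i (partial_deriv j \<Psi>) x)"
        using sm\<eta> \<Psi>(1) by (subst partial_deriv_mult) (auto intro!: smooth_fun_differentiable smooth_fun_partial)
      finally show ?thesis by simp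
    qed
    have test: "test_fun (ball 0 1) \<phi>"
    proof -
      \<comment> \<open>The cutoff vanishes once |x|^2 \<ge> 1/2, and 1/2 < (3/4)^2.\<close>
      have "{x. \<phi> x \<noteq> 0} \<subseteq> cball 0 (3/4)"
      proof
        fix x assume "x \<in> {x. \<phi> x \<noteq> 0}"
        then have "?\<eta> x \<noteq> 0" by (auto simp: \<phi>_def)
        then have "\<not> (1/2 - (norm x)\<^sup>2) / K \<le> 0" using bump_simps(4) unfolding cutoff_def by blast
        then have "(norm x)\<^sup>2 < 1/2" using K(3) by (simp add: not_le zero_less_divide_iff)
        also have "1/2 \<le> (3/4::real)\<^sup>2" by (simp add: power2_eq_square)
        finally show "x \<in> cball 0 (3/4)" using power2_less_imp_less[of "norm x" "3/4"] by simp
      qed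
      then have "closure {x. \<phi> x \<noteq> 0} \<subseteq> cball 0 (3/4)" by (rule closure_minimal) auto
      moreover from this have "compact (closure {x. \<phi> x \<noteq> 0})"
        by (meson bounded_cball bounded_subset closed_closure compact_eq_bounded_closed)
      moreover have "cball (0::real^'n) (3/4) \<subseteq> ball 0 1" by auto
      ultimately show ?thesis using sm\<phi> unfolding test_fun_def by blast
    qed
    define L where "L x = (\<Sum>i\<in>UNIV. \<Sum>j\<in>UNIV. a x i j * partial_derivs [i, j] \<phi> x)" for x
    have mball: "AE x in M. norm x < 1" unfolding M_def by (rule AE_I2) (simp add: space_restrict_space)
    have meas: "h \<in> borel_measurable M" if "continuous_on UNIV h" for h :: "real^'n \<Rightarrow> real"
      unfolding M_def by (rule measurable_lebesgue_on_continuous[OF that]) simp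
    have ind_meas: "(\<lambda>x. indicator (ball 0 (1/2)) x :: real) \<in> borel_measurable M"
      unfolding M_def by (intro borel_measurable_indicator) (auto simp: sets_restrict_space_iff)
    have L_meas: "L \<in> borel_measurable M"
      unfolding L_def[abs_def]
      by (intro borel_measurable_sum borel_measurable_times a[rule_format]
          meas[OF smooth_fun_continuous[OF smooth_fun_partials[OF sm\<phi>]]])
    have "\<exists>b\<ge>0. \<forall>k x. norm x \<le> 1 \<longrightarrow> \<bar>partial_derivs [fst k, snd k] \<phi> x\<bar> \<le> b"
      by (intro continuous_family_bounded_on_ball smooth_fun_continuous smooth_fun_partials sm\<phi>)
    then obtain b where b: "\<And>k x. norm x \<le> 1 \<Longrightarrow> \<bar>partial_derivs [fst k, snd k] \<phi> x\<bar> \<le> b" by blast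
    have L_bd: "AE x in M. \<bar>L x\<bar> \<le> ?d\<^sup>2 * (Lam * b)"
      using ell mball
    proof eventually_elim
      case (elim x)
      show ?case unfolding L_def
        by (rule sum_sum_abs_le[where A="a x", OF elliptic_abs_le[OF elim(1) lam(1)]])
          (use b[of x "(i, j)" for i j] elim(2) in simp)
    qed
    have mL: "integrable M (\<lambda>x. m x * L x)"
      by (rule integrable_mult_AE_bounded[OF m L_meas L_bd])
    have lower: "AE x in M. c0 * (m x * (indicator (ball 0 (1/2)) x * g x)) - c1 * S * (m x * indicator (ball 0 (1/2)) x) \<le> m x * L x"
      using ell mball m0
    proof eventually_elim
      case (elim x)
      have PS: "S \<le> \<Psi> x + 2 * S" "\<bar>\<Psi> x + 2 * S\<bar> \<le> 3 * S" using \<Psi>b(1)[of x] elim(2) by auto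
      have "c0 * (indicator (ball 0 (1/2)) x * g x) - c1 * S * indicator (ball 0 (1/2)) x \<le> L x"
      proof (cases "norm x < 1/2")
        case True
        have "c0 * g x \<le> c0 * laplacian \<Psi> x"
          using c0 \<Psi>g[OF True] by (intro mult_left_mono) auto
        moreover have "c0 * laplacian \<Psi> x - c1 * S \<le> L x"
          unfolding L_def p\<phi> c0_def c1_def
          by (rule elliptic_cutoff_inner[OF elim(1) lam(1) K(3) \<Psi>b(2) PS(2) hessian_nonneg_of_convex[OF \<Psi>] True E2 E1])
            (use elim(2) in auto)
        ultimately have "c0 * g x - c1 * S \<le> L x" by linarith
        then show ?thesis using True by simp
      next
        case False
        have "0 \<le> L x"
          unfolding L_def p\<phi>
          by (rule elliptic_cutoff_outer[OF elim(1) lam(1) K(1,2) \<Psi>b(2) PS(1) hessian_nonneg_of_convex[OF \<Psi>]])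
            (use elim(2) False in auto)
        then show ?thesis using False by simp
      qed
      from mult_left_mono[OF this elim(3)] show ?case by (simp add: algebra_simps)
    qed
    have i1: "integrable M (\<lambda>x. m x * indicator (ball 0 (1/2)) x)"
      by (rule integrable_mult_AE_bounded[OF m ind_meas, of 1]) (auto simp: indicator_def)
    obtain gb where gb: "\<And>x. norm x \<le> 1 \<Longrightarrow> \<bar>g x\<bar> \<le> gb"
      using continuous_bounded_on_ball[OF g(1)] by blast
    have i2: "integrable M (\<lambda>x. m x * (indicator (ball 0 (1/2)) x * g x))"
    proof (rule integrable_mult_AE_bounded[OF m, of _ gb])
      show "(\<lambda>x. indicator (ball 0 (1/2)) x * g x) \<in> borel_measurable M"
        by (intro borel_measurable_times ind_meas meas g)
      show "AE x in M. \<bar>indicator (ball 0 (1/2)) x * g x\<bar> \<le> gb"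
        using mball
      proof eventually_elim
        case (elim x)
        then show ?case using gb[of x] by (auto simp: indicator_def intro: order_trans[OF abs_ge_zero])
      qed
    qed
    define I1 where "I1 = (\<integral>x. m x * indicator (ball 0 (1/2)) x \<partial>M)"
    define I2 where "I2 = (\<integral>x. m x * (indicator (ball 0 (1/2)) x * g x) \<partial>M)"
    have I1: "0 \<le> I1" unfolding I1_def
      by (rule integral_nonneg_AE) (use m0 in \<open>auto simp: indicator_def\<close>)
    have "c0 * I2 - c1 * S * I1
        = (\<integral>x. c0 * (m x * (indicator (ball 0 (1/2)) x * g x)) - c1 * S * (m x * indicator (ball 0 (1/2)) x) \<partial>M)"
      unfolding I1_def I2_def
      by (subst Bochner_Integration.integral_diff[OF integrable_mult_right[OF i2] integrable_mult_right[OF i1]])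
        (simp only: integral_mult_right_zero)
    also have "\<dots> \<le> (\<integral>x. m x * L x \<partial>M)"
      by (rule integral_mono_AE[OF _ mL lower]) (intro Bochner_Integration.integrable_diff integrable_mult_right i1 i2)
    also have "\<dots> = (\<integral>x. (\<Sum>i\<in>UNIV. \<Sum>j\<in>UNIV. a x i j * m x * partial_derivs [i, j] \<phi> x) \<partial>M)"
      unfolding L_def sum_distrib_left by (intro Bochner_Integration.integral_cong refl sum.cong) (simp only: mult_ac)
    also have "\<dots> = (\<integral>x. f x * \<phi> x \<partial>M)" using weak test by blast
    also have "\<dots> \<le> (\<integral>x. B * (3 * S) \<partial>M)"
    proof (rule integral_mono_AE)
      have fin: "integrable M (\<lambda>x. c :: real)" for c
        unfolding M_def by (rule finite_measure.integrable_const[OF finite_measure_lebesgue_on]) simp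
      show "integrable M (\<lambda>x. B * (3 * S))" by (rule fin)
      have \<phi>b: "\<bar>\<phi> x\<bar> \<le> 3 * S" if "norm x < 1" for x
      proof -
        have "\<bar>?\<eta> x\<bar> * \<bar>\<Psi> x + 2 * S\<bar> \<le> 1 * (3 * S)"
          using \<Psi>b(1)[of x] that by (intro mult_mono) (auto simp: cutoff_def bump_nonneg bump_le_1)
        then show ?thesis by (simp add: \<phi>_def abs_mult)
      qed
      have bd: "AE x in M. \<bar>f x * \<phi> x\<bar> \<le> B * (3 * S)"
        using f(2) mball by eventually_elim (auto simp: abs_mult B intro!: mult_mono \<phi>b)
      have "(\<lambda>x. f x * \<phi> x) \<in> borel_measurable M"
        by (intro borel_measurable_times f meas[OF smooth_fun_continuous[OF sm\<phi>]])
      from integrable_mult_AE_bounded[OF fin[of 1] this bd] show "integrable M (\<lambda>x. f x * \<phi> x)" by simp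
      show "AE x in M. f x * \<phi> x \<le> B * (3 * S)" using bd by eventually_elim linarith
    qed
    also have "\<dots> = vol * (B * (3 * S))" by (simp add: M_def vol_def measure_restrict_space)
    finally have "c0 * I2 \<le> S * (c1 * I1 + 3 * vol * B)" by (simp add: algebra_simps)
    also have "\<dots> \<le> S * ((c1 + 3 * vol + 1) * (I1 + B))"
    proof -
      have "0 \<le> c1 * B" "0 \<le> vol * I1" using c1 vol B I1 by auto
      then show ?thesis using S B I1 by (intro mult_left_mono) (auto simp: algebra_simps)
    qed
    finally have "I2 \<le> S * ((c1 + 3 * vol + 1) * (I1 + B)) / c0" using c0 by (simp add: pos_le_divide_eq mult.commute)
    then show "I2 \<le> C * N * (I1 + B)" by (simp add: C_def S_def mult_ac)
  qed
qed

section \<open>Duality\<close>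

context
  fixes w :: "real^'n \<Rightarrow> real" and Cst :: real
  assumes w: "integrable lebesgue w" "\<And>x. 0 \<le> w x" "\<And>x. 1/2 \<le> norm x \<Longrightarrow> w x = 0"
    and Cst: "0 \<le> Cst"
    and test: "\<And>g N. continuous_on UNIV g \<Longrightarrow> (\<forall>x. 0 < g x) \<Longrightarrow> 0 < N \<Longrightarrow>
      (\<integral>x. indicator (ball 0 1) x * g x ^ CARD('n) \<partial>lborel) \<le> N ^ CARD('n) \<Longrightarrow>
      (\<integral>x. w x * g x \<partial>lebesgue) \<le> Cst * N"
begin

text \<open>In the application \<open>w\<close> is |m| cut off to the half ball. A measurable h is
  an almost everywhere limit of continuous functions; clamping them to [0, k] and adding 1/(j + 1)
  makes them bounded and positive, and both integrals converge by domination. The strict inequality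
  assumed for h lets the approximations satisfy the hypothesis of \<open>test\<close> from some j
  on.\<close>

lemma dual_bound_bounded:
  assumes h: "h \<in> borel_measurable lebesgue" "\<And>x. 0 \<le> h x" "\<And>x. h x \<le> k"
    and N: "0 < N" "(\<integral>x. indicator (ball 0 1) x * h x ^ CARD('n) \<partial>lebesgue) < N ^ CARD('n)"
  shows "(\<integral>x. w x * h x \<partial>lebesgue) \<le> Cst * N"
proof -
  have "h measurable_on UNIV"
    using h(1) lebesgue_measurable_imp_measurable_on[of h UNIV] by simp
  then obtain Z g where Z: "negligible Z" and g: "\<And>j. continuous_on UNIV (g j)"
    and lim: "\<And>x. x \<notin> Z \<Longrightarrow> (\<lambda>j. g j x) \<longlonglongrightarrow> h x"
    unfolding measurable_on_def by auto
  have k: "0 \<le> k" using h(2,3) order_trans by blast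
  define G where "G j x = min (max (g j x) 0) k + inverse (real (Suc j))" for j x
  have Gc: "continuous_on UNIV (G j)" for j
    unfolding G_def[abs_def] by (intro continuous_intros g)
  have Gpos: "0 < G j x" for j x using k by (simp add: G_def add_nonneg_pos)
  have Gle: "G j x \<le> k + 1" for j x
  proof -
    have "inverse (real (Suc j)) \<le> 1" by (simp add: field_simps)
    then show ?thesis unfolding G_def by (intro add_mono) auto
  qed
  have Gm: "G j \<in> borel_measurable lebesgue" for j
    by (intro measurable_completion) (simp add: borel_measurable_continuous_onI[OF Gc])
  have Glim: "AE x in lebesgue. (\<lambda>j. G j x) \<longlonglongrightarrow> h x"
  proof (rule AE_I'[of Z])
    show "Z \<in> null_sets lebesgue" using Z by (simp add: negligible_iff_null_sets)
    have "(\<lambda>j. G j x) \<longlonglongrightarrow> h x" if "x \<notin> Z" for x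
    proof -
      have "(\<lambda>j. G j x) \<longlonglongrightarrow> min (max (h x) 0) k + 0"
        unfolding G_def by (intro tendsto_intros lim that LIMSEQ_inverse_real_of_nat)
      then show ?thesis using h(2,3) by (simp add: max_absorb1 min_absorb1)
    qed
    then show "{x \<in> space lebesgue. \<not> (\<lambda>j. G j x) \<longlonglongrightarrow> h x} \<subseteq> Z" by auto
  qed
  have indm: "(\<lambda>x. indicator (ball 0 1) x :: real) \<in> borel_measurable (lebesgue :: (real^'n) measure)"
    by (intro borel_measurable_indicator) simp
  have "(\<lambda>j. \<integral>x. indicator (ball 0 1) x * G j x ^ CARD('n) \<partial>lebesgue) \<longlonglongrightarrow>
      (\<integral>x. indicator (ball 0 1) x * h x ^ CARD('n) \<partial>lebesgue)"
  proof (rule integral_dominated_convergence[where w="\<lambda>x. (k + 1) ^ CARD('n) * indicator (ball 0 1) x"])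
    show "integrable lebesgue (\<lambda>x::real^'n. (k + 1) ^ CARD('n) * indicator (ball 0 1) x)"
      by (intro integrable_mult_right integrable_real_indicator) (use emeasure_bounded_finite[OF bounded_ball, of "0::real^'n" 1] in auto)
    show "AE x in lebesgue. (\<lambda>j. indicator (ball 0 1) x * G j x ^ CARD('n)) \<longlonglongrightarrow> indicator (ball 0 1) x * h x ^ CARD('n)"
      using Glim by eventually_elim (intro tendsto_intros)
    show "AE x in lebesgue. norm (indicator (ball 0 1) x * G j x ^ CARD('n)) \<le> (k + 1) ^ CARD('n) * indicator (ball 0 1) x" for j
      using Gle Gpos[THEN less_imp_le] by (intro AE_I2) (auto simp: indicator_def intro!: power_mono)
  qed (intro borel_measurable_times borel_measurable_power indm Gm h)+
  from order_tendstoD(2)[OF this N(2)]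
  have ev: "\<forall>\<^sub>F j in sequentially. (\<integral>x. w x * G j x \<partial>lebesgue) \<le> Cst * N"
  proof eventually_elim
    case (elim j)
    have "(\<integral>x. indicator (ball 0 1) x * G j x ^ CARD('n) \<partial>lborel) = (\<integral>x. indicator (ball 0 1) x * G j x ^ CARD('n) \<partial>lebesgue)"
      using borel_measurable_continuous_onI[OF Gc[of j]]
      by (intro integral_completion[symmetric] borel_measurable_times borel_measurable_power borel_measurable_indicator) auto
    with elim show ?case by (intro test[OF Gc _ N(1)]) (auto simp: Gpos)
  qed
  have "(\<lambda>j. \<integral>x. w x * G j x \<partial>lebesgue) \<longlonglongrightarrow> (\<integral>x. w x * h x \<partial>lebesgue)"
  proof (rule integral_dominated_convergence[where w="\<lambda>x. (k + 1) * w x"])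
    show "integrable lebesgue (\<lambda>x. (k + 1) * w x)" using w(1) by simp
    show "AE x in lebesgue. (\<lambda>j. w x * G j x) \<longlonglongrightarrow> w x * h x"
      using Glim by eventually_elim (intro tendsto_intros)
    show "AE x in lebesgue. norm (w x * G j x) \<le> (k + 1) * w x" for j
      using Gle Gpos[THEN less_imp_le] w(2) by (intro AE_I2) (auto simp: abs_mult mult.commute intro!: mult_left_mono)
  qed (intro borel_measurable_times Gm h borel_measurable_integrable[OF w(1)])+
  from LIMSEQ_le_const2[OF this] ev show ?thesis by (auto simp: eventually_sequentially)
qed

text \<open>The extremal weight of Hoelder's inequality: for the truncation v, the function h =
  v^(1/(d-1)) satisfies h^d = v h = v^p. Duality then bounds I, the integral of v^p, by 2 Cst
  I^(1/d), which is I^(1/p) \<le> 2 Cst. Truncation makes I finite and h bounded.\<close>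

lemma Lp_truncated_le:
  assumes d: "CARD('n) \<ge> 2" and k: "0 \<le> k"
  defines "p \<equiv> real CARD('n) / (real CARD('n) - 1)"
  shows "integrable lebesgue (\<lambda>x. min (w x) k powr p)"
    and "(\<integral>x. min (w x) k powr p \<partial>lebesgue) \<le> (2 * Cst) powr p"
proof -
  let ?d = "CARD('n)"
  define q where "q = 1 / (real ?d - 1)"
  define v where "v x = min (w x) k" for x
  have q: "0 < q" "p = 1 + q" "p = q * real ?d" using d by (auto simp: q_def p_def field_simps)
  have v0: "0 \<le> v x" "v x \<le> k" "v x \<le> w x" for x using w(2) k by (auto simp: v_def)
  have vm: "v \<in> borel_measurable lebesgue"
    unfolding v_def[abs_def] using borel_measurable_integrable[OF w(1)] by simp
  have vp: "v x powr p = indicator (ball 0 1) x * (v x powr p)" for x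
    using w(2)[of x] w(3)[of x] k by (auto simp: indicator_def v_def)
  have int: "integrable lebesgue (\<lambda>x. v x powr p)"
  proof (rule Bochner_Integration.integrable_bound)
    show "integrable lebesgue (\<lambda>x::real^'n. k powr p * indicator (ball 0 1) x)"
      by (intro integrable_mult_right integrable_real_indicator) (use emeasure_bounded_finite[OF bounded_ball, of "0::real^'n" 1] in auto)
    show "(\<lambda>x. v x powr p) \<in> borel_measurable lebesgue" using vm by simp
    show "AE x in lebesgue. norm (v x powr p) \<le> norm (k powr p * indicator (ball 0 1) x)"
    proof (rule AE_I2)
      fix x
      show "norm (v x powr p) \<le> norm (k powr p * indicator (ball 0 1) x)"
        using powr_mono2[of p "v x" k] v0[of x] q by (subst vp) (auto simp: indicator_def)
    qed
  qed
  then show "integrable lebesgue (\<lambda>x. min (w x) k powr p)" by (simp add: v_def)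
  define I where "I = (\<integral>x. v x powr p \<partial>lebesgue)"
  have I0: "0 \<le> I" unfolding I_def by simp
  have "I \<le> (2 * Cst) powr p"
  proof (cases "I = 0")
    case False
    with I0 have I: "0 < I" by simp
    define h where "h x = v x powr q" for x
    \<comment> \<open>Twice I because \<open>dual_bound_bounded\<close> needs a strict inequality;
      the loss 2^(1/d) is rounded up to 2.\<close>
    define N where "N = (2 * I) powr (1 / ?d)"
    have hd: "h x ^ ?d = v x powr p" for x
      by (cases "v x = 0") (simp_all add: h_def powr_power q(3) mult.commute)
    have N: "0 < N" "N ^ ?d = 2 * I" using I d by (auto simp: N_def powr_power)
    have "(\<integral>x. w x * h x \<partial>lebesgue) \<le> Cst * N"
    proof (rule dual_bound_bounded)
      show "h \<in> borel_measurable lebesgue" unfolding h_def[abs_def] using vm by simp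
      show "0 \<le> h x" for x by (simp add: h_def)
      show "h x \<le> k powr q" for x unfolding h_def using v0 q by (intro powr_mono2) auto
      show "(\<integral>x. indicator (ball 0 1) x * h x ^ ?d \<partial>lebesgue) < N ^ ?d"
        using I unfolding hd vp[symmetric] N I_def by simp
    qed (rule N)
    moreover have "I \<le> (\<integral>x. w x * h x \<partial>lebesgue)"
      unfolding I_def
    proof (rule integral_mono[OF int])
      show "integrable lebesgue (\<lambda>x. w x * h x)"
      proof (rule integrable_mult_AE_bounded[OF w(1), of _ "k powr q"])
        show "h \<in> borel_measurable lebesgue" unfolding h_def[abs_def] using vm by simp
        show "AE x in lebesgue. \<bar>h x\<bar> \<le> k powr q"
          unfolding h_def using v0 q by (intro AE_I2) (auto intro!: powr_mono2)
      qed
      fix x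
      have "v x powr p = v x * h x" using v0(1)[of x] by (cases "v x = 0") (auto simp: h_def q(2) powr_add)
      also have "\<dots> \<le> w x * h x" using v0 by (intro mult_right_mono) (auto simp: h_def)
      finally show "v x powr p \<le> w x * h x" .
    qed
    ultimately have 1: "I \<le> Cst * N" by linarith
    have "N = 2 powr (1 / ?d) * I powr (1 / ?d)" unfolding N_def using I by (simp add: powr_mult)
    also have "\<dots> \<le> 2 powr 1 * I powr (1 / ?d)"
      using d by (intro mult_right_mono powr_mono) (auto simp: field_simps)
    finally have "Cst * N \<le> Cst * (2 * I powr (1 / ?d))" using Cst by (intro mult_left_mono) auto
    moreover have "I = I powr (1 / p) * I powr (1 / ?d)"
    proof -
      have "1 / p + 1 / ?d = 1" using d by (simp add: p_def field_simps)
      then show ?thesis using I by (simp flip: powr_add)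
    qed
    ultimately have "I powr (1 / p) * I powr (1 / ?d) \<le> (2 * Cst) * I powr (1 / ?d)" using 1 by simp
    then have "I powr (1 / p) \<le> 2 * Cst" using I by simp
    then have "(I powr (1 / p)) powr p \<le> (2 * Cst) powr p" using q by (intro powr_mono2) auto
    then show ?thesis using I q by (simp add: powr_powr)
  qed simp
  then show "(\<integral>x. min (w x) k powr p \<partial>lebesgue) \<le> (2 * Cst) powr p" by (simp add: I_def v_def)
qed

text \<open>The bound for the truncations does not depend on the level, so monotone convergence
  removes the truncation.\<close>

lemma Lp_of_duality:
  assumes d: "CARD('n) \<ge> 2"
  defines "p \<equiv> real CARD('n) / (real CARD('n) - 1)"
  shows "integrable lebesgue (\<lambda>x. w x powr p)"
    and "(\<integral>x. w x powr p \<partial>lebesgue) \<le> (2 * Cst) powr p"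
proof -
  have p: "0 < p" using d by (simp add: p_def)
  note tr = Lp_truncated_le[OF d, folded p_def]
  let ?v = "\<lambda>n x. ennreal (min (w x) (real n) powr p)"
  have wm: "w \<in> borel_measurable lebesgue" using w(1) by simp
  have sup: "(SUP n. ?v n x) = ennreal (w x powr p)" for x
  proof (rule antisym)
    show "(SUP n. ?v n x) \<le> ennreal (w x powr p)"
      using w(2)[of x] p by (intro SUP_least ennreal_leI powr_mono2) auto
    have "w x \<le> real (nat \<lceil>w x\<rceil>)" by linarith
    then have "ennreal (w x powr p) = ?v (nat \<lceil>w x\<rceil>) x" by (simp add: min_absorb1)
    also have "\<dots> \<le> (SUP n. ?v n x)" by (rule SUP_upper) simp
    finally show "ennreal (w x powr p) \<le> (SUP n. ?v n x)" .
  qed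
  have "(\<integral>\<^sup>+x. ennreal (w x powr p) \<partial>lebesgue) = (SUP n. integral\<^sup>N lebesgue (?v n))"
    unfolding sup[symmetric]
  proof (rule nn_integral_monotone_convergence_SUP)
    show "incseq ?v" using w(2) p
      by (intro incseq_SucI le_funI ennreal_leI powr_mono2) auto
    show "?v n \<in> borel_measurable lebesgue" for n using wm by measurable
  qed
  also have "\<dots> \<le> ennreal ((2 * Cst) powr p)"
  proof (rule SUP_least)
    fix n
    have "integral\<^sup>N lebesgue (?v n) = ennreal (\<integral>x. min (w x) (real n) powr p \<partial>lebesgue)"
      by (rule nn_integral_eq_integral) (auto intro: tr)
    also have "\<dots> \<le> ennreal ((2 * Cst) powr p)" by (intro ennreal_leI tr) simp
    finally show "integral\<^sup>N lebesgue (?v n) \<le> ennreal ((2 * Cst) powr p)" .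
  qed
  finally have le: "(\<integral>\<^sup>+x. ennreal (w x powr p) \<partial>lebesgue) \<le> ennreal ((2 * Cst) powr p)" .
  show int: "integrable lebesgue (\<lambda>x. w x powr p)"
  proof (rule integrableI_bounded)
    show "(\<lambda>x. w x powr p) \<in> borel_measurable lebesgue" using wm by simp
    show "(\<integral>\<^sup>+x. ennreal (norm (w x powr p)) \<partial>lebesgue) < \<infinity>"
      using le_less_trans[OF le ennreal_less_top] by simp
  qed
  have "ennreal (\<integral>x. w x powr p \<partial>lebesgue) \<le> ennreal ((2 * Cst) powr p)"
    using le nn_integral_eq_integral[OF int] by simp
  then show "(\<integral>x. w x powr p \<partial>lebesgue) \<le> (2 * Cst) powr p" by simp
qed

end

section \<open>Symmetry and measurability of the weak Hessian\<close>

text \<open>Equality of mixed derivatives is wanted for the test functions \<open>box_bump\<close>.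
  It passes to products and through \<open>exp_recip\<close>, so it can be read off their
  construction.\<close>

definition hess_sym :: "(real^'n \<Rightarrow> real) \<Rightarrow> bool" where
  "hess_sym f \<longleftrightarrow> smooth_fun f \<and>
     (\<forall>i j. partial_deriv i (partial_deriv j f) = partial_deriv j (partial_deriv i f))"

lemma hess_sym_affine: "hess_sym (\<lambda>x. c * x $ k + e)"
proof -
  have "partial_deriv j (\<lambda>x. c * x $ k + e) = (\<lambda>x. c * (if j = k then 1 else 0))" for j
  proof -
    have "partial_deriv j (\<lambda>x. c * x $ k + e) = (\<lambda>x. partial_deriv j (\<lambda>x. c * x $ k) x + partial_deriv j (\<lambda>x. e) x)"
      by (intro partial_deriv_add smooth_fun_differentiable smooth_fun_mult) auto
    also have "partial_deriv j (\<lambda>x. c * x $ k) = (\<lambda>x. c * (if j = k then 1 else 0))"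
      by (subst partial_deriv_mult) (auto intro!: smooth_fun_differentiable simp: partial_deriv_const partial_deriv_component)
    finally show ?thesis by (simp add: partial_deriv_const)
  qed
  moreover have "smooth_fun (\<lambda>x. c * x $ k + e)" by (intro smooth_fun_add smooth_fun_mult) auto
  ultimately show ?thesis by (simp add: hess_sym_def partial_deriv_const)
qed

lemma hess_sym_const: "hess_sym (\<lambda>x. c)"
  by (simp add: hess_sym_def partial_deriv_const)

lemma hess_sym_mult:
  assumes "hess_sym f" "hess_sym g"
  shows "hess_sym (\<lambda>x. f x * g x)"
proof -
  have s: "smooth_fun f" "smooth_fun g" using assms by (auto simp: hess_sym_def)
  note d = smooth_fun_differentiable[OF s(1)] smooth_fun_differentiable[OF s(2)]
    smooth_fun_differentiable[OF smooth_fun_partial[OF s(1)]] smooth_fun_differentiable[OF smooth_fun_partial[OF s(2)]]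
  have p: "partial_deriv i (partial_deriv j (\<lambda>x. f x * g x)) = (\<lambda>x. (partial_deriv i (partial_deriv j f) x * g x
      + partial_deriv j f x * partial_deriv i g x) + (partial_deriv i f x * partial_deriv j g x + f x * partial_deriv i (partial_deriv j g) x))" for i j
  proof -
    have "partial_deriv i (partial_deriv j (\<lambda>x. f x * g x))
        = partial_deriv i (\<lambda>x. partial_deriv j f x * g x + f x * partial_deriv j g x)"
      by (subst partial_deriv_mult) (auto intro: d)
    also have "\<dots> = (\<lambda>x. partial_deriv i (\<lambda>x. partial_deriv j f x * g x) x + partial_deriv i (\<lambda>x. f x * partial_deriv j g x) x)"
      by (intro partial_deriv_add smooth_fun_differentiable smooth_fun_mult smooth_fun_partial s)
    also have "\<dots> = (\<lambda>x. (partial_deriv i (partial_deriv j f) x * g x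
      + partial_deriv j f x * partial_deriv i g x) + (partial_deriv i f x * partial_deriv j g x + f x * partial_deriv i (partial_deriv j g) x))"
      by (simp only: partial_deriv_mult[OF d(3) d(2)] partial_deriv_mult[OF d(1) d(4)])
    finally show ?thesis .
  qed
  have "partial_deriv i (partial_deriv j (\<lambda>x. f x * g x)) = partial_deriv j (partial_deriv i (\<lambda>x. f x * g x))" for i j
  proof -
    have "partial_deriv i (partial_deriv j f) = partial_deriv j (partial_deriv i f)"
      "partial_deriv i (partial_deriv j g) = partial_deriv j (partial_deriv i g)"
      using assms unfolding hess_sym_def by blast+
    then show ?thesis unfolding p by (simp add: fun_eq_iff)
  qed
  then show ?thesis using smooth_fun_mult[OF s] by (simp add: hess_sym_def)
qed

lemma hess_sym_exp_recip:
  assumes "hess_sym g"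
  shows "hess_sym (\<lambda>x. exp_recip p (g x))"
proof -
  have s: "smooth_fun g" using assms by (auto simp: hess_sym_def)
  have "partial_deriv i (partial_deriv j (\<lambda>x. exp_recip p (g x))) = (\<lambda>x. exp_recip (exp_recip_deriv (exp_recip_deriv p)) (g x)
      * partial_deriv i g x * partial_deriv j g x + exp_recip (exp_recip_deriv p) (g x) * partial_deriv i (partial_deriv j g) x)" for i j
    unfolding partial_deriv_exp_recip[OF s]
    by (subst partial_deriv_mult)
      (auto intro!: smooth_fun_differentiable smooth_fun_exp_recip smooth_fun_partial s simp: partial_deriv_exp_recip[OF s])
  moreover have "partial_deriv i (partial_deriv j g) = partial_deriv j (partial_deriv i g)" for i j
    using assms unfolding hess_sym_def by blast
  ultimately have "partial_deriv i (partial_deriv j (\<lambda>x. exp_recip p (g x))) = partial_deriv j (partial_deriv i (\<lambda>x. exp_recip p (g x)))" for i j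
    by (simp add: fun_eq_iff mult_ac)
  then show ?thesis using smooth_fun_exp_recip[OF s] by (simp add: hess_sym_def)
qed

lemma hess_sym_prod: "finite I \<Longrightarrow> (\<And>k. k \<in> I \<Longrightarrow> hess_sym (f k)) \<Longrightarrow> hess_sym (\<lambda>x. \<Prod>k\<in>I. f k x)"
  by (induction I rule: finite_induct) (auto intro: hess_sym_const hess_sym_mult)

text \<open>Smooth approximations of the indicator of the open box from inside: bump(n t) tends to 1
  for t > 0 and vanishes for t \<le> 0.\<close>

definition box_bump :: "nat \<Rightarrow> real^'n \<Rightarrow> real^'n \<Rightarrow> real^'n \<Rightarrow> real" where
  "box_bump n a b x = (\<Prod>k\<in>UNIV. bump (real (Suc n) * (x $ k - a $ k)) * bump (real (Suc n) * (b $ k - x $ k)))"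

lemma hess_sym_box_bump: "hess_sym (box_bump n a b)"
proof -
  have "hess_sym (\<lambda>x. exp_recip 1 (real (Suc n) * x $ k + (- real (Suc n) * a $ k))
        * exp_recip 1 ((- real (Suc n)) * x $ k + real (Suc n) * b $ k))" for k
    by (intro hess_sym_mult hess_sym_exp_recip hess_sym_affine)
  from hess_sym_prod[OF finite this] show ?thesis
    unfolding box_bump_def[abs_def] bump_def by (simp add: algebra_simps)
qed

lemma box_bump_zero: "x \<notin> box a b \<Longrightarrow> box_bump n a b x = 0"
proof -
  assume "x \<notin> box a b"
  then obtain k where "x $ k \<le> a $ k \<or> b $ k \<le> x $ k" by (auto simp: mem_box_cart not_less)
  then have "bump (real (Suc n) * (x $ k - a $ k)) * bump (real (Suc n) * (b $ k - x $ k)) = 0"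
    by (auto simp: bump_simps(4) mult_nonneg_nonpos)
  then show ?thesis unfolding box_bump_def by (intro prod_zero) auto
qed

lemma box_bump_bounds: "0 \<le> box_bump n a b x" "box_bump n a b x \<le> 1"
  unfolding box_bump_def by (auto intro!: prod_nonneg prod_le_1 mult_nonneg_nonneg mult_le_one bump_nonneg bump_le_1)

lemma bump_scale_tendsto: "0 < t \<Longrightarrow> (\<lambda>n. bump (real (Suc n) * t)) \<longlonglongrightarrow> 1"
proof -
  assume t: "0 < t"
  have "(\<lambda>n. exp (- (inverse (real (Suc n)) / t))) \<longlonglongrightarrow> exp (- (0 / t))"
    by (intro tendsto_intros LIMSEQ_inverse_real_of_nat) (use t in auto)
  moreover have "bump (real (Suc n) * t) = exp (- (inverse (real (Suc n)) / t))" for n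
    using bump_simps(1)[of "real (Suc n) * t"] t by (simp add: divide_inverse del: of_nat_Suc)
  ultimately show ?thesis by simp
qed

lemma box_bump_tendsto: "(\<lambda>n. box_bump n a b x) \<longlonglongrightarrow> indicator (box a b) x"
proof (cases "x \<in> box a b")
  case True
  have "(\<lambda>n. \<Prod>k\<in>UNIV. bump (real (Suc n) * (x $ k - a $ k)) * bump (real (Suc n) * (b $ k - x $ k)))
      \<longlonglongrightarrow> (\<Prod>k\<in>(UNIV::'a set). 1 * 1)"
    by (intro tendsto_prod tendsto_mult bump_scale_tendsto) (use True in \<open>auto simp: mem_box_cart\<close>)
  then show ?thesis using True by (simp add: box_bump_def)
qed (simp add: box_bump_zero)

text \<open>Lebesgue differentiation along cubes with corner x: for almost every x the means over
  the cubes tend to f x, and small cubes lie in the ball, where all means are 0.\<close>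

lemma AE_eq_0_of_small_boxes:
  fixes f :: "real^'n \<Rightarrow> real"
  assumes f: "integrable lebesgue f"
    and box: "\<And>a b. cbox a b \<subseteq> ball 0 r \<Longrightarrow> (\<integral>x. f x * indicator (box a b) x \<partial>lebesgue) = 0"
  shows "\<exists>N. negligible N \<and> (\<forall>x. norm x < r \<longrightarrow> x \<notin> N \<longrightarrow> f x = 0)"
proof -
  have ai: "f absolutely_integrable_on S" if "S \<in> sets lebesgue" for S
    unfolding set_integrable_def by (rule integrable_mult_indicator[OF that f])
  have fint: "f integrable_on cbox a b" for a b
    using ai[of "cbox a b"] by (simp add: set_lebesgue_integral_eq_integral(1))
  obtain N where N: "negligible N"
    "\<And>x e. \<lbrakk>x \<notin> N; 0 < e\<rbrakk> \<Longrightarrow> \<exists>d>0. \<forall>h. 0 < h \<and> h < d \<longrightarrow>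
        norm (integral (cbox x (x + h *\<^sub>R One)) f /\<^sub>R h ^ DIM(real^'n) - f x) < e"
    using integrable_ccontinuous_explicit[OF fint] by blast
  have "f x = 0" if x: "norm x < r" "x \<notin> N" for x
  proof (rule ccontr)
    assume "f x \<noteq> 0"
    then obtain d where d: "d > 0" "\<And>h. 0 < h \<Longrightarrow> h < d \<Longrightarrow>
        norm (integral (cbox x (x + h *\<^sub>R One)) f /\<^sub>R h ^ DIM(real^'n) - f x) < \<bar>f x\<bar>"
      using N(2)[OF x(2), of "\<bar>f x\<bar>"] by auto
    let ?n = "norm (One :: real^'n)"
    \<comment> \<open>The second entry keeps the diagonal of the cube shorter than r - |x|.\<close>
    define h where "h = min (d / 2) ((r - norm x) / (2 * (?n + 1)))"
    have n0: "0 < 2 * (?n + 1)" by (simp add: add_nonneg_pos)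
    have h: "0 < h" "h < d" using d x n0 by (auto simp: h_def)
    have "h * ?n < r - norm x"
    proof -
      have "h * (2 * (?n + 1)) \<le> r - norm x"
        using n0 by (subst pos_le_divide_eq[symmetric]) (auto simp: h_def)
      moreover have "h * ?n < h * (2 * (?n + 1))" using h by (intro mult_strict_left_mono) (auto simp: add_nonneg_pos)
      ultimately show ?thesis by linarith
    qed
    have sub: "cbox x (x + h *\<^sub>R One) \<subseteq> ball 0 r"
    proof
      fix y assume y: "y \<in> cbox x (x + h *\<^sub>R One)"
      have "norm (y - x) \<le> norm (h *\<^sub>R (One :: real^'n))"
      proof (rule norm_le_componentwise)
        fix b :: "real^'n" assume b: "b \<in> Basis"
        then have "x \<bullet> b \<le> y \<bullet> b" "y \<bullet> b \<le> x \<bullet> b + h" using y by (auto simp: mem_box inner_simps)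
        then show "\<bar>(y - x) \<bullet> b\<bar> \<le> \<bar>h *\<^sub>R One \<bullet> b\<bar>" using b h by (simp add: inner_diff_left)
      qed
      then have "norm y < r"
        using \<open>h * ?n < r - norm x\<close> h norm_triangle_sub[of y x] by simp
      then show "y \<in> ball 0 r" by simp
    qed
    have "integral (cbox x (x + h *\<^sub>R One)) f = integral (box x (x + h *\<^sub>R One)) f"
      by (rule integral_open_interval[symmetric])
    also have "\<dots> = (LINT y:box x (x + h *\<^sub>R One)|lebesgue. f y)"
      by (rule set_lebesgue_integral_eq_integral(2)[symmetric]) (rule ai, simp)
    also have "\<dots> = 0" using box[OF sub] by (simp add: set_lebesgue_integral_def mult.commute)
    finally show False using d(2)[OF h] by simp
  qed
  with N(1) show ?thesis by blast
qed

text \<open>The entries (i, j) and (j, i) act alike on test functions with symmetric Hessian, and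
  \<open>box_bump\<close> carries this over to integrals over boxes. Ellipticity is assumed at
  symmetric matrices, so the coefficients are elliptic almost everywhere by this result.\<close>

lemma weak_hessian_symmetric:
  fixes H :: "real^'n \<Rightarrow> real^'n^'n"
  assumes "weak_hessian (ball 0 1) u H"
  shows "\<exists>Z. negligible Z \<and> (\<forall>x. norm x < 1 \<longrightarrow> x \<notin> Z \<longrightarrow> H x \<in> sym_mats)"
proof -
  have wd: "weak_deriv (ball 0 1) [i, j] u (\<lambda>x. H x $ i $ j)" for i j
    using assms by (simp add: weak_hessian_def)
  have local: "\<exists>N. negligible N \<and> (\<forall>x. norm x < r \<longrightarrow> x \<notin> N \<longrightarrow> H x $ i $ j = H x $ j $ i)" if r: "r < 1" for r i j
  proof -
    \<comment> \<open>The entries are integrable on compact subsets only; the cut at radius r makes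
      them integrable on the whole space.\<close>
    define G where "G i j x = indicator (cball 0 r) x * H x $ i $ j" for i j x
    have Gi: "integrable lebesgue (G i j)" for i j
    proof -
      have "integrable (lebesgue_on (cball 0 r)) (\<lambda>x. H x $ i $ j)"
      proof -
        have "compact (cball (0::real^'n) r)" "cball (0::real^'n) r \<subseteq> ball 0 1" using r by auto
        then show ?thesis using wd[of i j] unfolding weak_deriv_def loc_integrable_def by blast
      qed
      then show ?thesis by (subst (asm) integrable_restrict_space) (auto simp: G_def[abs_def])
    qed
    have "(\<integral>x. (G i j x - G j i x) * indicator (box a b) x \<partial>lebesgue) = 0" if ab: "cbox a b \<subseteq> ball 0 r" for a b
    proof -
      let ?\<phi> = "\<lambda>n. box_bump n a b"
      have sm: "smooth_fun (?\<phi> n)" for n using hess_sym_box_bump by (auto simp: hess_sym_def)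
      have test: "test_fun (ball 0 1) (?\<phi> n)" for n
      proof -
        have "closure {x. ?\<phi> n x \<noteq> 0} \<subseteq> cbox a b"
        proof (rule closure_minimal)
          show "{x. ?\<phi> n x \<noteq> 0} \<subseteq> cbox a b" using box_bump_zero box_subset_cbox by blast
        qed auto
        moreover from this have "compact (closure {x. ?\<phi> n x \<noteq> 0})"
          by (meson bounded_cbox bounded_subset closed_closure compact_eq_bounded_closed)
        moreover have "ball (0::real^'n) r \<subseteq> ball 0 1" using r by auto
        ultimately show ?thesis using sm ab unfolding test_fun_def by blast
      qed
      have eq: "(LINT x|lebesgue_on (ball 0 1). H x $ i $ j * ?\<phi> n x) = (\<integral>x. G i j x * ?\<phi> n x \<partial>lebesgue)" for n i j
      proof -
        have "(LINT x|lebesgue_on (ball 0 1). H x $ i $ j * ?\<phi> n x)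
           = (\<integral>x. indicator (ball 0 1) x *\<^sub>R (H x $ i $ j * ?\<phi> n x) \<partial>lebesgue)"
          by (rule integral_restrict_space) simp
        also have "\<dots> = (\<integral>x. G i j x * ?\<phi> n x \<partial>lebesgue)"
        proof (intro Bochner_Integration.integral_cong refl)
          fix x
          show "indicator (ball 0 1) x *\<^sub>R (H x $ i $ j * ?\<phi> n x) = G i j x * ?\<phi> n x"
          proof (cases "x \<in> box a b")
            case True
            then have "x \<in> ball 0 r" using ab box_subset_cbox by blast
            then show ?thesis using r by (simp add: G_def)
          qed (simp add: box_bump_zero)
        qed
        finally show ?thesis .
      qed
      have \<phi>m: "?\<phi> n \<in> borel_measurable lebesgue" for n
        by (intro measurable_completion) (simp add: borel_measurable_continuous_onI[OF smooth_fun_continuous[OF sm]])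
      have Gphi: "integrable lebesgue (\<lambda>x. G i j x * ?\<phi> n x)" for n i j
        by (rule integrable_mult_AE_bounded[where b=1, OF Gi \<phi>m]) (simp add: box_bump_bounds)
      have zero: "(\<integral>x. (G i j x - G j i x) * ?\<phi> n x \<partial>lebesgue) = 0" for n
      proof -
        have "(LINT x|lebesgue_on (ball 0 1). H x $ i $ j * ?\<phi> n x) = (LINT x|lebesgue_on (ball 0 1). H x $ j $ i * ?\<phi> n x)"
        proof -
          have "partial_derivs [i, j] (?\<phi> n) = partial_derivs [j, i] (?\<phi> n)"
            using hess_sym_box_bump[of n a b] by (simp add: hess_sym_def)
          moreover have "(LINT x|lebesgue_on (ball 0 1). u x * partial_derivs [i, j] (?\<phi> n) x) = (LINT x|lebesgue_on (ball 0 1). H x $ i $ j * ?\<phi> n x)" for i j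
            using wd[of i j] test[of n] unfolding weak_deriv_def by (simp del: partial_derivs.simps)
          ultimately show ?thesis by metis
        qed
        then show ?thesis unfolding eq using Gphi by (simp add: left_diff_distrib)
      qed
      have "(\<lambda>n. \<integral>x. (G i j x - G j i x) * ?\<phi> n x \<partial>lebesgue) \<longlonglongrightarrow> (\<integral>x. (G i j x - G j i x) * indicator (box a b) x \<partial>lebesgue)"
      proof (rule integral_dominated_convergence[where w="\<lambda>x. \<bar>G i j x - G j i x\<bar>"])
        show "integrable lebesgue (\<lambda>x. \<bar>G i j x - G j i x\<bar>)" using Gi by simp
        show "AE x in lebesgue. (\<lambda>n. (G i j x - G j i x) * ?\<phi> n x) \<longlonglongrightarrow> (G i j x - G j i x) * indicator (box a b) x"
          by (intro AE_I2 tendsto_intros box_bump_tendsto)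
        show "AE x in lebesgue. norm ((G i j x - G j i x) * ?\<phi> n x) \<le> \<bar>G i j x - G j i x\<bar>" for n
          using box_bump_bounds[of n a b] by (intro AE_I2) (simp add: abs_mult mult_left_le)
        have gm: "(\<lambda>x. G i j x - G j i x) \<in> borel_measurable lebesgue" using Gi by (intro borel_measurable_diff borel_measurable_integrable)
        show "(\<lambda>x. (G i j x - G j i x) * ?\<phi> n x) \<in> borel_measurable lebesgue" for n
          by (intro borel_measurable_times gm \<phi>m)
        show "(\<lambda>x. (G i j x - G j i x) * indicator (box a b) x) \<in> borel_measurable lebesgue"
          by (intro borel_measurable_times gm borel_measurable_indicator) simp
      qed
      then show ?thesis unfolding zero by (simp add: LIMSEQ_const_iff)
    qed
    from AE_eq_0_of_small_boxes[OF Bochner_Integration.integrable_diff[OF Gi Gi] this]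
    obtain N where "negligible N" "\<And>x. norm x < r \<Longrightarrow> x \<notin> N \<Longrightarrow> G i j x - G j i x = 0" by blast
    then show ?thesis by (intro exI[of _ N]) (auto simp: G_def)
  qed
  \<comment> \<open>The radii 1 - 1/(n + 1) exhaust the unit ball, and countably many exceptional
    sets remain negligible.\<close>
  have "\<forall>n i j. \<exists>N. negligible N \<and> (\<forall>x. norm x < 1 - inverse (real (Suc n)) \<longrightarrow> x \<notin> N \<longrightarrow> H x $ i $ j = H x $ j $ i)"
    by (intro allI local) simp
  then obtain N where N: "\<And>n i j. negligible (N n i j)"
    "\<And>n i j x. norm x < 1 - inverse (real (Suc n)) \<Longrightarrow> x \<notin> N n i j \<Longrightarrow> H x $ i $ j = H x $ j $ i" by metis
  define Z where "Z = (\<Union>n. \<Union>i\<in>UNIV. \<Union>j\<in>UNIV. N n i j)"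
  have Z: "negligible Z" unfolding Z_def
    by (intro negligible_countable_Union countable_UN negligible_Union) (auto intro!: negligible_Union N)
  have "H x \<in> sym_mats" if x: "norm x < 1" "x \<notin> Z" for x
  proof -
    obtain n where "inverse (real (Suc n)) < 1 - norm x" using reals_Archimedean[of "1 - norm x"] x(1) by auto
    then have "norm x < 1 - inverse (real (Suc n))" by linarith
    then have "H x $ i $ j = H x $ j $ i" for i j using N(2) x(2) unfolding Z_def by blast
    then show ?thesis by (simp add: transpose_def vec_eq_iff sym_mats_def)
  qed
  with Z show ?thesis by (intro exI[of _ Z]) simp
qed

text \<open>Local integrability gives measurability on closed balls of radius below 1, and the
  entries are pointwise limits of their cuts to such balls.\<close>

lemma weak_hessian_measurable:
  fixes H :: "real^'n \<Rightarrow> real^'n^'n"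
  assumes "weak_hessian (ball 0 1) u H"
  shows "H \<in> borel_measurable (lebesgue_on (ball 0 1))"
proof -
  have comp: "(\<lambda>x. H x $ i $ j) \<in> borel_measurable (lebesgue_on (ball 0 1))" for i j
  proof -
    define r where "r n = 1 - inverse (real (Suc n))" for n
    have r: "r n < 1" for n by (simp add: r_def)
    have meas: "(\<lambda>x. indicator (cball 0 (r n)) x *\<^sub>R H x $ i $ j) \<in> borel_measurable lebesgue" for n
    proof -
      have "compact (cball (0::real^'n) (r n))" "cball (0::real^'n) (r n) \<subseteq> ball 0 1"
        by (auto intro: le_less_trans[OF _ r])
      then have "integrable (lebesgue_on (cball 0 (r n))) (\<lambda>x. H x $ i $ j)"
        using assms unfolding weak_hessian_def weak_deriv_def loc_integrable_def by blast
      then have "integrable lebesgue (\<lambda>x. indicator (cball 0 (r n)) x *\<^sub>R H x $ i $ j)"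
        by (subst (asm) integrable_restrict_space) auto
      then show ?thesis by (rule borel_measurable_integrable)
    qed
    have "(\<lambda>n. indicator (cball 0 (r n)) x *\<^sub>R H x $ i $ j) \<longlonglongrightarrow> indicator (ball 0 1) x *\<^sub>R H x $ i $ j" for x
    proof (cases "norm x < 1")
      case True
      have "r \<longlonglongrightarrow> 1 - 0" unfolding r_def[abs_def] by (intro tendsto_intros LIMSEQ_inverse_real_of_nat)
      then have "\<forall>\<^sub>F n in sequentially. norm x < r n" using True by (intro order_tendstoD(1)) auto
      then have "\<forall>\<^sub>F n in sequentially. indicator (cball 0 (r n)) x *\<^sub>R H x $ i $ j = indicator (ball 0 1) x *\<^sub>R H x $ i $ j"
        by eventually_elim (use True in auto)
      then show ?thesis by (rule tendsto_eventually)
    next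
      case False
      then have "\<not> norm x \<le> r n" for n using r[of n] by linarith
      then show ?thesis using False by simp
    qed
    from borel_measurable_LIMSEQ_real[OF this meas]
    have "(\<lambda>x. indicator (ball 0 1) x *\<^sub>R H x $ i $ j) \<in> borel_measurable lebesgue" .
    then have "(\<lambda>x. indicator (ball 0 1) x *\<^sub>R H x $ i $ j) \<in> borel_measurable (lebesgue_on (ball 0 1))"
      by (rule measurable_restrict_space1)
    then show ?thesis
      by (rule measurable_cong[THEN iffD1, rotated]) (simp add: space_restrict_space)
  qed
  show ?thesis
  proof (subst borel_measurable_euclidean_space, intro ballI)
    fix b :: "real^'n^'n" assume "b \<in> Basis"
    then obtain i j where "b = axis i (axis j 1)" by (auto simp: Basis_vec_def)
    then show "(\<lambda>x. H x \<bullet> b) \<in> borel_measurable (lebesgue_on (ball 0 1))"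
      using comp[of i j] by (simp add: inner_axis)
  qed
qed

section \<open>Symmetry and measurability of the coefficients\<close>

lemma mat_partial_commute: "mat_partial F i j = mat_partial F j i"
proof -
  have "sym_unit i j = sym_unit j i" by (simp add: sym_unit_def vec_eq_iff add.commute)
  then show ?thesis by (simp add: mat_partial_def fun_eq_iff)
qed

lemma closed_sym_mats: "closed (sym_mats :: (real^'n^'n) set)"
proof -
  have eq: "(sym_mats :: (real^'n^'n) set) = (\<Inter>i. \<Inter>j. {M. M $ j $ i = M $ i $ j})"
    by (auto simp: sym_mats_def transpose_def vec_eq_iff)
  show ?thesis
    unfolding eq by (intro closed_INT ballI closed_Collect_eq continuous_intros)
qed

text \<open>The continuity of \<open>mat_partial F i j\<close> is known on symmetric matrices. Cut
  off by their indicator it is Borel on all matrices, and the composition with H changes only where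
  H is not symmetric, a negligible set.\<close>

lemma measurable_coefficients:
  fixes H :: "real^'n \<Rightarrow> real^'n^'n"
  assumes H: "weak_hessian (ball 0 1) u H" and F: "continuous_on sym_mats (mat_partial F i j)"
  shows "(\<lambda>x. mat_partial F i j (H x)) \<in> borel_measurable (lebesgue_on (ball 0 1))"
proof -
  obtain Z where Z: "negligible Z" "\<And>x. norm x < 1 \<Longrightarrow> x \<notin> Z \<Longrightarrow> H x \<in> sym_mats"
    using weak_hessian_symmetric[OF H] by blast
  have "(\<lambda>M. indicator sym_mats M *\<^sub>R mat_partial F i j M) \<in> borel_measurable borel"
    by (rule borel_measurable_continuous_on_indicator) (use F borel_closed[OF closed_sym_mats] in auto)
  from measurable_compose[OF weak_hessian_measurable[OF H] this]
  have "(\<lambda>x. indicator sym_mats (H x) *\<^sub>R mat_partial F i j (H x)) measurable_on ball 0 1"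
    by (simp add: measurable_on_iff_borel_measurable)
  then have "(\<lambda>x. mat_partial F i j (H x)) measurable_on ball 0 1"
    by (rule measurable_on_spike[OF _ Z(1)]) (use Z(2) in auto)
  then show ?thesis by (simp add: measurable_on_iff_borel_measurable)
qed

section \<open>The estimate\<close>

text \<open>\<open>real_of_ereal\<close> sends infinite values to 0, so the essential supremum has
  to be shown finite first: boundedness of f bounds it above, and the positive measure of the ball
  makes it at least 0.\<close>

lemma Linf_norm_bound:
  fixes f :: "real^'n \<Rightarrow> real"
  assumes f: "f \<in> borel_measurable (lebesgue_on (ball 0 1))" and b: "bounded (f ` ball 0 1)"
  shows "0 \<le> Linf_norm (ball 0 1) f" "AE x in lebesgue_on (ball 0 1). \<bar>f x\<bar> \<le> Linf_norm (ball 0 1) f"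
proof -
  let ?M = "lebesgue_on (ball (0::real^'n) 1)"
  let ?s = "esssup ?M (\<lambda>x. ereal \<bar>f x\<bar>)"
  have m: "(\<lambda>x. ereal \<bar>f x\<bar>) \<in> borel_measurable ?M" using f by simp
  obtain B where "\<forall>y\<in>f ` ball 0 1. norm y \<le> B" using b unfolding bounded_iff by blast
  then have B: "\<bar>f x\<bar> \<le> B" if "x \<in> ball 0 1" for x using that by auto
  have "?s \<le> ereal B"
    using m by (rule esssup_I) (rule AE_I2, simp add: B space_restrict_space)
  moreover have "0 \<le> ?s"
  proof -
    have "unit_ball_vol (real CARD('n)) \<noteq> 0"
      using unit_ball_vol_pos[of "real CARD('n)"] by (metis less_irrefl of_nat_0_le_iff)
    then have "emeasure ?M (space ?M) \<noteq> 0"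
      using content_ball[of 1 "0::real^'n"]
      by (auto simp: emeasure_restrict_space space_restrict_space measure_def)
    then have "(0::ereal) = esssup ?M (\<lambda>x. 0)" by (simp add: esssup_const)
    also have "\<dots> \<le> ?s" by (rule esssup_mono) simp_all
    finally show ?thesis .
  qed
  ultimately have s: "ereal (real_of_ereal ?s) = ?s" "0 \<le> ?s" by (auto intro: ereal_real')
  then show "0 \<le> Linf_norm (ball 0 1) f" by (simp add: Linf_norm_def real_of_ereal_pos)
  show "AE x in ?M. \<bar>f x\<bar> \<le> Linf_norm (ball 0 1) f"
    using esssup_AE[of "\<lambda>x. ereal \<bar>f x\<bar>" ?M]
  proof eventually_elim
    case (elim x)
    then show ?case using s(1) unfolding Linf_norm_def by (metis ereal_less_eq(3))
  qed
qed

theorem lemma3: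
  fixes lam Lam :: real
  assumes "CARD('n::finite) \<ge> 2" and "0 < lam" and "lam \<le> Lam"
  shows "\<exists>C1>0. \<exists>C2>0.
    \<forall>(nrm :: real^'n^'n \<Rightarrow> real) (F :: real^'n^'n \<Rightarrow> real) (u :: real^'n \<Rightarrow> real)
      (D2u :: real^'n \<Rightarrow> real^'n^'n) (f :: real^'n \<Rightarrow> real) (m :: real^'n \<Rightarrow> real).
      norm_on_sym nrm \<and>
      C1_on_sym F \<and> F 0 = 0 \<and>
      uniformly_elliptic nrm lam Lam F \<and>
      elliptic_coeffs lam Lam F \<and>
      (\<forall>i j. \<exists>L. L-lipschitz_on sym_mats (mat_partial F i j)) \<and>
      sobolev_Wk1_loc 2 (ball 0 1) u \<and> weak_hessian (ball 0 1) u D2u \<and>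
      f \<in> borel_measurable (lebesgue_on (ball 0 1)) \<and> bounded (f ` ball 0 1) \<and>
      in_Lp 1 (ball 0 1) m \<and> (AE x in lebesgue_on (ball 0 1). 0 \<le> m x) \<and>
      weak_adjoint_solution (ball 0 1) F D2u m f
      \<longrightarrow>
      in_Lp (real CARD('n) / (real CARD('n) - 1)) (ball 0 (1/2)) m \<and>
      Lp_norm (real CARD('n) / (real CARD('n) - 1)) (ball 0 (1/2)) m
        \<le> C1 * Lp_norm 1 (ball 0 (1/2)) m + C2 * Linf_norm (ball 0 1) f"
proof -
  let ?M = "lebesgue_on (ball (0::real^'n) 1)"
  let ?ind = "\<lambda>x::real^'n. indicator (ball 0 (1/2)) x :: real"
  define p where "p = real CARD('n) / (real CARD('n) - 1)"
  have p: "0 < p" using assms by (simp add: p_def)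
  obtain C where C: "C > 0" and main: "\<And>(a :: real^'n \<Rightarrow> 'n \<Rightarrow> 'n \<Rightarrow> real) m f B g N.
    adjoint_solution lam Lam a m f B \<Longrightarrow>
    continuous_on UNIV g \<Longrightarrow> (\<forall>x. 0 < g x) \<Longrightarrow> 0 < N \<Longrightarrow>
    (\<integral>x. indicator (ball 0 1) x * g x ^ CARD('n) \<partial>lborel) \<le> N ^ CARD('n) \<Longrightarrow>
    (\<integral>x. m x * (?ind x * g x) \<partial>?M) \<le> C * N * ((\<integral>x. m x * ?ind x \<partial>?M) + B)"
    using weighted_integral_le[OF assms(2,3), where 'n='n] by blast
  \<comment> \<open>C comes from the pairing with continuous weights and 2 from
    \<open>Lp_of_duality\<close>; the same constant serves both terms.\<close>
  have pos: "0 < 2 * C" using C by simp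
  show ?thesis
  proof (rule exI[of _ "2 * C"], rule conjI[OF pos], rule exI[of _ "2 * C"], rule conjI[OF pos],
      intro allI impI, goal_cases)
    case (1 nrm F u D2u f m)
    then have C1: "C1_on_sym F" and ell: "elliptic_coeffs lam Lam F" and H: "weak_hessian (ball 0 1) u D2u"
      and f: "f \<in> borel_measurable ?M" "bounded (f ` ball 0 1)" and m: "in_Lp 1 (ball 0 1) m"
      and m0: "AE x in ?M. 0 \<le> m x" and weak: "weak_adjoint_solution (ball 0 1) F D2u m f"
      by blast+
    define B where "B = Linf_norm (ball 0 1) f"
    have B: "0 \<le> B" "AE x in ?M. \<bar>f x\<bar> \<le> B" using Linf_norm_bound[OF f] by (auto simp: B_def)
    have mm: "m \<in> borel_measurable ?M" using m by (simp add: in_Lp_def)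
    have mabs: "integrable ?M (\<lambda>x. \<bar>m x\<bar>)" using m by (simp add: in_Lp_def)
    then have mi: "integrable ?M m" using integrable_abs_cancel[OF _ mm] by simp
    have indm: "?ind \<in> borel_measurable ?M"
      by (intro borel_measurable_indicator) (auto simp: sets_restrict_space_iff)
    obtain Z where Z: "negligible Z" "\<And>x. norm x < 1 \<Longrightarrow> x \<notin> Z \<Longrightarrow> D2u x \<in> sym_mats"
      using weak_hessian_symmetric[OF H] by blast
    have "AE x in lebesgue. x \<notin> Z"
      using Z(1) by (intro AE_not_in) (simp add: negligible_iff_null_sets)
    then have "AE x in ?M. x \<notin> Z" by (subst AE_restrict_space_iff) auto
    moreover have "AE x in ?M. norm x < 1" by (rule AE_I2) (simp add: space_restrict_space)
    ultimately have ell_ae: "AE x in ?M. elliptic lam Lam (\<lambda>i j. mat_partial F i j (D2u x))"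
    proof eventually_elim
      case (elim x)
      have "mat_partial F i j (D2u x) = mat_partial F j i (D2u x)" for i j
        by (simp add: mat_partial_commute[of F i j])
      then show ?case using ell Z(2)[OF elim(2,1)] unfolding elliptic_def elliptic_coeffs_def by blast
    qed
    have meas_a: "\<forall>i j. (\<lambda>x. mat_partial F i j (D2u x)) \<in> borel_measurable ?M"
      using C1 by (intro allI measurable_coefficients[OF H]) (simp add: C1_on_sym_def)
    have sol: "adjoint_solution lam Lam (\<lambda>x i j. mat_partial F i j (D2u x)) m f B"
      unfolding adjoint_solution_def Let_def
      using meas_a ell_ae mi m0 f(1) B weak unfolding weak_adjoint_solution_def by blast
    define I1 where "I1 = (\<integral>x. m x * ?ind x \<partial>?M)"
    define Cst where "Cst = C * (I1 + B)"
    have I1: "0 \<le> I1" unfolding I1_def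
      by (rule integral_nonneg_AE) (use m0 in \<open>auto simp: indicator_def\<close>)
    have Cst: "0 \<le> Cst" using C I1 B by (simp add: Cst_def)
    \<comment> \<open>As m is nonnegative only almost everywhere, |m| is used to make w nonnegative
      at every point, as the duality lemmas require.\<close>
    define w where "w x = ?ind x * \<bar>m x\<bar>" for x
    have wball: "indicator (ball 0 1) x *\<^sub>R (w x * c) = w x * c" for x c
      by (auto simp: w_def indicator_def)
    have w: "integrable lebesgue w"
    proof -
      have "integrable ?M (\<lambda>x. \<bar>m x\<bar> * ?ind x)"
        by (rule integrable_mult_AE_bounded[where b=1, OF mabs indm]) (auto simp: indicator_def)
      then have "integrable lebesgue (\<lambda>x. indicator (ball 0 1) x *\<^sub>R (\<bar>m x\<bar> * ?ind x))"
        by (subst (asm) integrable_restrict_space) auto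
      moreover have "(\<lambda>x. indicator (ball 0 1) x *\<^sub>R (\<bar>m x\<bar> * ?ind x)) = w"
        by (auto simp: w_def indicator_def fun_eq_iff)
      ultimately show ?thesis by simp
    qed
    have w0: "0 \<le> w x" "1/2 \<le> norm x \<Longrightarrow> w x = 0" for x by (auto simp: w_def)
    have to_M: "(\<integral>x. w x * g x \<partial>lebesgue) = (\<integral>x. m x * (?ind x * g x) \<partial>?M)"
      if g: "g \<in> borel_measurable ?M" for g
    proof -
      have "(\<integral>x. w x * g x \<partial>lebesgue) = (\<integral>x. w x * g x \<partial>?M)"
        by (subst integral_restrict_space) (simp_all only: wball, simp)
      also have "\<dots> = (\<integral>x. m x * (?ind x * g x) \<partial>?M)"
      proof (rule integral_cong_AE)
        show "(\<lambda>x. w x * g x) \<in> borel_measurable ?M"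
          unfolding w_def by (intro borel_measurable_times indm borel_measurable_abs mm g)
        show "(\<lambda>x. m x * (?ind x * g x)) \<in> borel_measurable ?M"
          by (intro borel_measurable_times indm mm g)
        show "AE x in ?M. w x * g x = m x * (?ind x * g x)"
          using m0 by eventually_elim (simp add: w_def)
      qed
      finally show ?thesis .
    qed
    have test: "(\<integral>x. w x * g x \<partial>lebesgue) \<le> Cst * N"
      if g: "continuous_on UNIV g" "\<forall>x. 0 < g x" "0 < N"
        "(\<integral>x. indicator (ball 0 1) x * g x ^ CARD('n) \<partial>lborel) \<le> N ^ CARD('n)" for g N
    proof -
      have "g \<in> borel_measurable ?M" by (rule measurable_lebesgue_on_continuous[OF g(1)]) simp
      from to_M[OF this] have "(\<integral>x. w x * g x \<partial>lebesgue) = (\<integral>x. m x * (?ind x * g x) \<partial>?M)" .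
      also have "\<dots> \<le> C * N * (I1 + B)"
        unfolding I1_def
        by (rule main[OF sol g])
      finally show ?thesis by (simp add: Cst_def mult_ac)
    qed
    note Lp = Lp_of_duality[OF w w0 Cst test assms(1), folded p_def]
    have wp: "w x powr p = indicator (ball 0 (1/2)) x *\<^sub>R (\<bar>m x\<bar> powr p)" for x
      using p by (simp add: w_def indicator_def)
    have m_half: "m \<in> borel_measurable (lebesgue_on (ball 0 (1/2)))"
      using mm by (rule measurable_restrict_mono) auto
    have half: "ball (0::real^'n) (1/2) \<inter> space lebesgue \<in> sets lebesgue" by auto
    have int: "integrable (lebesgue_on (ball 0 (1/2))) (\<lambda>x. \<bar>m x\<bar> powr p)"
      using Lp(1) unfolding wp by (rule integrable_restrict_space[THEN iffD2, OF half])
    have L1: "Lp_norm 1 (ball 0 (1/2)) m = I1"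
    proof -
      have "(LINT x|lebesgue_on (ball 0 (1/2)). \<bar>m x\<bar>) = (\<integral>x. ?ind x *\<^sub>R \<bar>m x\<bar> \<partial>lebesgue)"
        by (rule integral_restrict_space[OF half])
      also have "\<dots> = (\<integral>x. w x * 1 \<partial>lebesgue)" by (simp add: w_def)
      also have "\<dots> = I1" unfolding I1_def by (subst to_M) simp_all
      finally show ?thesis using I1 by (simp add: Lp_norm_def)
    qed
    have "(LINT x|lebesgue_on (ball 0 (1/2)). \<bar>m x\<bar> powr p) = (\<integral>x. w x powr p \<partial>lebesgue)"
      unfolding wp by (rule integral_restrict_space[OF half])
    then have "Lp_norm p (ball 0 (1/2)) m = (\<integral>x. w x powr p \<partial>lebesgue) powr (1 / p)"
      by (simp add: Lp_norm_def)
    also have "\<dots> \<le> ((2 * Cst) powr p) powr (1 / p)"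
      using p by (intro powr_mono2[OF _ _ Lp(2)] Bochner_Integration.integral_nonneg) simp_all
    also have "\<dots> = 2 * Cst" using Cst p by (simp add: powr_powr)
    finally have "Lp_norm p (ball 0 (1/2)) m \<le> 2 * C * Lp_norm 1 (ball 0 (1/2)) m + 2 * C * Linf_norm (ball 0 1) f"
      by (simp add: Cst_def L1 B_def algebra_simps)
    then show ?case using m_half int by (simp add: in_Lp_def flip: p_def)
  qed
qed

end
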